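(* Let $M$ be Hrushovski's countable non-collapsed structure for a symmetric ternary relation $R$ and let $M_s$ be its $S$-reduct, regarded as an $S$-structure. Let $\mathfrak{C}_s$ be the category whose objects are the elements of the age $\mathcal{C}_s$ of $M_s$ (the class of finite $S$-structures isomorphic to a substructure of $M_s$) and whose morphisms are the strong embeddings. Then $M_s$ is the Fraïssé limit of $\mathfrak{C}_s$.
   Context: The structure $M$. An $R$-structure is a set with a symmetric ternary relation $R$ holding only of triples of pairwise distinct elements. For finite $A$, $d_0(A)=|A|-r(A)$ where $r(A)$ is the number of three-element subsets $\{x,y,z\}\subseteq A$ with $R(x,y,z)$. For finite $A\subseteq N$, $A\leqslant N$ means $d_0(B)\ge d_0(A)$ for all finite $B$ with $A\subseteq B\subseteq N$. $\mathcal{C}$ is the class of finite $R$-structures $A$ with $\emptyset\leqslant A$. $M$ is the unique (up to isomorphism) countable $R$-structure all of whose finite substructures lie in $\mathcal{C}$ and such that whenever $A\leqslant M$ is finite and $A\leqslant B\in\mathcal{C}$ there is an embedding $f:B\to M$ over $A$ with $f(B)\leqslant M$. $S$-structures. An $S$-structure is a set $A$ with a family $C(A)$ of subsets of $A$ of size $\ge 3$ (declared maximal cliques) and a function $\mathfrak{m}_A:C(A)\to\{1,2,3\}$ (pre-multiplicity) which is valid: putting $m_A(X)=\sum_{C\in C(A),X\subseteq C}\mathfrak{m}_A(C)$ for $X\subseteq A$ with $|X|\ge3$ (and $m_A(X)=0$ if $|X|<3$), one has $m_A(X)\le 1+\frac{2}{|X|-2}$ whenever $|X|\ge 3$. A subset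 $A'\subseteq A$ carries the induced structure $C(A')=\{C\cap A':C\in C(A),|C\cap A'|\ge3\}$, $\mathfrak{m}_{A'}(D)=\sum_{C\in C(A),C\cap A'=D}\mathfrak{m}_A(C)$; these are the substructures. An embedding is an injection that is an isomorphism (preserving cliques and multiplicities both ways) onto the induced structure on its image. For finite $A$, $d_{0s}(A)=|A|-\sum_{C\in C(A)}\mathfrak{m}_A(C)(|C|-2)$. For a finite substructure $A\subseteq N$, $A\leqslant_s N$ ("strong") means $d_{0s}(D)\ge d_{0s}(A)$ for every finite $D$ with $A\subseteq D\subseteq N$; an embedding is strong if its image is strong in the target. $M_s$ is the $S$-structure with universe $M$, $C(M_s)$ the family of sets $\{c\in M:R(c,x,y)\}$ ($x\ne y$ in $M$) with at least $3$ elements, and $\mathfrak{m}(C)$ the number of unordered pairs $\{x,y\}$ with $C=\{c:R(c,x,y)\}$. (This is the reduct of $M$ to $S(x_1,x_2,x_3):=\exists x_4,x_5\bigwedge_{i}R(x_i,x_4,x_5)\wedge\bigwedge_{i\ne j}x_i\neq x_j$, together with multiplicities.) Fraïssé limit of $\mathfrak{C}_s$: the unique (up to isomorphism) countable $S$-structure whose finite substructures are, up to isomorphism, exactly the members of $\mathcal{C}_s$, into which every member of $\mathcal{C}_s$ strongly embeds, and which is homogeneous with respect to strong substructures, i.e. every isomorphism between finite strong substructures extends to an automorphism. *)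

theory Defs
  imports Complex_Main "HOL-Library.Countable_Set"
begin

section \<open>R-structures\<close>

record 'a rstruct =
  runiv :: "'a set"
  rrel :: "'a \<Rightarrow> 'a \<Rightarrow> 'a \<Rightarrow> bool"

text \<open>The two transpositions below generate all permutations of the three arguments.\<close>

definition r_structure :: "('a, 'm) rstruct_scheme \<Rightarrow> bool" where
  "r_structure M \<longleftrightarrow> (\<forall>x y z. rrel M x y z \<longrightarrow>
      x \<in> runiv M \<and> y \<in> runiv M \<and> z \<in> runiv M \<and>
      x \<noteq> y \<and> x \<noteq> z \<and> y \<noteq> z \<and>
      rrel M y x z \<and> rrel M x z y)"

definition r_induced :: "'a rstruct \<Rightarrow> 'a set \<Rightarrow> 'a rstruct" where
  "r_induced M A = \<lparr> runiv = A, rrel = (\<lambda>x y z. x \<in> A \<and> y \<in> A \<and> z \<in> A \<and> rrel M x y z) \<rparr>"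

definition r_triples :: "'a rstruct \<Rightarrow> 'a set set" where
  "r_triples A = {T. \<exists>x y z. T = {x, y, z} \<and> T \<subseteq> runiv A \<and> card T = 3 \<and> rrel A x y z}"

definition d0 :: "'a rstruct \<Rightarrow> int" where
  "d0 A = int (card (runiv A)) - int (card (r_triples A))"

text \<open>\<open>r_strong A N\<close> is the relation \<open>A \<leqslant> N\<close> for a finite substructure of \<open>N\<close>, given by its universe.\<close>

definition r_strong :: "'a set \<Rightarrow> 'a rstruct \<Rightarrow> bool" where
  "r_strong A N \<longleftrightarrow> finite A \<and> A \<subseteq> runiv N \<and>
     (\<forall>B. finite B \<and> A \<subseteq> B \<and> B \<subseteq> runiv N \<longrightarrow> d0 (r_induced N B) \<ge> d0 (r_induced N A))"

definition r_class :: "'a rstruct set" where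
  "r_class = {A. r_structure A \<and> finite (runiv A) \<and> r_strong {} A}"

definition r_embedding :: "('a \<Rightarrow> 'b) \<Rightarrow> 'a rstruct \<Rightarrow> 'b rstruct \<Rightarrow> bool" where
  "r_embedding f A N \<longleftrightarrow> inj_on f (runiv A) \<and> f ` runiv A \<subseteq> runiv N \<and>
     (\<forall>x\<in>runiv A. \<forall>y\<in>runiv A. \<forall>z\<in>runiv A. rrel N (f x) (f y) (f z) \<longleftrightarrow> rrel A x y z)"

text \<open>
  In the extension property the inclusion \<open>A \<leqslant> B\<close> is given up to isomorphism, by a strong
  embedding \<open>g\<close> of \<open>A\<close> into a structure \<open>B\<close> whose universe is a (finite) set of natural numbers;
  ``over \<open>A\<close>'' then means \<open>f (g a) = a\<close>.  Requiring \<open>B\<close> to live on the type of \<open>M\<close> would be too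
  weak, since that type may have no points outside \<open>M\<close>.
\<close>

definition hrushovski_structure :: "'a rstruct \<Rightarrow> bool" where
  "hrushovski_structure M \<longleftrightarrow>
     r_structure M \<and> countable (runiv M) \<and>
     (\<forall>A. finite A \<and> A \<subseteq> runiv M \<longrightarrow> r_induced M A \<in> r_class) \<and>
     (\<forall>A (B :: nat rstruct) g.
        r_strong A M \<and> B \<in> r_class \<and> r_embedding g (r_induced M A) B \<and> r_strong (g ` A) B \<longrightarrow>
        (\<exists>f. r_embedding f B M \<and> (\<forall>a\<in>A. f (g a) = a) \<and> r_strong (f ` runiv B) M))"

section \<open>S-structures\<close>

text \<open>The value of \<open>mult\<close> outside \<open>cliques\<close> is irrelevant and never used.\<close>

record 'a sstruct =
  univ :: "'a set"
  cliques :: "'a set set"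
  mult :: "'a set \<Rightarrow> nat"

text \<open>
  Cliques may be infinite, while \<open>card\<close> is \<open>0\<close> on infinite sets, so ``size at least \<open>3\<close>'' is stated
  as follows.
\<close>

definition at_least3 :: "'a set \<Rightarrow> bool" where
  "at_least3 X \<longleftrightarrow> infinite X \<or> card X \<ge> 3"

definition total_mult :: "'a sstruct \<Rightarrow> 'a set \<Rightarrow> nat" where
  "total_mult A X = (if at_least3 X then (\<Sum>C | C \<in> cliques A \<and> X \<subseteq> C. mult A C) else 0)"

text \<open>
  Multiplicities are positive, so the bound on \<open>m(X)\<close> entails that only finitely many cliques
  contain \<open>X\<close>; this has to be demanded explicitly because a sum over an infinite set is \<open>0\<close> in HOL.
  For infinite \<open>X\<close> the bound is read with \<open>2 / \<infinity> = 0\<close>.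
\<close>

definition valid_mult :: "'a sstruct \<Rightarrow> bool" where
  "valid_mult A \<longleftrightarrow> (\<forall>X. X \<subseteq> univ A \<and> at_least3 X \<longrightarrow>
     finite {C \<in> cliques A. X \<subseteq> C} \<and>
     real (total_mult A X) \<le> 1 + (if finite X then 2 / (real (card X) - 2) else 0))"

definition s_structure :: "'a sstruct \<Rightarrow> bool" where
  "s_structure A \<longleftrightarrow>
     (\<forall>C\<in>cliques A. C \<subseteq> univ A \<and> at_least3 C \<and> mult A C \<in> {1, 2, 3}) \<and> valid_mult A"

definition s_induced :: "'a sstruct \<Rightarrow> 'a set \<Rightarrow> 'a sstruct" where
  "s_induced A A' = \<lparr> univ = A',
     cliques = {C \<inter> A' | C. C \<in> cliques A \<and> at_least3 (C \<inter> A')},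
     mult = (\<lambda>D. \<Sum>C | C \<in> cliques A \<and> C \<inter> A' = D. mult A C) \<rparr>"

definition s_iso :: "('a \<Rightarrow> 'b) \<Rightarrow> 'a sstruct \<Rightarrow> 'b sstruct \<Rightarrow> bool" where
  "s_iso f A B \<longleftrightarrow> bij_betw f (univ A) (univ B) \<and>
     cliques B = (\<lambda>C. f ` C) ` cliques A \<and>
     (\<forall>C\<in>cliques A. mult B (f ` C) = mult A C)"

definition s_embedding :: "('a \<Rightarrow> 'b) \<Rightarrow> 'a sstruct \<Rightarrow> 'b sstruct \<Rightarrow> bool" where
  "s_embedding f A N \<longleftrightarrow> f ` univ A \<subseteq> univ N \<and> s_iso f A (s_induced N (f ` univ A))"

definition d0s :: "'a sstruct \<Rightarrow> int" where
  "d0s A = int (card (univ A)) - (\<Sum>C\<in>cliques A. int (mult A C) * (int (card C) - 2))"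

definition s_strong :: "'a set \<Rightarrow> 'a sstruct \<Rightarrow> bool" where
  "s_strong A N \<longleftrightarrow> finite A \<and> A \<subseteq> univ N \<and>
     (\<forall>D. finite D \<and> A \<subseteq> D \<and> D \<subseteq> univ N \<longrightarrow> d0s (s_induced N D) \<ge> d0s (s_induced N A))"

definition strong_embedding :: "('a \<Rightarrow> 'b) \<Rightarrow> 'a sstruct \<Rightarrow> 'b sstruct \<Rightarrow> bool" where
  "strong_embedding f A N \<longleftrightarrow> s_embedding f A N \<and> s_strong (f ` univ A) N"

text \<open>
  The age is a class closed under isomorphism, and every finite structure has an isomorphic copy
  on a set of natural numbers; it is represented by its members on such sets.
\<close>

definition age :: "'a sstruct \<Rightarrow> nat sstruct set" where
  "age N = {A. s_structure A \<and> finite (univ A) \<and>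
     (\<exists>D f. finite D \<and> D \<subseteq> univ N \<and> s_iso f A (s_induced N D))}"

section \<open>The reduct and the limit\<close>

definition r_line :: "'a rstruct \<Rightarrow> 'a \<Rightarrow> 'a \<Rightarrow> 'a set" where
  "r_line M x y = {c \<in> runiv M. rrel M c x y}"

definition S_reduct :: "'a rstruct \<Rightarrow> 'a sstruct" where
  "S_reduct M = \<lparr> univ = runiv M,
     cliques = {r_line M x y | x y.
        x \<in> runiv M \<and> y \<in> runiv M \<and> x \<noteq> y \<and> at_least3 (r_line M x y)},
     mult = (\<lambda>C. card {{x, y} | x y.
        x \<in> runiv M \<and> y \<in> runiv M \<and> x \<noteq> y \<and> r_line M x y = C}) \<rparr>"

text \<open>
  The defining properties of a Fraisse limit of the category with objects \<open>K\<close> (closed under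
  isomorphism, represented on sets of natural numbers) and with strong embeddings as morphisms.
\<close>

definition fraisse_limit :: "nat sstruct set \<Rightarrow> 'a sstruct \<Rightarrow> bool" where
  "fraisse_limit K N \<longleftrightarrow>
     s_structure N \<and> countable (univ N) \<and>
     age N = K \<and>
     (\<forall>A\<in>K. \<exists>f. strong_embedding f A N) \<and>
     (\<forall>A B f. s_strong A N \<and> s_strong B N \<and> s_iso f (s_induced N A) (s_induced N B) \<longrightarrow>
        (\<exists>\<sigma>. s_iso \<sigma> N N \<and> (\<forall>a\<in>A. \<sigma> a = f a)))"

end

theory Submission
  imports Defs
begin

text \<open>
  Everything is reduced to one extension property of the reduct \<open>M\<^sub>s\<close>: if \<open>A \<leqslant>\<^sub>s M\<^sub>s\<close> is
  finite and \<open>A \<leqslant>\<^sub>s B\<close> with \<open>B\<close> in the age, then \<open>B\<close> embeds strongly into \<open>M\<^sub>s\<close> over \<open>A\<close>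
  (\<open>S_reduct_extension\<close>).  Countable structures with this property are compared by back and forth
  along finite strong substructures (\<open>back_and_forth\<close>); applied to \<open>M\<^sub>s\<close> and itself this gives
  homogeneity, applied to \<open>M\<^sub>s\<close> and another limit it gives uniqueness.

  S-structures are treated as families of sets \<open>K j\<close>.  The family of \<open>M\<^sub>s\<close> consists of the lines
  \<open>{c. R(c, x, y)}\<close>, indexed by the pairs \<open>{x, y}\<close>, and any S-structure is the family of its
  cliques, each repeated according to its multiplicity.  On a finite set \<open>D\<close> such a family has
  predimension \<open>|D| - \<Sum>j. max 0 (|K j \<inter> D| - 2)\<close> (\<open>d0s_presents\<close>).

  For the extension property two comparisons of the predimensions of \<open>M\<close> and \<open>M\<^sub>s\<close> are needed.

  First, \<open>A \<leqslant> M\<close> implies \<open>A \<leqslant>\<^sub>s M\<^sub>s\<close> (\<open>hstrong_imp_s_strong\<close>).  By Hall's theorem, \<open>A \<leqslant> M\<close> lets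
  any finite set of triples not contained in \<open>A\<close> choose pairwise distinct points outside \<open>A\<close>,
  each triple one of its own points.
  Among the triples \<open>{c} \<union> P\<close> through a pair \<open>P\<close> at most two choose a point of \<open>P\<close>; all the
  others choose \<open>c\<close>.  So the line of \<open>P\<close> owns as many points as the predimension of \<open>M\<^sub>s\<close> charges
  for it.

  Second, an S-extension \<open>A \<leqslant>\<^sub>s B\<close> is realised by an R-extension.  Enlarge \<open>A\<close> to a finite
  \<open>H \<leqslant> M\<close>.  A clique of \<open>B\<close> with at least three points in \<open>A\<close> is assigned a pair of \<open>H\<close> whose
  line has the same trace on \<open>A\<close>; since multiplicities count pairs, this can be done bijectively.
  Every other clique receives a pair of new points.  Now relate each point of a clique to the pair
  of that clique (\<open>clique_amalgam\<close>).  The predimension of the result relative to \<open>H\<close> is bounded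
  below by that of \<open>B\<close> relative to \<open>A\<close>, so that \<open>H\<close> is strong in the result and the result embeds
  into \<open>M\<close> over \<open>H\<close>.  No other clique arises on \<open>B\<close>, because a point of \<open>B\<close> outside \<open>A\<close> lies in
  at most one of the cliques that come from \<open>A\<close>.  Finally \<open>A \<leqslant>\<^sub>s M\<^sub>s\<close> makes \<open>B\<close> strong in the
  amalgam, and the first comparison makes the amalgam strong in \<open>M\<^sub>s\<close>.
\<close>

section \<open>S-structures as weighted families of sets\<close>

text \<open>
  Zero off the declared cliques, so that isomorphisms can be described by weights alone
  although \<open>mult\<close> is arbitrary there.
\<close>

definition weight :: "'a sstruct \<Rightarrow> 'a set \<Rightarrow> nat" where
  "weight N X = (if X \<in> cliques N then mult N X else 0)"

lemma at_least3_mono: "at_least3 X \<Longrightarrow> X \<subseteq> Y \<Longrightarrow> at_least3 Y"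
  unfolding at_least3_def by (meson card_mono finite_subset le_trans)

lemma at_least3_finite: "finite X \<Longrightarrow> at_least3 X \<longleftrightarrow> 3 \<le> card X"
  by (simp add: at_least3_def)

lemma at_least3_image: "inj_on f X \<Longrightarrow> at_least3 (f ` X) \<longleftrightarrow> at_least3 X"
  by (simp add: at_least3_def card_image finite_image_iff)

lemma at_least3_obtain:
  assumes "at_least3 X"
  obtains Y where "Y \<subseteq> X" "card Y = 3" "finite Y" "at_least3 Y"
proof -
  have "\<exists>Y. Y \<subseteq> X \<and> card Y = 3 \<and> finite Y"
  proof (cases "finite X")
    case True
    then show ?thesis
      using assms at_least3_finite[of X] obtain_subset_with_card_n[of 3 X] finite_subset by metis
  next
    case False
    then show ?thesis using infinite_arbitrarily_large[of X 3] by blast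
  qed
  then show thesis using that at_least3_finite by (metis order_refl)
qed

lemma image_subset_image_iff:
  "inj_on f U \<Longrightarrow> X \<subseteq> U \<Longrightarrow> Y \<subseteq> U \<Longrightarrow> f ` X \<subseteq> f ` Y \<longleftrightarrow> X \<subseteq> Y"
  by (metis image_mono inv_into_image_cancel)

lemma s_structure_clique:
  assumes "s_structure N" "C \<in> cliques N"
  shows "C \<subseteq> univ N" "at_least3 C" "0 < mult N C" "mult N C \<le> 3"
  using assms unfolding s_structure_def by auto

lemma weight_pos_iff: "s_structure N \<Longrightarrow> 0 < weight N X \<longleftrightarrow> X \<in> cliques N"
  by (auto simp: weight_def dest: s_structure_clique)

lemma weight_small: "s_structure N \<Longrightarrow> \<not> at_least3 X \<Longrightarrow> weight N X = 0"
  by (auto simp: weight_def dest: s_structure_clique)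

lemma finite_cliques_above:
  assumes "s_structure N" "at_least3 X"
  shows "finite {C \<in> cliques N. X \<subseteq> C}"
proof (cases "X \<subseteq> univ N")
  case True
  then show ?thesis using assms by (auto simp: s_structure_def valid_mult_def)
next
  case False
  then have "{C \<in> cliques N. X \<subseteq> C} = {}" using s_structure_clique[OF assms(1)] by blast
  then show ?thesis by (metis finite.emptyI)
qed

lemma finite_cliques_trace:
  assumes "s_structure N" "at_least3 X"
  shows "finite {C \<in> cliques N. C \<inter> D = X}"
  by (rule finite_subset[OF _ finite_cliques_above[OF assms]]) auto

lemma weight_induced:
  assumes "s_structure N"
  shows "weight (s_induced N D) X =
    (if at_least3 X then \<Sum>C | C \<in> cliques N \<and> C \<inter> D = X. mult N C else 0)"
proof (cases "at_least3 X \<and> (\<exists>C\<in>cliques N. C \<inter> D = X)")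
  case True
  then show ?thesis by (auto simp: weight_def s_induced_def)
next
  case False
  then have "X \<notin> cliques (s_induced N D)" by (auto simp: s_induced_def)
  moreover have "(\<Sum>C | C \<in> cliques N \<and> C \<inter> D = X. mult N C) = 0" if "at_least3 X"
    using False that by (intro sum.neutral) auto
  ultimately show ?thesis by (simp add: weight_def)
qed

lemma univ_induced [simp]: "univ (s_induced N D) = D"
  by (simp add: s_induced_def)

text \<open>
  Every clique containing \<open>X \<subseteq> D\<close> leaves a trace on \<open>D\<close> that still contains \<open>X\<close>, and the
  multiplicities of cliques with equal traces are added.
\<close>

lemma total_mult_induced:
  assumes N: "s_structure N" and X: "X \<subseteq> D"
  shows "total_mult (s_induced N D) X = total_mult N X"
    and "at_least3 X \<Longrightarrow> finite {E \<in> cliques (s_induced N D). X \<subseteq> E}"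
proof -
  have "finite {E \<in> cliques (s_induced N D). X \<subseteq> E} \<and>
     total_mult (s_induced N D) X = total_mult N X" if X3: "at_least3 X"
  proof -
    let ?F = "{C \<in> cliques N. X \<subseteq> C}" and ?G = "{E \<in> cliques (s_induced N D). X \<subseteq> E}"
    have fin: "finite ?F" by (rule finite_cliques_above[OF N X3])
    have G: "?G = (\<lambda>C. C \<inter> D) ` ?F"
      using X at_least3_mono[OF X3] by (auto simp: s_induced_def)
    have "total_mult N X = (\<Sum>E\<in>(\<lambda>C. C \<inter> D) ` ?F. \<Sum>C | C \<in> ?F \<and> C \<inter> D = E. mult N C)"
      using X3 sum.image_gen[OF fin, of "mult N" "\<lambda>C. C \<inter> D"] by (simp add: total_mult_def)
    also have "\<dots> = (\<Sum>E\<in>?G. mult (s_induced N D) E)"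
      unfolding G
    proof (rule sum.cong[OF refl])
      fix E assume "E \<in> (\<lambda>C. C \<inter> D) ` ?F"
      then have "X \<subseteq> E" using X by auto
      then have "{C. C \<in> ?F \<and> C \<inter> D = E} = {C. C \<in> cliques N \<and> C \<inter> D = E}" by auto
      then show "(\<Sum>C | C \<in> ?F \<and> C \<inter> D = E. mult N C) = mult (s_induced N D) E"
        by (simp add: s_induced_def)
    qed
    also have "\<dots> = total_mult (s_induced N D) X" using X3 by (simp add: total_mult_def)
    finally show ?thesis using G fin by simp
  qed
  then show "total_mult (s_induced N D) X = total_mult N X"
    and "at_least3 X \<Longrightarrow> finite {E \<in> cliques (s_induced N D). X \<subseteq> E}"
    by (auto simp: total_mult_def)
qed

lemma total_mult_le_3:
  assumes "valid_mult N" "C \<subseteq> univ N" "at_least3 C"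
  shows "total_mult N C \<le> 3"
proof -
  have *: "real (total_mult N C) \<le> 1 + (if finite C then 2 / (real (card C) - 2) else 0)"
    using assms by (auto simp: valid_mult_def)
  have "2 / (real (card C) - 2) \<le> 2" if "finite C"
    using assms(3) that by (simp add: at_least3_def field_simps)
  with * have "real (total_mult N C) \<le> 3" by (auto split: if_splits)
  then show ?thesis by linarith
qed

text \<open>
  The bound on a single multiplicity is automatic: it is at most the total multiplicity of the
  clique, and \<open>1 + 2 / (|C| - 2) \<le> 3\<close>.
\<close>

lemma s_structureI:
  assumes wf: "\<And>C. C \<in> cliques N \<Longrightarrow> C \<subseteq> univ N \<and> at_least3 C \<and> 0 < mult N C"
    and valid: "valid_mult N"
  shows "s_structure N"
  unfolding s_structure_def
proof (intro conjI ballI)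
  fix C assume C: "C \<in> cliques N"
  have "finite {E \<in> cliques N. C \<subseteq> E}" using valid wf[OF C] by (auto simp: valid_mult_def)
  then have "mult N C \<le> (\<Sum>E | E \<in> cliques N \<and> C \<subseteq> E. mult N E)"
    using C by (intro member_le_sum) auto
  also have "\<dots> = total_mult N C" using wf[OF C] by (simp add: total_mult_def)
  also have "\<dots> \<le> 3" using total_mult_le_3[OF valid] wf[OF C] by simp
  finally show "mult N C \<in> {1, 2, 3}" using wf[OF C] by auto
qed (use wf valid in auto)

lemma s_structure_induced:
  assumes N: "s_structure N" and D: "D \<subseteq> univ N"
  shows "s_structure (s_induced N D)"
proof (rule s_structureI)
  fix E assume E: "E \<in> cliques (s_induced N D)"
  then obtain C where C: "C \<in> cliques N" "E = C \<inter> D" "at_least3 E" by (auto simp: s_induced_def)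
  have "mult N C \<le> mult (s_induced N D) E"
    unfolding s_induced_def
    using finite_cliques_trace[OF N C(3), of D] C by (auto intro!: member_le_sum)
  then show "E \<subseteq> univ (s_induced N D) \<and> at_least3 E \<and> 0 < mult (s_induced N D) E"
    using C s_structure_clique(3)[OF N C(1)] by auto
next
  show "valid_mult (s_induced N D)"
    unfolding valid_mult_def
  proof (intro allI impI, elim conjE)
    fix X assume X: "X \<subseteq> univ (s_induced N D)" "at_least3 X"
    then show "finite {E \<in> cliques (s_induced N D). X \<subseteq> E} \<and>
      real (total_mult (s_induced N D) X) \<le> 1 + (if finite X then 2 / (real (card X) - 2) else 0)"
      using total_mult_induced[OF N, of X D] N D
      by (auto simp: s_structure_def valid_mult_def)
  qed
qed

lemma weight_induced_induced:
  assumes N: "s_structure N" and D: "D \<subseteq> univ N" "D' \<subseteq> D"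
  shows "weight (s_induced (s_induced N D) D') X = weight (s_induced N D') X"
proof (cases "at_least3 X")
  case X3: True
  let ?F = "{C \<in> cliques N. C \<inter> D' = X}"
  have fin: "finite ?F" by (rule finite_cliques_trace[OF N X3])
  have img: "(\<lambda>C. C \<inter> D) ` ?F = {E \<in> cliques (s_induced N D). E \<inter> D' = X}"
  proof -
    have "C \<inter> D \<inter> D' = C \<inter> D'" for C using D(2) by blast
    moreover have "at_least3 (C \<inter> D)" if "C \<inter> D' = X" for C
      using at_least3_mono[OF X3, of "C \<inter> D"] D(2) that by blast
    ultimately show ?thesis by (auto simp: s_induced_def)
  qed
  have "weight (s_induced N D') X = sum (mult N) ?F"
    using X3 by (simp add: weight_induced[OF N])
  also have "\<dots> = (\<Sum>E\<in>(\<lambda>C. C \<inter> D) ` ?F. \<Sum>C | C \<in> ?F \<and> C \<inter> D = E. mult N C)"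
    by (rule sum.image_gen[OF fin])
  also have "\<dots> = (\<Sum>E\<in>(\<lambda>C. C \<inter> D) ` ?F. mult (s_induced N D) E)"
  proof (rule sum.cong[OF refl])
    fix E assume "E \<in> (\<lambda>C. C \<inter> D) ` ?F"
    then have "{C. C \<in> ?F \<and> C \<inter> D = E} = {C. C \<in> cliques N \<and> C \<inter> D = E}"
      using D(2) by auto
    then show "(\<Sum>C | C \<in> ?F \<and> C \<inter> D = E. mult N C) = mult (s_induced N D) E"
      by (simp add: s_induced_def)
  qed
  also have "\<dots> = weight (s_induced (s_induced N D) D') X"
    unfolding img using X3 by (simp add: weight_induced[OF s_structure_induced[OF N D(1)]])
  finally show ?thesis by simp
next
  case False
  then show ?thesis
    by (simp add: weight_induced[OF N] weight_induced[OF s_structure_induced[OF N D(1)]])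
qed

subsection \<open>Isomorphisms\<close>

text \<open>
  Sets with fewer than three points have weight \<open>0\<close> in both structures.
\<close>

lemma s_isoI:
  assumes A: "s_structure A" and B: "s_structure B"
    and bij: "bij_betw f (univ A) (univ B)"
    and w: "\<And>X. X \<subseteq> univ A \<Longrightarrow> at_least3 X \<Longrightarrow> weight B (f ` X) = weight A X"
  shows "s_iso f A B"
proof -
  have w': "weight B (f ` X) = weight A X" if "X \<subseteq> univ A" for X
  proof (cases "at_least3 X")
    case False
    moreover have "inj_on f X" using bij that by (meson bij_betw_def inj_on_subset)
    ultimately show ?thesis
      using weight_small[OF A] weight_small[OF B] at_least3_image by metis
  qed (use w that in auto)
  have sub: "C \<subseteq> univ A" if "C \<in> cliques A" for C using s_structure_clique[OF A that] by blast
  have "cliques B = (\<lambda>C. f ` C) ` cliques A"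
  proof (intro equalityI subsetI)
    fix C assume C: "C \<in> cliques B"
    then have "C \<subseteq> f ` univ A"
      using s_structure_clique[OF B C] bij by (auto simp: bij_betw_def)
    then obtain X where X: "X \<subseteq> univ A" "C = f ` X" by (meson subset_imageE)
    then show "C \<in> (\<lambda>C. f ` C) ` cliques A"
      using w'[OF X(1)] C weight_pos_iff[OF A, of X] weight_pos_iff[OF B, of C] by auto
  next
    fix C assume "C \<in> (\<lambda>C. f ` C) ` cliques A"
    then obtain X where X: "X \<in> cliques A" "C = f ` X" by auto
    then show "C \<in> cliques B"
      using w'[OF sub[OF X(1)]] weight_pos_iff[OF A, of X] weight_pos_iff[OF B, of C] by auto
  qed
  moreover have "mult B (f ` C) = mult A C" if "C \<in> cliques A" for C
  proof -
    have "f ` C \<in> cliques B" using that calculation by blast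
    then show ?thesis using w'[OF sub[OF that]] that by (simp add: weight_def)
  qed
  ultimately show ?thesis using bij by (simp add: s_iso_def)
qed

lemma s_iso_bij: "s_iso f A B \<Longrightarrow> bij_betw f (univ A) (univ B)"
  by (simp add: s_iso_def)

lemma s_iso_inj: "s_iso f A B \<Longrightarrow> inj_on f (univ A)"
  by (simp add: s_iso_def bij_betw_def)

lemma s_iso_image: "s_iso f A B \<Longrightarrow> f ` univ A = univ B"
  by (simp add: s_iso_def bij_betw_def)

lemma s_iso_weight:
  assumes A: "s_structure A" and f: "s_iso f A B" and X: "X \<subseteq> univ A"
  shows "weight B (f ` X) = weight A X"
proof -
  have "f ` X \<in> cliques B \<longleftrightarrow> X \<in> cliques A"
  proof
    assume "f ` X \<in> cliques B"
    then obtain C where "C \<in> cliques A" "f ` X = f ` C" using f by (auto simp: s_iso_def)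
    then show "X \<in> cliques A"
      using X s_structure_clique(1)[OF A] inj_on_image_eq_iff[OF s_iso_inj[OF f]] by metis
  qed (use f in \<open>auto simp: s_iso_def\<close>)
  then show ?thesis using f by (auto simp: weight_def s_iso_def)
qed

lemma s_iso_s_structure:
  assumes A: "s_structure A" and f: "s_iso f A B"
  shows "s_structure B"
proof (rule s_structureI)
  fix C assume "C \<in> cliques B"
  then obtain X where X: "X \<in> cliques A" "C = f ` X" using f by (auto simp: s_iso_def)
  note s = s_structure_clique[OF A X(1)]
  have "inj_on f X" using s_iso_inj[OF f] s(1) inj_on_subset by blast
  then show "C \<subseteq> univ B \<and> at_least3 C \<and> 0 < mult B C"
    using X s f s_iso_image[OF f] at_least3_image by (fastforce simp: s_iso_def)
next
  show "valid_mult B"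
    unfolding valid_mult_def
  proof (intro allI impI, elim conjE)
    fix Y assume Y: "Y \<subseteq> univ B" "at_least3 Y"
    then obtain X where X: "X \<subseteq> univ A" "Y = f ` X"
      using s_iso_image[OF f] by (metis subset_imageE)
    have inj: "inj_on f X" using s_iso_inj[OF f] X(1) inj_on_subset by blast
    have X3: "at_least3 X" using Y X inj at_least3_image by blast
    have sub: "C \<subseteq> univ A" if "C \<in> cliques A" for C using s_structure_clique[OF A that] by blast
    have "f ` X \<subseteq> f ` C \<longleftrightarrow> X \<subseteq> C" if "C \<in> cliques A" for C
      using image_subset_image_iff[OF s_iso_inj[OF f] X(1) sub[OF that]] .
    then have eq: "{E \<in> cliques B. Y \<subseteq> E} = (`) f ` {C \<in> cliques A. X \<subseteq> C}"
      using f X(2) by (auto simp: s_iso_def)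
    have "{C \<in> cliques A. X \<subseteq> C} \<subseteq> Pow (univ A)" using sub by blast
    then have "inj_on ((`) f) {C \<in> cliques A. X \<subseteq> C}"
      by (rule inj_on_subset[OF inj_on_image_Pow[OF s_iso_inj[OF f]]])
    then have "(\<Sum>E | E \<in> cliques B \<and> Y \<subseteq> E. mult B E)
        = (\<Sum>C | C \<in> cliques A \<and> X \<subseteq> C. mult B (f ` C))"
      unfolding eq by (simp add: sum.reindex)
    also have "\<dots> = (\<Sum>C | C \<in> cliques A \<and> X \<subseteq> C. mult A C)"
      using f by (intro sum.cong) (auto simp: s_iso_def)
    finally have tot: "total_mult B Y = total_mult A X"
      using X3 Y(2) by (simp add: total_mult_def)
    have "finite {C \<in> cliques A. X \<subseteq> C} \<and>
        real (total_mult A X) \<le> 1 + (if finite X then 2 / (real (card X) - 2) else 0)"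
      using A X(1) X3 by (simp add: s_structure_def valid_mult_def)
    moreover have "card Y = card X" "finite Y = finite X"
      using X(2) inj by (auto simp: card_image finite_image_iff)
    ultimately show "finite {E \<in> cliques B. Y \<subseteq> E} \<and>
        real (total_mult B Y) \<le> 1 + (if finite Y then 2 / (real (card Y) - 2) else 0)"
      unfolding tot unfolding eq by (auto split: if_splits)
  qed
qed

lemma s_iso_comp:
  assumes f: "s_iso f A B" and g: "s_iso g B C"
  shows "s_iso (g \<circ> f) A C"
  unfolding s_iso_def
proof (intro conjI ballI)
  show "bij_betw (g \<circ> f) (univ A) (univ C)"
    by (rule bij_betw_trans[OF s_iso_bij[OF f] s_iso_bij[OF g]])
  have fB: "cliques B = (`) f ` cliques A" and gC: "cliques C = (`) g ` cliques B"
    using f g by (auto simp: s_iso_def)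
  show "cliques C = (`) (g \<circ> f) ` cliques A"
    unfolding gC fB by (simp add: image_image)
  fix X assume X: "X \<in> cliques A"
  then have "f ` X \<in> cliques B" using fB by simp
  then have "mult C (g ` f ` X) = mult A X" using f g X by (simp add: s_iso_def)
  then show "mult C ((g \<circ> f) ` X) = mult A X" by (simp add: image_image)
qed

lemma s_iso_inv:
  assumes A: "s_structure A" and f: "s_iso f A B"
  shows "s_iso (inv_into (univ A) f) B A"
proof (rule s_isoI[OF s_iso_s_structure[OF A f] A bij_betw_inv_into[OF s_iso_bij[OF f]]])
  fix Y assume "Y \<subseteq> univ B"
  then obtain X where X: "X \<subseteq> univ A" "Y = f ` X"
    using s_iso_image[OF f] by (metis subset_imageE)
  then have "inv_into (univ A) f ` Y = X" using s_iso_inj[OF f] by (simp add: inv_into_image_cancel)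
  then show "weight A (inv_into (univ A) f ` Y) = weight B Y"
    using s_iso_weight[OF A f X(1)] X(2) by simp
qed

lemma s_iso_induced_cong:
  assumes N: "s_structure N" and D: "D \<subseteq> univ N" and N': "s_structure N'" and D': "D' \<subseteq> univ N'"
    and f: "s_iso f (s_induced N D) (s_induced N' D')" and eq: "\<And>x. x \<in> D \<Longrightarrow> g x = f x"
  shows "s_iso g (s_induced N D) (s_induced N' D')"
proof (rule s_isoI[OF s_structure_induced[OF N D] s_structure_induced[OF N' D']])
  show "bij_betw g (univ (s_induced N D)) (univ (s_induced N' D'))"
    using s_iso_bij[OF f] bij_betw_cong[of D g f] eq by simp
  fix X assume X: "X \<subseteq> univ (s_induced N D)"
  then have "g ` X = f ` X" using eq by (intro image_cong) auto
  then show "weight (s_induced N' D') (g ` X) = weight (s_induced N D) X"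
    using s_iso_weight[OF s_structure_induced[OF N D] f X] by simp
qed

lemma s_iso_restrict:
  assumes A: "s_structure A" and f: "s_iso f A B" and D: "D \<subseteq> univ A"
  shows "s_iso f (s_induced A D) (s_induced B (f ` D))"
proof -
  have B: "s_structure B" by (rule s_iso_s_structure[OF A f])
  have inj: "inj_on f (univ A)" by (rule s_iso_inj[OF f])
  have fD: "f ` D \<subseteq> univ B" using D s_iso_image[OF f] by blast
  show ?thesis
  proof (rule s_isoI[OF s_structure_induced[OF A D] s_structure_induced[OF B fD]])
    show "bij_betw f (univ (s_induced A D)) (univ (s_induced B (f ` D)))"
      using inj_on_subset[OF inj D] by (simp add: bij_betw_def)
    fix X assume "X \<subseteq> univ (s_induced A D)" and X3: "at_least3 X"
    then have X: "X \<subseteq> D" by simp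
    have fX3: "at_least3 (f ` X)"
      using X3 at_least3_image[OF inj_on_subset[OF inj]] X D by blast
    have sub: "C \<subseteq> univ A" if "C \<in> cliques A" for C using s_structure_clique[OF A that] by blast
    have tr: "f ` C \<inter> f ` D = f ` X \<longleftrightarrow> C \<inter> D = X" if "C \<in> cliques A" for C
      using inj_on_image_Int[OF inj sub[OF that] D] inj_on_image_eq_iff[OF inj, of "C \<inter> D" X] D X
      by (metis inf.coboundedI2 order_trans)
    have eq: "{E \<in> cliques B. E \<inter> f ` D = f ` X} = (`) f ` {C \<in> cliques A. C \<inter> D = X}"
      using tr f by (auto simp: s_iso_def)
    have "{C \<in> cliques A. C \<inter> D = X} \<subseteq> Pow (univ A)" using sub by blast
    then have "inj_on ((`) f) {C \<in> cliques A. C \<inter> D = X}"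
      by (rule inj_on_subset[OF inj_on_image_Pow[OF inj]])
    then have "(\<Sum>E | E \<in> cliques B \<and> E \<inter> f ` D = f ` X. mult B E)
        = (\<Sum>C | C \<in> cliques A \<and> C \<inter> D = X. mult B (f ` C))"
      unfolding eq by (simp add: sum.reindex)
    also have "\<dots> = (\<Sum>C | C \<in> cliques A \<and> C \<inter> D = X. mult A C)"
      using f by (intro sum.cong) (auto simp: s_iso_def)
    finally show "weight (s_induced B (f ` D)) (f ` X) = weight (s_induced A D) X"
      using X3 fX3 by (simp add: weight_induced[OF A] weight_induced[OF B])
  qed
qed

text \<open>
  Inducing in two steps agrees with inducing at once only up to the identity isomorphism, since
  the values of \<open>mult\<close> outside the cliques may differ.
\<close>

lemma s_iso_induced_induced:
  assumes N: "s_structure N" and D: "D \<subseteq> univ N" "D' \<subseteq> D"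
  shows "s_iso id (s_induced (s_induced N D) D') (s_induced N D')"
    and "s_iso id (s_induced N D') (s_induced (s_induced N D) D')"
proof -
  have s: "s_structure (s_induced (s_induced N D) D')" "s_structure (s_induced N D')"
    using s_structure_induced[OF N] s_structure_induced[OF s_structure_induced[OF N D(1)]] D by auto
  show "s_iso id (s_induced (s_induced N D) D') (s_induced N D')"
    by (rule s_isoI[OF s]) (simp_all add: weight_induced_induced[OF N D])
  show "s_iso id (s_induced N D') (s_induced (s_induced N D) D')"
    by (rule s_isoI[OF s(2,1)]) (simp_all add: weight_induced_induced[OF N D])
qed

lemma s_iso_copy:
  assumes A: "s_structure A" and inj: "inj_on c (univ A)"
  shows "\<exists>B. s_iso c A B \<and> s_structure B \<and> univ B = c ` univ A"
proof -
  define B where "B = \<lparr>univ = c ` univ A, cliques = (\<lambda>C. c ` C) ` cliques A,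
     mult = (\<lambda>D. mult A (inv_into (univ A) c ` D))\<rparr>"
  have "inv_into (univ A) c ` c ` C = C" if "C \<in> cliques A" for C
    using s_structure_clique(1)[OF A that] inj by (simp add: inv_into_image_cancel)
  then have "s_iso c A B"
    using inj by (auto simp: s_iso_def B_def bij_betw_def)
  moreover have "univ B = c ` univ A" by (simp add: B_def)
  ultimately show ?thesis using s_iso_s_structure[OF A] by blast
qed

subsection \<open>The predimension\<close>

text \<open>
  The weight of a set is the number of indices at which it occurs.  The index set may be infinite,
  as for the lines of a reduct, and the family may contain small sets, which are ignored.
\<close>

definition presents :: "'j set \<Rightarrow> ('j \<Rightarrow> 'a set) \<Rightarrow> 'a sstruct \<Rightarrow> bool" where
  "presents I K N \<longleftrightarrow> (\<forall>j\<in>I. K j \<subseteq> univ N) \<and>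
     (\<forall>X. X \<subseteq> univ N \<and> at_least3 X \<longrightarrow>
        finite {j \<in> I. X \<subseteq> K j} \<and> weight N X = card {j \<in> I. K j = X})"

lemma presents_cliques:
  assumes N: "s_structure N"
  shows "presents (SIGMA C:cliques N. {..<mult N C}) fst N"
  unfolding presents_def
proof (intro conjI allI impI ballI; (elim conjE)?)
  fix j assume "j \<in> (SIGMA C:cliques N. {..<mult N C})"
  then show "fst j \<subseteq> univ N" using s_structure_clique(1)[OF N] by fastforce
next
  fix X assume X: "X \<subseteq> univ N" "at_least3 X"
  have "{j \<in> (SIGMA C:cliques N. {..<mult N C}). X \<subseteq> fst j}
      = (SIGMA C:{C \<in> cliques N. X \<subseteq> C}. {..<mult N C})" by auto
  then show "finite {j \<in> (SIGMA C:cliques N. {..<mult N C}). X \<subseteq> fst j}"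
    using finite_cliques_above[OF N X(2)] by (metis finite_SigmaI finite_lessThan)
  have "{j \<in> (SIGMA C:cliques N. {..<mult N C}). fst j = X}
      = (if X \<in> cliques N then {X} \<times> {..<mult N X} else {})" by auto
  then have "card {j \<in> (SIGMA C:cliques N. {..<mult N C}). fst j = X}
      = card (if X \<in> cliques N then {X} \<times> {..<mult N X} else {})"
    by (rule arg_cong)
  also have "\<dots> = weight N X" by (cases "X \<in> cliques N") (simp_all add: weight_def)
  finally show "weight N X = card {j \<in> (SIGMA C:cliques N. {..<mult N C}). fst j = X}"
    by (rule sym)
qed

text \<open>
  The indices whose member has trace \<open>X\<close> on \<open>D\<close> are grouped by that member, which is a clique, and
  each clique is met as often as its multiplicity says.
\<close>

lemma presents_induced:
  assumes N: "s_structure N" and P: "presents I K N" and D: "D \<subseteq> univ N"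
  shows "presents I (\<lambda>j. K j \<inter> D) (s_induced N D)"
  unfolding presents_def
proof (intro conjI allI impI ballI; (elim conjE)?)
  fix X assume "X \<subseteq> univ (s_induced N D)" and X3: "at_least3 X"
  then have X: "X \<subseteq> D" by simp
  have fin: "finite {j \<in> I. X \<subseteq> K j}" using P X D X3 by (auto simp: presents_def)
  then show "finite {j \<in> I. X \<subseteq> K j \<inter> D}" by (rule rev_finite_subset) auto
  have w: "weight N Y = card {j \<in> I. K j = Y}" if "Y \<subseteq> univ N" "at_least3 Y" for Y
    using P that by (auto simp: presents_def)
  let ?J = "{j \<in> I. K j \<inter> D = X}" and ?C = "{C \<in> cliques N. C \<inter> D = X}"
  have finJ: "finite ?J" using fin by (rule rev_finite_subset) auto
  have "K j \<in> ?C" if "j \<in> ?J" for j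
  proof -
    have *: "K j \<subseteq> univ N" "at_least3 (K j)"
      using that P at_least3_mono[OF X3] by (auto simp: presents_def)
    have "finite {i \<in> I. K i = K j}" using fin that by (auto intro: rev_finite_subset)
    then have "card {i \<in> I. K i = K j} > 0" using that by (auto simp: card_gt_0_iff)
    then show ?thesis using w[OF *] weight_pos_iff[OF N, of "K j"] that by simp
  qed
  then have img: "K ` ?J \<subseteq> ?C" by auto
  have "weight (s_induced N D) X = (\<Sum>C\<in>?C. mult N C)" using X3 by (simp add: weight_induced[OF N])
  also have "\<dots> = (\<Sum>C\<in>?C. card {j \<in> ?J. K j = C})"
  proof (rule sum.cong[OF refl])
    fix C assume C: "C \<in> ?C"
    then have "mult N C = card {j \<in> I. K j = C}"
      using w[of C] s_structure_clique[OF N, of C] by (simp add: weight_def)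
    moreover have "{j \<in> I. K j = C} = {j \<in> ?J. K j = C}" using C by auto
    ultimately show "mult N C = card {j \<in> ?J. K j = C}" by metis
  qed
  also have "\<dots> = card ?J"
    using sum.group[OF finJ finite_cliques_trace[OF N X3, of D] img, of "\<lambda>_. 1::nat"] by simp
  finally show "weight (s_induced N D) X = card ?J" .
qed auto

lemma d0s_weight:
  assumes N: "s_structure N" and fin: "finite (univ N)"
  shows "d0s N = int (card (univ N)) - int (\<Sum>X\<in>Pow (univ N). weight N X * (card X - 2))"
proof -
  have sub: "cliques N \<subseteq> Pow (univ N)" using s_structure_clique(1)[OF N] by blast
  have "(\<Sum>C\<in>cliques N. int (mult N C) * (int (card C) - 2))
      = (\<Sum>C\<in>cliques N. int (weight N C * (card C - 2)))"
  proof (rule sum.cong[OF refl])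
    fix C assume C: "C \<in> cliques N"
    have "finite C" using s_structure_clique(1)[OF N C] fin finite_subset by blast
    then have "2 \<le> card C" using s_structure_clique(2)[OF N C] by (simp add: at_least3_finite)
    then show "int (mult N C) * (int (card C) - 2) = int (weight N C * (card C - 2))"
      using C by (simp add: weight_def of_nat_diff)
  qed
  also have "\<dots> = (\<Sum>X\<in>Pow (univ N). int (weight N X * (card X - 2)))"
    using sub fin by (intro sum.mono_neutral_left) (auto simp: weight_def)
  finally show ?thesis unfolding d0s_def by (simp only: of_nat_sum)
qed

lemma finite_relevant:
  assumes P: "presents I K N" and D: "finite D" "D \<subseteq> univ N"
  shows "finite {j \<in> I. 3 \<le> card (K j \<inter> D)}"
proof (rule finite_subset)
  show "{j \<in> I. 3 \<le> card (K j \<inter> D)} \<subseteq> (\<Union>X\<in>{X. X \<subseteq> D \<and> at_least3 X}. {j \<in> I. X \<subseteq> K j})"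
  proof
    fix j assume j: "j \<in> {j \<in> I. 3 \<le> card (K j \<inter> D)}"
    then have "at_least3 (K j \<inter> D)" using D(1) by (simp add: at_least3_finite)
    then have "K j \<inter> D \<in> {X. X \<subseteq> D \<and> at_least3 X}" by simp
    then show "j \<in> (\<Union>X\<in>{X. X \<subseteq> D \<and> at_least3 X}. {j \<in> I. X \<subseteq> K j})"
      using j by blast
  qed
  show "finite (\<Union>X\<in>{X. X \<subseteq> D \<and> at_least3 X}. {j \<in> I. X \<subseteq> K j})"
    using P D by (auto simp: presents_def)
qed

text \<open>
  Truncated subtraction makes members with at most two points in \<open>D\<close> contribute nothing, so the
  sum may run over any finite set of indices that contains the relevant ones.
\<close>

lemma d0s_presents:
  assumes N: "s_structure N" and P: "presents I K N" and D: "finite D" "D \<subseteq> univ N"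
    and I': "finite I'" "I' \<subseteq> I" "{j \<in> I. 3 \<le> card (K j \<inter> D)} \<subseteq> I'"
  shows "d0s (s_induced N D) = int (card D) - int (\<Sum>j\<in>I'. card (K j \<inter> D) - 2)"
proof -
  have Q: "presents I (\<lambda>j. K j \<inter> D) (s_induced N D)" by (rule presents_induced[OF N P D(2)])
  have "(\<Sum>X\<in>Pow D. weight (s_induced N D) X * (card X - 2))
      = (\<Sum>X\<in>Pow D. \<Sum>j | j \<in> I' \<and> K j \<inter> D = X. card (K j \<inter> D) - 2)"
  proof (rule sum.cong[OF refl])
    fix X assume X: "X \<in> Pow D"
    show "weight (s_induced N D) X * (card X - 2) = (\<Sum>j | j \<in> I' \<and> K j \<inter> D = X. card (K j \<inter> D) - 2)"
    proof (cases "at_least3 X")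
      case True
      then have "3 \<le> card X" using X D(1) by (metis PowD at_least3_finite finite_subset)
      then have "{j \<in> I. K j \<inter> D = X} = {j \<in> I'. K j \<inter> D = X}" using I' by auto
      then have "weight (s_induced N D) X = card {j \<in> I'. K j \<inter> D = X}"
        using Q X True by (auto simp: presents_def)
      then show ?thesis by simp
    next
      case False
      then have "card X - 2 = 0" using X D(1) finite_subset[of X D] by (simp add: at_least3_finite)
      then show ?thesis by simp
    qed
  qed
  also have "\<dots> = (\<Sum>j\<in>I'. card (K j \<inter> D) - 2)"
    by (rule sum.group) (use D I' in auto)
  finally show ?thesis
    using d0s_weight[OF s_structure_induced[OF N D(2)]] D(1) by simp
qed

lemma d0s_iso:
  assumes A: "s_structure A" "finite (univ A)" and f: "s_iso f A B"
  shows "d0s B = d0s A"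
proof -
  have inj: "inj_on f (univ A)" by (rule s_iso_inj[OF f])
  have B: "univ B = f ` univ A" using s_iso_image[OF f] by simp
  have "Pow (univ B) = (`) f ` Pow (univ A)" by (simp add: B image_Pow_surj)
  moreover have "inj_on ((`) f) (Pow (univ A))" using inj by (rule inj_on_image_Pow)
  ultimately have "(\<Sum>X\<in>Pow (univ B). weight B X * (card X - 2))
     = (\<Sum>X\<in>Pow (univ A). weight B (f ` X) * (card (f ` X) - 2))"
    by (simp add: sum.reindex)
  also have "\<dots> = (\<Sum>X\<in>Pow (univ A). weight A X * (card X - 2))"
    using s_iso_weight[OF A(1) f] card_image[OF inj_on_subset[OF inj]] by (intro sum.cong) auto
  finally show ?thesis
    using d0s_weight[OF A] d0s_weight[OF s_iso_s_structure[OF A(1) f]] A(2) B card_image[OF inj]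
    by simp
qed

text \<open>
  For a fixed set \<open>K\<close> the function \<open>D \<mapsto> max 0 (|K \<inter> D| - 2)\<close> is a monotone convex function of a
  modular function and hence supermodular.
\<close>

lemma d0s_submodular:
  assumes N: "s_structure N" and D: "finite D" "D \<subseteq> univ N" and E: "finite E" "E \<subseteq> univ N"
  shows "d0s (s_induced N (D \<union> E)) + d0s (s_induced N (D \<inter> E))
    \<le> d0s (s_induced N D) + d0s (s_induced N E)"
proof -
  let ?I = "SIGMA C:cliques N. {..<mult N C}"
  let ?K = "fst :: 'a set \<times> nat \<Rightarrow> 'a set"
  note P = presents_cliques[OF N]
  define J where "J = {j \<in> ?I. 3 \<le> card (?K j \<inter> (D \<union> E))}"
  have DE: "finite (D \<union> E)" "D \<union> E \<subseteq> univ N" using D E by auto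
  have J: "finite J" "J \<subseteq> ?I" unfolding J_def using finite_relevant[OF P DE] by auto
  have sub: "{j \<in> ?I. 3 \<le> card (?K j \<inter> F)} \<subseteq> J" if "F \<subseteq> D \<union> E" for F
  proof -
    have "card (?K j \<inter> F) \<le> card (?K j \<inter> (D \<union> E))" for j
      using that DE(1) by (intro card_mono) auto
    then show ?thesis unfolding J_def using le_trans by blast
  qed
  note eq = d0s_presents[OF N P _ _ J sub]
  have "card (?K j \<inter> D) - 2 + (card (?K j \<inter> E) - 2)
      \<le> card (?K j \<inter> (D \<union> E)) - 2 + (card (?K j \<inter> (D \<inter> E)) - 2)" for j
  proof -
    have "card (?K j \<inter> D) + card (?K j \<inter> E) = card (?K j \<inter> (D \<union> E)) + card (?K j \<inter> (D \<inter> E))"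
    proof -
      have "?K j \<inter> D \<union> ?K j \<inter> E = ?K j \<inter> (D \<union> E)" "?K j \<inter> D \<inter> (?K j \<inter> E) = ?K j \<inter> (D \<inter> E)"
        by auto
      then show ?thesis using card_Un_Int[of "?K j \<inter> D" "?K j \<inter> E"] D(1) E(1) by simp
    qed
    moreover have "card (?K j \<inter> (D \<inter> E)) \<le> card (?K j \<inter> D)" "card (?K j \<inter> (D \<inter> E)) \<le> card (?K j \<inter> E)"
      using D(1) E(1) by (auto intro!: card_mono)
    ultimately show ?thesis by linarith
  qed
  then have "(\<Sum>j\<in>J. card (?K j \<inter> D) - 2) + (\<Sum>j\<in>J. card (?K j \<inter> E) - 2)
      \<le> (\<Sum>j\<in>J. card (?K j \<inter> (D \<union> E)) - 2) + (\<Sum>j\<in>J. card (?K j \<inter> (D \<inter> E)) - 2)"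
    by (simp add: sum.distrib[symmetric] sum_mono)
  moreover have "card D + card E = card (D \<union> E) + card (D \<inter> E)" by (rule card_Un_Int[OF D(1) E(1)])
  ultimately show ?thesis
    using eq[of D, OF D] eq[of E, OF E] eq[of "D \<union> E", OF DE] eq[of "D \<inter> E"] D
    by (simp only: finite_Int le_infI1 sup_ge1 sup_ge2 order_refl simp_thms)
qed

subsection \<open>Strong substructures\<close>

text \<open>
  A finite superset \<open>F\<close> of \<open>D\<close> is cut down to \<open>F \<inter> E\<close>: by submodularity this does not increase
  the predimension, because \<open>E\<close> is strong.
\<close>

lemma s_strong_trans:
  assumes N: "s_structure N" and E: "s_strong E N" and DE: "D \<subseteq> E"
    and le: "\<And>F. D \<subseteq> F \<Longrightarrow> F \<subseteq> E \<Longrightarrow> d0s (s_induced N D) \<le> d0s (s_induced N F)"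
  shows "s_strong D N"
  unfolding s_strong_def
proof (intro conjI allI impI; (elim conjE)?)
  show "finite D" "D \<subseteq> univ N" using E DE finite_subset by (auto simp: s_strong_def)
  fix F assume F: "finite F" "D \<subseteq> F" "F \<subseteq> univ N"
  have E': "finite E" "E \<subseteq> univ N" using E by (auto simp: s_strong_def)
  have "d0s (s_induced N E) \<le> d0s (s_induced N (F \<union> E))"
    using E F by (auto simp: s_strong_def)
  moreover have "d0s (s_induced N D) \<le> d0s (s_induced N (F \<inter> E))" using le F DE by simp
  ultimately show "d0s (s_induced N D) \<le> d0s (s_induced N F)"
    using d0s_submodular[OF N F(1,3) E'] by linarith
qed

lemma d0s_induced_induced:
  assumes N: "s_structure N" and D: "finite D" "D \<subseteq> univ N" "D' \<subseteq> D"
  shows "d0s (s_induced (s_induced N D) D') = d0s (s_induced N D')"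
proof -
  have "finite D'" "D' \<subseteq> univ N" using D finite_subset by auto
  then show ?thesis
    using d0s_iso[OF s_structure_induced[OF N] _ s_iso_induced_induced(2)[OF N D(2,3)]] by simp
qed

lemma s_strong_iso:
  assumes A: "s_structure A" and f: "s_iso f A B" and D: "s_strong D A"
  shows "s_strong (f ` D) B"
  unfolding s_strong_def
proof (intro conjI allI impI; (elim conjE)?)
  have eq: "d0s (s_induced B (f ` E)) = d0s (s_induced A E)" if "finite E" "E \<subseteq> univ A" for E
    using d0s_iso[OF s_structure_induced[OF A that(2)] _ s_iso_restrict[OF A f that(2)]] that(1)
    by simp
  show "finite (f ` D)" "f ` D \<subseteq> univ B" using D s_iso_image[OF f] by (auto simp: s_strong_def)
  fix F assume F: "finite F" "f ` D \<subseteq> F" "F \<subseteq> univ B"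
  then obtain E where E: "E \<subseteq> univ A" "F = f ` E" using s_iso_image[OF f] by (metis subset_imageE)
  have "finite E" using F(1) E s_iso_inj[OF f] by (metis finite_imageD inj_on_subset)
  moreover have "D \<subseteq> E"
    using F(2) E D image_subset_image_iff[OF s_iso_inj[OF f]] by (auto simp: s_strong_def)
  ultimately show "d0s (s_induced B (f ` D)) \<le> d0s (s_induced B F)"
    using D E eq by (auto simp: s_strong_def)
qed

lemma s_strong_induced:
  assumes N: "s_structure N" and D: "s_strong D N" and E: "D \<subseteq> E" "finite E" "E \<subseteq> univ N"
  shows "s_strong D (s_induced N E)"
  unfolding s_strong_def
proof (intro conjI allI impI; (elim conjE)?)
  show "finite D" "D \<subseteq> univ (s_induced N E)" using D E by (auto simp: s_strong_def)
  fix F assume F: "finite F" "D \<subseteq> F" "F \<subseteq> univ (s_induced N E)"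
  then show "d0s (s_induced (s_induced N E) D) \<le> d0s (s_induced (s_induced N E) F)"
    using D E d0s_induced_induced[OF N E(2,3)] by (auto simp: s_strong_def)
qed

lemma s_strong_induced_trans:
  assumes N: "s_structure N" and E: "s_strong E N" and D: "s_strong D (s_induced N E)"
  shows "s_strong D N"
proof (rule s_strong_trans[OF N E])
  show DE: "D \<subseteq> E" using D by (auto simp: s_strong_def)
  have E': "finite E" "E \<subseteq> univ N" using E by (auto simp: s_strong_def)
  fix F assume F: "D \<subseteq> F" "F \<subseteq> E"
  then have "finite F" using E'(1) finite_subset by blast
  then have "d0s (s_induced (s_induced N E) D) \<le> d0s (s_induced (s_induced N E) F)"
    using D F by (simp add: s_strong_def)
  then show "d0s (s_induced N D) \<le> d0s (s_induced N F)"
    by (simp only: d0s_induced_induced[OF N E' F(2)] d0s_induced_induced[OF N E' DE])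
qed

text \<open>
  A finite superset of least predimension is strong.
\<close>

lemma s_strong_closure:
  assumes nonneg: "\<And>D. finite D \<Longrightarrow> D \<subseteq> univ N \<Longrightarrow> 0 \<le> d0s (s_induced N D)"
    and F: "finite F" "F \<subseteq> univ N"
  shows "\<exists>D. F \<subseteq> D \<and> s_strong D N"
proof -
  let ?P = "\<lambda>D. finite D \<and> F \<subseteq> D \<and> D \<subseteq> univ N"
  have "\<exists>D. ?P D \<and> (\<forall>E. ?P E \<longrightarrow> nat (d0s (s_induced N D)) \<le> nat (d0s (s_induced N E)))"
    by (rule ex_has_least_nat[where k = F]) (use F in simp)
  then obtain D where D: "?P D"
    and min: "\<And>E. ?P E \<Longrightarrow> nat (d0s (s_induced N D)) \<le> nat (d0s (s_induced N E))" by auto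
  have "s_strong D N"
    unfolding s_strong_def
  proof (intro conjI allI impI; (elim conjE)?)
    fix E assume E: "finite E" "D \<subseteq> E" "E \<subseteq> univ N"
    then have "?P E" using D by auto
    from min[OF this] show "d0s (s_induced N D) \<le> d0s (s_induced N E)"
      using nonneg[of D] nonneg[of E] D E by linarith
  qed (use D in auto)
  then show ?thesis using D by blast
qed

section \<open>Triple systems and the reduct\<close>

text \<open>
  A symmetric relation between three distinct points is represented by its set \<open>E\<close> of
  three-element sets; there is then no order of arguments to keep track of when triples are counted.
\<close>

definition line :: "'a set set \<Rightarrow> 'a set \<Rightarrow> 'a set" where
  "line E P = {c. c \<notin> P \<and> insert c P \<in> E}"

definition pairs :: "'a set \<Rightarrow> 'a set set" where
  "pairs V = {P. P \<subseteq> V \<and> card P = 2}"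

definition hdim :: "'a set set \<Rightarrow> 'a set \<Rightarrow> int" where
  "hdim E D = int (card D) - int (card {T \<in> E. T \<subseteq> D})"

definition hstrong :: "'a set \<Rightarrow> 'a set set \<Rightarrow> 'a set \<Rightarrow> bool" where
  "hstrong V E A \<longleftrightarrow> finite A \<and> A \<subseteq> V \<and>
     (\<forall>B. finite B \<and> A \<subseteq> B \<and> B \<subseteq> V \<longrightarrow> hdim E A \<le> hdim E B)"

definition triples_on :: "'a set \<Rightarrow> 'a set set \<Rightarrow> bool" where
  "triples_on V E \<longleftrightarrow> (\<forall>T\<in>E. T \<subseteq> V \<and> card T = 3)"

lemma finite_pairs: "finite V \<Longrightarrow> finite (pairs V)"
  by (simp add: pairs_def)

lemma finite_pair: "P \<in> pairs V \<Longrightarrow> finite P"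
  unfolding pairs_def by (auto intro: card_ge_0_finite)

lemma finite_triple: "triples_on V E \<Longrightarrow> T \<in> E \<Longrightarrow> finite T"
  unfolding triples_on_def by (auto intro: card_ge_0_finite)

lemma finite_triples_within: "finite D \<Longrightarrow> finite {T \<in> E. T \<subseteq> D}"
  by (rule finite_subset[of _ "Pow D"]) auto

lemma line_subset: "triples_on V E \<Longrightarrow> line E P \<subseteq> V"
  by (auto simp: line_def triples_on_def)

lemma hdim_empty: "triples_on V E \<Longrightarrow> hdim E {} = 0"
proof -
  assume "triples_on V E"
  then have "{T \<in> E. T \<subseteq> {}} = {}" by (auto simp: triples_on_def)
  then show ?thesis unfolding hdim_def by (metis card.empty diff_0_right of_nat_0)
qed

lemma hdim_submodular:
  assumes D: "finite D" and F: "finite F"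
  shows "hdim E (D \<union> F) + hdim E (D \<inter> F) \<le> hdim E D + hdim E F"
proof -
  let ?t = "\<lambda>X. {T \<in> E. T \<subseteq> X}"
  have "card (?t D) + card (?t F) = card (?t D \<union> ?t F) + card (?t D \<inter> ?t F)"
    by (rule card_Un_Int) (use D F finite_triples_within in auto)
  moreover have "card (?t D \<union> ?t F) \<le> card (?t (D \<union> F))"
    using D F by (intro card_mono finite_triples_within) auto
  moreover have "card (?t D \<inter> ?t F) = card (?t (D \<inter> F))" by (rule arg_cong[of _ _ card]) auto
  moreover have "card D + card F = card (D \<union> F) + card (D \<inter> F)" by (rule card_Un_Int[OF D F])
  ultimately show ?thesis unfolding hdim_def by linarith
qed

lemma hstrong_closure:
  assumes nonneg: "\<And>D. finite D \<Longrightarrow> D \<subseteq> V \<Longrightarrow> 0 \<le> hdim E D"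
    and F: "finite F" "F \<subseteq> V"
  shows "\<exists>D. F \<subseteq> D \<and> hstrong V E D"
proof -
  let ?P = "\<lambda>D. finite D \<and> F \<subseteq> D \<and> D \<subseteq> V"
  have "\<exists>D. ?P D \<and> (\<forall>B. ?P B \<longrightarrow> nat (hdim E D) \<le> nat (hdim E B))"
    by (rule ex_has_least_nat[where k = F]) (use F in simp)
  then obtain D where D: "?P D" and min: "\<And>B. ?P B \<Longrightarrow> nat (hdim E D) \<le> nat (hdim E B)"
    by auto
  have "hstrong V E D"
    unfolding hstrong_def
  proof (intro conjI allI impI; (elim conjE)?)
    fix B assume B: "finite B" "D \<subseteq> B" "B \<subseteq> V"
    then have "?P B" using D by auto
    from min[OF this] show "hdim E D \<le> hdim E B"
      using nonneg[of D] nonneg[of B] D B by linarith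
  qed (use D in auto)
  then show ?thesis using D by blast
qed

text \<open>
  With \<open>m\<close> pairs over \<open>X\<close> there are at most \<open>|X| + 2 m\<close> points and at least \<open>m |X|\<close> triples, so
  \<open>0 \<le> |X| + 2 m - m |X|\<close>.  This is the source of the validity condition on multiplicities, as
  \<open>|X| / (|X| - 2) = 1 + 2 / (|X| - 2)\<close>.
\<close>

lemma card_pairs_over:
  assumes X: "finite X" "finite Q" and Q: "\<And>P. P \<in> Q \<Longrightarrow> card P = 2 \<and> X \<subseteq> line E P"
    and nonneg: "0 \<le> hdim E (X \<union> \<Union>Q)"
  shows "card Q * (card X - 2) \<le> card X"
proof -
  have finP: "finite P" if "P \<in> Q" for P using Q[OF that] by (auto intro: card_ge_0_finite)
  have fin: "finite (X \<union> \<Union>Q)" using X finP by auto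
  have "card (X \<union> \<Union>Q) \<le> card X + card (\<Union>Q)" by (rule card_Un_le)
  also have "card (\<Union>Q) \<le> (\<Sum>P\<in>Q. card P)" using card_Union_le_sum_card by blast
  also have "(\<Sum>P\<in>Q. card P) = 2 * card Q" using Q by simp
  finally have c: "card (X \<union> \<Union>Q) \<le> card X + 2 * card Q" by simp
  have disj: "P \<inter> X = {}" if "P \<in> Q" for P using Q[OF that] by (auto simp: line_def)
  have rec: "insert c P - X = P" "insert c P \<inter> X = {c}" if "P \<in> Q" "c \<in> X" for P c
    using disj[OF that(1)] that(2) by auto
  have "inj_on (\<lambda>(P, c). insert c P) (Q \<times> X)"
  proof (rule inj_onI, clarsimp)
    fix P c P' c' assume *: "P \<in> Q" "c \<in> X" "P' \<in> Q" "c' \<in> X" and e: "insert c P = insert c' P'"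
    show "P = P' \<and> c = c'"
      using rec[OF *(1,2)] rec[OF *(3,4)] unfolding e by simp
  qed
  then have "card Q * card X = card ((\<lambda>(P, c). insert c P) ` (Q \<times> X))"
    by (simp add: card_image card_cartesian_product)
  also have "\<dots> \<le> card {T \<in> E. T \<subseteq> X \<union> \<Union>Q}"
    using Q by (intro card_mono finite_triples_within[OF fin]) (fastforce simp: line_def)
  finally have "card Q * card X \<le> card X + 2 * card Q"
    using nonneg c unfolding hdim_def by linarith
  then show ?thesis by (simp add: diff_mult_distrib2 algebra_simps)
qed

text \<open>
  Adding \<open>P\<close> to \<open>A\<close> would bring in at most two points but at least three triples.  Hence all the
  pairs that matter for the S-structure on \<open>A\<close> lie inside \<open>A\<close>.
\<close>

lemma pair_within_hstrong:
  assumes E: "triples_on V E" and A: "hstrong V E A" and P: "P \<in> pairs V"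
    and l: "3 \<le> card (line E P \<inter> A)"
  shows "P \<subseteq> A"
proof (rule ccontr)
  assume not: "\<not> P \<subseteq> A"
  have fin: "finite A" "finite P" "finite (A \<union> P)" using A finite_pair[OF P] by (auto simp: hstrong_def)
  let ?N = "(\<lambda>c. insert c P) ` (line E P \<inter> A)"
  have "inj_on (\<lambda>c. insert c P) (line E P \<inter> A)"
    by (rule inj_onI) (auto simp: line_def)
  then have cN: "card ?N = card (line E P \<inter> A)" by (rule card_image)
  have "card {T \<in> E. T \<subseteq> A} + card ?N = card ({T \<in> E. T \<subseteq> A} \<union> ?N)"
    using fin not by (intro card_Un_disjoint[symmetric] finite_triples_within) auto
  also have "\<dots> \<le> card {T \<in> E. T \<subseteq> A \<union> P}"
    using fin by (intro card_mono finite_triples_within) (auto simp: line_def)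
  finally have "card {T \<in> E. T \<subseteq> A} + 3 \<le> card {T \<in> E. T \<subseteq> A \<union> P}" using cN l by simp
  moreover have "card (A \<union> P) \<le> card A + 2" using card_Un_le[of A P] P by (simp add: pairs_def)
  moreover have "hdim E A \<le> hdim E (A \<union> P)"
    using A P fin unfolding hstrong_def pairs_def by auto
  ultimately show False unfolding hdim_def by linarith
qed

subsection \<open>R-structures as triple systems\<close>

lemma triples_on_r_triples: "triples_on (runiv M) (r_triples M)"
  by (auto simp: triples_on_def r_triples_def)

lemma rrel_iff:
  assumes M: "r_structure M"
  shows "rrel M x y z \<longleftrightarrow> {x, y, z} \<in> r_triples M \<and> x \<noteq> y \<and> x \<noteq> z \<and> y \<noteq> z"
proof
  note rD = M[unfolded r_structure_def, rule_format]
  assume r: "rrel M x y z"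
  then have "x \<in> runiv M \<and> y \<in> runiv M \<and> z \<in> runiv M \<and> x \<noteq> y \<and> x \<noteq> z \<and> y \<noteq> z"
    using rD[OF r] by simp
  moreover from this have "{x, y, z} \<in> r_triples M"
    unfolding r_triples_def using r
    by (intro CollectI exI[of _ x] exI[of _ y] exI[of _ z]) simp
  ultimately show "{x, y, z} \<in> r_triples M \<and> x \<noteq> y \<and> x \<noteq> z \<and> y \<noteq> z" by simp
next
  assume a: "{x, y, z} \<in> r_triples M \<and> x \<noteq> y \<and> x \<noteq> z \<and> y \<noteq> z"
  then obtain u v w where T: "{x, y, z} = {u, v, w}" and r: "rrel M u v w"
    unfolding r_triples_def by blast
  have perm: "rrel M b a c" "rrel M a c b" if "rrel M a b c" for a b c
    using M[unfolded r_structure_def, rule_format, OF that] by simp_all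
  note p = perm[OF r]
  note q = perm[OF p(1)] perm[OF p(2)]
  have all: "rrel M u v w" "rrel M v u w" "rrel M u w v" "rrel M v w u" "rrel M w u v" "rrel M w v u"
    using r p q perm[OF q(2)] by simp_all
  have "x \<in> {u, v, w}" "y \<in> {u, v, w}" "z \<in> {u, v, w}" unfolding T[symmetric] by simp_all
  then show "rrel M x y z" using all a by auto
qed

lemma r_triples_induced:
  assumes D: "D \<subseteq> runiv M"
  shows "r_triples (r_induced M D) = {T \<in> r_triples M. T \<subseteq> D}"
proof (intro equalityI subsetI)
  fix T assume "T \<in> r_triples (r_induced M D)"
  then have "\<exists>x y z. T = {x, y, z} \<and> T \<subseteq> D \<and> card T = 3 \<and> rrel M x y z"
    unfolding r_triples_def r_induced_def rstruct.simps mem_Collect_eq by (elim exE conjE) (intro exI conjI)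
  then show "T \<in> {T \<in> r_triples M. T \<subseteq> D}"
    unfolding r_triples_def mem_Collect_eq using D
    by (elim exE conjE, intro conjI exI) (assumption | erule subset_trans)+
next
  fix T assume "T \<in> {T \<in> r_triples M. T \<subseteq> D}"
  then obtain x y z where T: "T = {x, y, z}" "T \<subseteq> D" "card T = 3" "rrel M x y z"
    unfolding r_triples_def mem_Collect_eq by (elim exE conjE)
  then have "x \<in> D" "y \<in> D" "z \<in> D" by simp_all
  with T show "T \<in> r_triples (r_induced M D)"
    unfolding r_triples_def r_induced_def rstruct.simps mem_Collect_eq
    by (intro exI[of _ x] exI[of _ y] exI[of _ z]) simp
qed

lemma d0_induced:
  assumes "D \<subseteq> runiv M"
  shows "d0 (r_induced M D) = hdim (r_triples M) D"
proof -
  have "runiv (r_induced M D) = D" by (simp add: r_induced_def)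
  then show ?thesis unfolding d0_def hdim_def r_triples_induced[OF assms] by simp
qed

lemma r_strong_iff: "r_strong A M \<longleftrightarrow> hstrong (runiv M) (r_triples M) A"
proof -
  have "d0 (r_induced M A) \<le> d0 (r_induced M B) \<longleftrightarrow> hdim (r_triples M) A \<le> hdim (r_triples M) B"
    if "A \<subseteq> B" "B \<subseteq> runiv M" for B
    using that by (simp add: d0_induced subset_trans[OF that])
  then show ?thesis unfolding r_strong_def hstrong_def by blast
qed

lemma r_line_eq:
  assumes M: "r_structure M" and "x \<noteq> y"
  shows "r_line M x y = line (r_triples M) {x, y}"
proof -
  have "c \<in> runiv M" if "{c, x, y} \<in> r_triples M" for c
    using that triples_on_r_triples[of M] by (auto simp: triples_on_def)
  then show ?thesis using assms(2) by (auto simp: r_line_def line_def rrel_iff[OF M])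
qed

lemma pairs_eq: "pairs V = {{x, y} | x y. x \<in> V \<and> y \<in> V \<and> x \<noteq> y}"
  by (auto simp: pairs_def card_2_iff)

lemma S_reduct_cliques:
  assumes M: "r_structure M"
  shows "cliques (S_reduct M) = {C \<in> line (r_triples M) ` pairs (runiv M). at_least3 C}"
proof (rule set_eqI)
  fix C
  have "C \<in> cliques (S_reduct M) \<longleftrightarrow> (\<exists>x y. x \<noteq> y \<and> x \<in> runiv M \<and> y \<in> runiv M \<and>
      C = r_line M x y \<and> at_least3 C)"
    unfolding S_reduct_def sstruct.simps by blast
  also have "\<dots> \<longleftrightarrow> (\<exists>x y. x \<noteq> y \<and> x \<in> runiv M \<and> y \<in> runiv M \<and>
      C = line (r_triples M) {x, y} \<and> at_least3 C)"
    by (simp add: r_line_eq[OF M] cong: conj_cong)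
  also have "\<dots> \<longleftrightarrow> C \<in> {C \<in> line (r_triples M) ` pairs (runiv M). at_least3 C}"
    unfolding pairs_eq by blast
  finally show "C \<in> cliques (S_reduct M) \<longleftrightarrow>
      C \<in> {C \<in> line (r_triples M) ` pairs (runiv M). at_least3 C}" .
qed

lemma S_reduct_mult:
  assumes M: "r_structure M"
  shows "mult (S_reduct M) C = card {P \<in> pairs (runiv M). line (r_triples M) P = C}"
proof -
  have "P \<in> {{x, y} | x y. x \<in> runiv M \<and> y \<in> runiv M \<and> x \<noteq> y \<and> r_line M x y = C}
      \<longleftrightarrow> P \<in> {P \<in> pairs (runiv M). line (r_triples M) P = C}" (is "P \<in> ?L \<longleftrightarrow> _") for P
  proof -
    have "P \<in> ?L \<longleftrightarrow> (\<exists>x y. x \<noteq> y \<and> x \<in> runiv M \<and> y \<in> runiv M \<and> P = {x, y} \<and> r_line M x y = C)"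
      by blast
    also have "\<dots> \<longleftrightarrow> (\<exists>x y. x \<noteq> y \<and> x \<in> runiv M \<and> y \<in> runiv M \<and> P = {x, y} \<and>
        line (r_triples M) P = C)"
      by (simp add: r_line_eq[OF M] cong: conj_cong)
    finally show ?thesis unfolding pairs_eq by blast
  qed
  then show ?thesis by (simp add: S_reduct_def set_eq_iff)
qed

lemma univ_S_reduct [simp]: "univ (S_reduct M) = runiv M"
  by (simp add: S_reduct_def)

lemma finite_pairs_over:
  assumes nonneg: "\<And>D. finite D \<Longrightarrow> D \<subseteq> V \<Longrightarrow> 0 \<le> hdim E D"
    and X: "finite X" "X \<subseteq> V" "3 \<le> card X"
  shows "finite {P \<in> pairs V. X \<subseteq> line E P}"
    and "card {P \<in> pairs V. X \<subseteq> line E P} * (card X - 2) \<le> card X"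
proof -
  let ?S = "{P \<in> pairs V. X \<subseteq> line E P}"
  have bound: "card Q * (card X - 2) \<le> card X" if Q: "finite Q" "Q \<subseteq> ?S" for Q
  proof (rule card_pairs_over[OF X(1) Q(1)])
    show "\<And>P. P \<in> Q \<Longrightarrow> card P = 2 \<and> X \<subseteq> line E P" using Q by (auto simp: pairs_def)
    have "finite (\<Union>Q)" using Q by (intro finite_Union) (auto intro: finite_pair)
    moreover have "\<Union>Q \<subseteq> V" using Q by (auto simp: pairs_def)
    ultimately show "0 \<le> hdim E (X \<union> \<Union>Q)" using X by (intro nonneg) auto
  qed
  show fin: "finite ?S"
  proof (rule ccontr)
    assume "infinite ?S"
    then obtain Q where Q: "finite Q" "card Q = card X + 1" "Q \<subseteq> ?S"
      using infinite_arbitrarily_large[of ?S "card X + 1"] by blast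
    have "(card X + 1) * 1 \<le> card Q * (card X - 2)" unfolding Q(2) using X(3) by (intro mult_le_mono) auto
    then show False using bound[OF Q(1,3)] by simp
  qed
  show "card ?S * (card X - 2) \<le> card X" by (rule bound[OF fin]) simp
qed

lemma presents_S_reduct:
  assumes M: "r_structure M"
    and nonneg: "\<And>D. finite D \<Longrightarrow> D \<subseteq> runiv M \<Longrightarrow> 0 \<le> hdim (r_triples M) D"
  shows "presents (pairs (runiv M)) (line (r_triples M)) (S_reduct M)"
  unfolding presents_def
proof (intro conjI allI impI ballI; (elim conjE)?)
  fix P show "line (r_triples M) P \<subseteq> univ (S_reduct M)"
    using line_subset[OF triples_on_r_triples] by simp
next
  fix X assume X: "X \<subseteq> univ (S_reduct M)" "at_least3 X"
  obtain Y where Y: "Y \<subseteq> X" "card Y = 3" "finite Y" using at_least3_obtain[OF X(2)] by metis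
  have "finite {P \<in> pairs (runiv M). Y \<subseteq> line (r_triples M) P}"
    by (rule finite_pairs_over(1)[OF nonneg]) (use X Y in auto)
  then show "finite {P \<in> pairs (runiv M). X \<subseteq> line (r_triples M) P}"
    by (rule rev_finite_subset) (use Y in auto)
  show "weight (S_reduct M) X = card {P \<in> pairs (runiv M). line (r_triples M) P = X}"
  proof (cases "X \<in> cliques (S_reduct M)")
    case True
    then show ?thesis by (simp add: weight_def S_reduct_mult[OF M])
  next
    case False
    then have "{P \<in> pairs (runiv M). line (r_triples M) P = X} = {}"
      using X(2) by (auto simp: S_reduct_cliques[OF M])
    then have "card {P \<in> pairs (runiv M). line (r_triples M) P = X} = 0" by (metis card.empty)
    then show ?thesis using False by (simp add: weight_def)
  qed
qed

lemma s_structure_S_reduct: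
  assumes M: "r_structure M"
    and nonneg: "\<And>D. finite D \<Longrightarrow> D \<subseteq> runiv M \<Longrightarrow> 0 \<le> hdim (r_triples M) D"
  shows "s_structure (S_reduct M)"
proof -
  let ?V = "runiv M" and ?l = "line (r_triples M)" and ?N = "S_reduct M"
  let ?over = "\<lambda>X. {P \<in> pairs ?V. X \<subseteq> ?l P}"
  have P: "presents (pairs ?V) ?l ?N" by (rule presents_S_reduct[OF M nonneg])
  have fin: "finite (?over X)" if "X \<subseteq> ?V" "at_least3 X" for X
    using P that by (auto simp: presents_def)
  have above: "{C \<in> cliques ?N. X \<subseteq> C} = ?l ` ?over X" if "at_least3 X" for X
    using at_least3_mono[OF that] by (auto simp: S_reduct_cliques[OF M])
  have total: "total_mult ?N X = card (?over X)" if X: "X \<subseteq> ?V" "at_least3 X" for X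
  proof -
    have "total_mult ?N X = (\<Sum>C\<in>?l ` ?over X. card {P \<in> pairs ?V. ?l P = C})"
      using X(2) by (simp add: total_mult_def above S_reduct_mult[OF M])
    also have "\<dots> = (\<Sum>C\<in>?l ` ?over X. card {P \<in> ?over X. ?l P = C})"
      by (intro sum.cong[OF refl] arg_cong[of _ _ card]) auto
    also have "\<dots> = card (?over X)"
      using sum.image_gen[OF fin[OF X], of "\<lambda>_. 1::nat" ?l] by simp
    finally show ?thesis .
  qed
  show ?thesis
  proof (rule s_structureI)
    fix C assume C: "C \<in> cliques ?N"
    then obtain P where P: "P \<in> pairs ?V" "?l P = C" "at_least3 C" by (auto simp: S_reduct_cliques[OF M])
    have CV: "C \<subseteq> ?V" using line_subset[OF triples_on_r_triples] P(2) by metis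
    have "finite {P \<in> pairs ?V. ?l P = C}" by (rule rev_finite_subset[OF fin[OF CV P(3)]]) auto
    then have "0 < mult ?N C" using P by (auto simp: S_reduct_mult[OF M] card_gt_0_iff)
    then show "C \<subseteq> univ ?N \<and> at_least3 C \<and> 0 < mult ?N C" using CV P by simp
  next
    show "valid_mult ?N"
      unfolding valid_mult_def
    proof (intro allI impI conjI; elim conjE)
      fix X assume X: "X \<subseteq> univ ?N" "at_least3 X"
      then have X': "X \<subseteq> ?V" by simp
      show "finite {C \<in> cliques ?N. X \<subseteq> C}" using fin[OF X' X(2)] by (simp add: above[OF X(2)])
      show "real (total_mult ?N X) \<le> 1 + (if finite X then 2 / (real (card X) - 2) else 0)"
      proof (cases "finite X")
        case True
        then have c3: "3 \<le> card X" using X(2) by (simp add: at_least3_finite)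
        have "card (?over X) * (card X - 2) \<le> card X"
          by (rule finite_pairs_over(2)[OF nonneg True X' c3])
        then have "real (card (?over X) * (card X - 2)) \<le> real (card X)" by (rule of_nat_mono)
        then have "real (card (?over X)) * (real (card X) - 2) \<le> real (card X)"
          using c3 by (simp add: of_nat_diff)
        then show ?thesis using True c3 total[OF X' X(2)] by (simp add: field_simps)
      next
        case False
        \<comment> \<open>A five-element subset already forces total multiplicity at most \<open>5/3\<close>.\<close>
        obtain Y where Y: "Y \<subseteq> X" "finite Y" "card Y = 5"
          using infinite_arbitrarily_large[OF False, of 5] by blast
        have YV: "Y \<subseteq> ?V" "3 \<le> card Y" using Y X' by auto
        note fY = finite_pairs_over(1)[OF nonneg Y(2) YV]
        have "card (?over Y) * (card Y - 2) \<le> card Y"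
          by (rule finite_pairs_over(2)[OF nonneg Y(2) YV])
        then have "card (?over Y) \<le> 1" using Y(3) by simp
        moreover have "card (?over X) \<le> card (?over Y)" by (rule card_mono[OF fY]) (use Y in auto)
        ultimately show ?thesis using False total[OF X' X(2)] by simp
      qed
    qed
  qed
qed

text \<open>
  A strong \<open>H\<close> contains every pair whose line has three points in \<open>D\<close>, which makes the sum finite.
\<close>

lemma d0s_S_reduct:
  assumes N: "s_structure (S_reduct M)"
    and P: "presents (pairs (runiv M)) (line (r_triples M)) (S_reduct M)"
    and H: "hstrong (runiv M) (r_triples M) H" and D: "D \<subseteq> H"
  shows "d0s (s_induced (S_reduct M) D)
    = int (card D) - int (\<Sum>P\<in>pairs H. card (line (r_triples M) P \<inter> D) - 2)"
proof (rule d0s_presents[OF N P])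
  have H': "finite H" "H \<subseteq> runiv M" using H by (auto simp: hstrong_def)
  show "finite D" "D \<subseteq> univ (S_reduct M)" using H' D finite_subset by auto
  show "finite (pairs H)" "pairs H \<subseteq> pairs (runiv M)" using H' finite_pairs by (auto simp: pairs_def)
  show "{P \<in> pairs (runiv M). 3 \<le> card (line (r_triples M) P \<inter> D)} \<subseteq> pairs H"
  proof clarify
    fix P assume P: "P \<in> pairs (runiv M)" "3 \<le> card (line (r_triples M) P \<inter> D)"
    have "card (line (r_triples M) P \<inter> D) \<le> card (line (r_triples M) P \<inter> H)"
      using D H'(1) by (intro card_mono) auto
    then have "P \<subseteq> H" using pair_within_hstrong[OF triples_on_r_triples H P(1)] P(2) by simp
    then show "P \<in> pairs H" using P(1) by (simp add: pairs_def)
  qed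
qed

section \<open>Strong in the triple system implies strong in the reduct\<close>

text \<open>
  Hall's marriage theorem, with the argument of Halmos and Vaughan.  If Hall's condition is tight
  for some nonempty proper subfamily, that subfamily and the rest, deprived of the points used, are
  solved separately.  Otherwise there is slack, and an arbitrary choice for one member leaves
  Hall's condition intact for the others.
\<close>

theorem hall_transversal:
  assumes "finite I" "\<And>i. i \<in> I \<Longrightarrow> finite (S i)"
    and "\<And>J. J \<subseteq> I \<Longrightarrow> card J \<le> card (\<Union>i\<in>J. S i)"
  shows "\<exists>\<phi>. inj_on \<phi> I \<and> (\<forall>i\<in>I. \<phi> i \<in> S i)"
  using assms
proof (induction I arbitrary: S rule: finite_psubset_induct)
  case (psubset I)
  note fin = psubset.hyps and finS = psubset.prems(1) and hall = psubset.prems(2)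
  have finU: "finite (\<Union>i\<in>J. S i)" if "J \<subseteq> I" for J
    using that fin finS by (meson finite_UN_I finite_subset subsetD)
  show ?case
  proof (cases "\<exists>J. J \<noteq> {} \<and> J \<subset> I \<and> card (\<Union>i\<in>J. S i) = card J")
    case True
    then obtain J where J: "J \<noteq> {}" "J \<subset> I" and tight: "card (\<Union>i\<in>J. S i) = card J" by blast
    let ?U = "\<Union>i\<in>J. S i"
    have JI: "J \<subseteq> I" using J by blast
    have fU: "finite ?U" by (rule finU[OF JI])
    have fJ: "finite J" using JI fin by (rule finite_subset)
    have "\<exists>\<phi>. inj_on \<phi> J \<and> (\<forall>i\<in>J. \<phi> i \<in> S i)"
    proof (rule psubset.IH[OF J(2)])
      show "finite (S i)" if "i \<in> J" for i using that JI by (intro finS) blast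
      show "card K \<le> card (\<Union>i\<in>K. S i)" if "K \<subseteq> J" for K using that JI by (intro hall) blast
    qed
    then obtain f where f: "inj_on f J" "\<forall>i\<in>J. f i \<in> S i" by blast
    have "\<exists>\<phi>. inj_on \<phi> (I - J) \<and> (\<forall>i\<in>I - J. \<phi> i \<in> S i - ?U)"
    proof (rule psubset.IH)
      show "I - J \<subset> I" using J by blast
      show "finite (S i - ?U)" if "i \<in> I - J" for i using that finS by simp
      fix K assume K: "K \<subseteq> I - J"
      have fK: "finite K" using K fin finite_subset by blast
      have "(\<Union>i\<in>K \<union> J. S i) = (\<Union>i\<in>K. S i - ?U) \<union> ?U" by blast
      then have "card (\<Union>i\<in>K \<union> J. S i) \<le> card (\<Union>i\<in>K. S i - ?U) + card ?U"
        by (simp only: card_Un_le)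
      moreover have "card (K \<union> J) \<le> card (\<Union>i\<in>K \<union> J. S i)" using K JI by (intro hall) blast
      moreover have "card (K \<union> J) = card K + card J" using K fK fJ by (intro card_Un_disjoint) blast+
      ultimately show "card K \<le> card (\<Union>i\<in>K. S i - ?U)" using tight by linarith
    qed
    then obtain g where g: "inj_on g (I - J)" "\<forall>i\<in>I - J. g i \<in> S i - ?U" by blast
    define h where "h i = (if i \<in> J then f i else g i)" for i
    have "inj_on h (J \<union> (I - J))"
      unfolding inj_on_Un
    proof (intro conjI)
      show "inj_on h J" using f(1) by (simp add: h_def inj_on_def)
      show "inj_on h (I - J)" using g(1) by (simp add: h_def inj_on_def)
      have "h ` J \<subseteq> ?U" using f(2) by (auto simp: h_def)
      moreover have "h ` (I - J) \<inter> ?U = {}" using g(2) by (auto simp: h_def)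
      ultimately show "h ` (J - (I - J)) \<inter> h ` (I - J - J) = {}" by blast
    qed
    moreover have "J \<union> (I - J) = I" using JI by blast
    moreover have "\<forall>i\<in>I. h i \<in> S i" using f(2) g(2) by (simp add: h_def)
    ultimately show ?thesis by metis
  next
    case False
    have strict: "card J < card (\<Union>i\<in>J. S i)" if "J \<noteq> {}" "J \<subset> I" for J
    proof -
      have "card J \<le> card (\<Union>i\<in>J. S i)" using that by (intro hall) blast
      then show ?thesis using False that le_neq_implies_less by metis
    qed
    show ?thesis
    proof (cases "I = {}")
      case False
      then obtain i where i: "i \<in> I" by blast
      have "card {i} \<le> card (S i)" using hall[of "{i}"] i by simp
      then obtain x where x: "x \<in> S i" by (metis card.empty card_1_singleton_iff equals0I is_singletonI not_one_le_zero One_nat_def)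
      have "\<exists>\<phi>. inj_on \<phi> (I - {i}) \<and> (\<forall>j\<in>I - {i}. \<phi> j \<in> S j - {x})"
      proof (rule psubset.IH)
        show "I - {i} \<subset> I" using i by blast
        show "finite (S j - {x})" if "j \<in> I - {i}" for j using that finS by simp
        fix K assume K: "K \<subseteq> I - {i}"
        show "card K \<le> card (\<Union>j\<in>K. S j - {x})"
        proof (cases "K = {}")
          case False
          have "K \<subset> I" using K i by blast
          then have "card K < card (\<Union>j\<in>K. S j)" by (rule strict[OF False])
          moreover have "(\<Union>j\<in>K. S j - {x}) = (\<Union>j\<in>K. S j) - {x}" by blast
          moreover have "card (\<Union>j\<in>K. S j) - 1 \<le> card ((\<Union>j\<in>K. S j) - {x})"
            by (simp add: card_Diff_singleton_if)
          ultimately show ?thesis by simp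
        qed simp
      qed
      then obtain g where g: "inj_on g (I - {i})" "\<forall>j\<in>I - {i}. g j \<in> S j - {x}" by blast
      have "inj_on (g(i := x)) (insert i (I - {i}))"
        unfolding inj_on_insert using g by (auto simp: inj_on_def)
      moreover have "insert i (I - {i}) = I" using i by blast
      moreover have "\<forall>j\<in>I. (g(i := x)) j \<in> S j" using g(2) x by simp
      ultimately show ?thesis by metis
    qed simp
  qed
qed

text \<open>
  Hall's condition for the sets \<open>T - A\<close> with \<open>T \<in> J\<close> follows from comparing the predimensions
  of \<open>A\<close> and \<open>A \<union> \<Union>J\<close>.
\<close>

lemma hstrong_orientation:
  assumes E: "triples_on V E" and A: "hstrong V E A" and Z: "finite Z" "Z \<subseteq> V"
  shows "\<exists>\<phi>. inj_on \<phi> {T \<in> E. T \<subseteq> Z \<and> \<not> T \<subseteq> A} \<and>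
    (\<forall>T\<in>{T \<in> E. T \<subseteq> Z \<and> \<not> T \<subseteq> A}. \<phi> T \<in> T - A)"
proof (rule hall_transversal)
  let ?T = "{T \<in> E. T \<subseteq> Z \<and> \<not> T \<subseteq> A}"
  have finA: "finite A" and AV: "A \<subseteq> V" using A by (auto simp: hstrong_def)
  have "?T \<subseteq> {T \<in> E. T \<subseteq> Z}" by blast
  then show finT: "finite ?T" using finite_triples_within[OF Z(1), of E] by (rule finite_subset)
  show "finite (T - A)" if "T \<in> ?T" for T using that finite_triple[OF E] by simp
  fix J assume J: "J \<subseteq> ?T"
  have finJ: "finite J" using J finT by (rule finite_subset)
  let ?U = "\<Union>T\<in>J. T - A"
  let ?B = "A \<union> ?U"
  have "?U \<subseteq> Z" using J by blast
  then have finU: "finite ?U" using Z(1) by (rule finite_subset)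
  have finB: "finite ?B" using finA finU by simp
  have "?B \<subseteq> V" using \<open>?U \<subseteq> Z\<close> Z(2) AV by blast
  then have le: "hdim E A \<le> hdim E ?B" using A finB unfolding hstrong_def by blast
  have "card ?B = card A + card ?U" using finA finU by (intro card_Un_disjoint) blast+
  moreover have "card {T \<in> E. T \<subseteq> A} + card J \<le> card {T \<in> E. T \<subseteq> ?B}"
  proof -
    have "card {T \<in> E. T \<subseteq> A} + card J = card ({T \<in> E. T \<subseteq> A} \<union> J)"
      using J finJ by (intro card_Un_disjoint[symmetric] finite_triples_within finA) blast+
    also have "\<dots> \<le> card {T \<in> E. T \<subseteq> ?B}"
      by (intro card_mono finite_triples_within finB) (use J in blast)
    finally show ?thesis .
  qed
  ultimately show "card J \<le> card ?U" using le unfolding hdim_def by linarith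
qed

text \<open>
  In an orientation as above the triples through \<open>P\<close> have distinct points, and at most two of them
  choose a point of \<open>P\<close>.  The remaining ones choose their point on the line of \<open>P\<close>, and points
  chosen for different pairs are different.  When \<open>P\<close> lies inside \<open>A\<close> no triple through \<open>P\<close> can
  choose a point of \<open>P\<close>, so every point of the line outside \<open>A\<close> is chosen.
\<close>

lemma hstrong_line_sum:
  assumes E: "triples_on V E" and A: "hstrong V E A" and D: "finite D" "A \<subseteq> D" "D \<subseteq> V"
    and Q: "finite Q" "Q \<subseteq> pairs V"
  shows "card A + (\<Sum>P\<in>Q. card (line E P \<inter> D) - 2) \<le> card D + (\<Sum>P\<in>Q. card (line E P \<inter> A) - 2)"
proof -
  define Z where "Z = D \<union> \<Union>Q"
  have "finite (\<Union>Q)" using Q by (intro finite_Union) (auto intro: finite_pair)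
  moreover have "\<Union>Q \<subseteq> V" using Q(2) by (auto simp: pairs_def)
  ultimately have "finite Z" "Z \<subseteq> V" using D unfolding Z_def by auto
  from hstrong_orientation[OF E A this]
  obtain \<phi> where inj: "inj_on \<phi> {T \<in> E. T \<subseteq> Z \<and> \<not> T \<subseteq> A}"
    and \<phi>: "\<And>T. T \<in> {T \<in> E. T \<subseteq> Z \<and> \<not> T \<subseteq> A} \<Longrightarrow> \<phi> T \<in> T - A"
    by (elim exE conjE) simp
  \<comment> \<open>The points that the pair \<open>P\<close> pays with.\<close>
  define S where "S P = {c \<in> line E P \<inter> (D - A). \<phi> (insert c P) = c}" for P
  have tri: "insert c P \<in> {T \<in> E. T \<subseteq> Z \<and> \<not> T \<subseteq> A}"
    if "P \<in> Q" "c \<in> line E P" "c \<in> D" "\<not> insert c P \<subseteq> A" for c P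
    using that by (auto simp: Z_def line_def)
  have SD: "S P \<subseteq> D - A" for P by (auto simp: S_def)
  have disj: "S P \<inter> S P' = {}" if P: "P \<in> Q" "P' \<in> Q" "P \<noteq> P'" for P P'
  proof (rule ccontr)
    assume "S P \<inter> S P' \<noteq> {}"
    then obtain c where c: "c \<in> S P" "c \<in> S P'" by blast
    have 1: "insert c R \<in> {T \<in> E. T \<subseteq> Z \<and> \<not> T \<subseteq> A}" if "R \<in> Q" "c \<in> S R" for R
      using that(2) by (intro tri[OF that(1)]) (auto simp: S_def)
    have "\<phi> (insert c P) = \<phi> (insert c P')" using c by (simp add: S_def)
    then have "insert c P = insert c P'" using inj_onD[OF inj _ 1[OF P(1) c(1)] 1[OF P(2) c(2)]] by simp
    moreover have "c \<notin> P" "c \<notin> P'" using c by (auto simp: S_def line_def)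
    ultimately show False using P(3) by (simp add: insert_ident)
  qed
  have finDA: "finite (D - A)" using D(1) by simp
  have "(\<Sum>P\<in>Q. card (S P)) = card (\<Union>P\<in>Q. S P)"
    using finDA SD disj by (intro card_UN_disjoint[symmetric] Q(1)) (auto intro: finite_subset)
  also have "\<dots> \<le> card (D - A)" by (intro card_mono finDA) (use SD in blast)
  also have "\<dots> = card D - card A" using D finite_subset by (intro card_Diff_subset) auto
  finally have sumS: "(\<Sum>P\<in>Q. card (S P)) + card A \<le> card D"
    using card_mono[OF D(1,2)] by linarith
  have key: "card (line E P \<inter> D) - 2 \<le> card (S P) + (card (line E P \<inter> A) - 2)" if P: "P \<in> Q" for P
  proof (cases "P \<subseteq> A")
    case True
    have "S P = line E P \<inter> D - line E P \<inter> A"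
    proof
      show "line E P \<inter> D - line E P \<inter> A \<subseteq> S P"
      proof
        fix c assume c: "c \<in> line E P \<inter> D - line E P \<inter> A"
        then have "insert c P \<in> {T \<in> E. T \<subseteq> Z \<and> \<not> T \<subseteq> A}" using P by (intro tri) auto
        then have "\<phi> (insert c P) \<in> insert c P - A" using \<phi> by blast
        then show "c \<in> S P" using c True by (auto simp: S_def)
      qed
    qed (auto simp: S_def)
    then have "card (S P) = card (line E P \<inter> D) - card (line E P \<inter> A)"
      using D by (metis Int_mono card_Diff_subset finite_Int finite_subset order_refl)
    then show ?thesis by linarith
  next
    case False
    let ?L = "line E P \<inter> D"
    have cP: "card P = 2" "finite P" using P Q finite_pair by (auto simp: pairs_def intro: card_ge_0_finite)
    have "card (?L - S P) \<le> card P"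
    proof (rule card_inj_on_le[OF _ _ cP(2)])
      have in_tri: "insert c P \<in> {T \<in> E. T \<subseteq> Z \<and> \<not> T \<subseteq> A}" if "c \<in> ?L" for c
        using that False by (intro tri[OF P]) auto
      show "inj_on (\<lambda>c. \<phi> (insert c P)) (?L - S P)"
      proof (rule inj_onI)
        fix c c' assume c: "c \<in> ?L - S P" "c' \<in> ?L - S P" and e: "\<phi> (insert c P) = \<phi> (insert c' P)"
        have "insert c P = insert c' P" using inj_onD[OF inj e] in_tri c by blast
        moreover have "c \<notin> P" "c' \<notin> P" using c by (auto simp: line_def)
        ultimately show "c = c'" by (metis insert_iff)
      qed
      show "(\<lambda>c. \<phi> (insert c P)) ` (?L - S P) \<subseteq> P"
      proof
        fix y assume "y \<in> (\<lambda>c. \<phi> (insert c P)) ` (?L - S P)"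
        then obtain c where c: "c \<in> ?L" "c \<notin> S P" "y = \<phi> (insert c P)" by blast
        have "\<phi> (insert c P) \<in> insert c P - A" using \<phi> in_tri[OF c(1)] by blast
        moreover have "\<phi> (insert c P) \<noteq> c" if "c \<notin> A" using c that by (auto simp: S_def)
        ultimately show "y \<in> P" using c(3) by auto
      qed
    qed
    moreover have "S P \<subseteq> ?L" by (auto simp: S_def)
    then have "card (?L - S P) = card ?L - card (S P)" "card (S P) \<le> card ?L"
      using D(1) by (auto intro!: card_Diff_subset card_mono intro: finite_subset)
    ultimately show ?thesis using cP by linarith
  qed
  have "(\<Sum>P\<in>Q. card (line E P \<inter> D) - 2) \<le> (\<Sum>P\<in>Q. card (S P) + (card (line E P \<inter> A) - 2))"
    by (rule sum_mono[OF key])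
  then show ?thesis using sumS by (simp add: sum.distrib)
qed

lemma hstrong_imp_s_strong:
  assumes M: "r_structure M"
    and nonneg: "\<And>D. finite D \<Longrightarrow> D \<subseteq> runiv M \<Longrightarrow> 0 \<le> hdim (r_triples M) D"
    and A: "hstrong (runiv M) (r_triples M) A"
  shows "s_strong A (S_reduct M)"
  unfolding s_strong_def
proof (intro conjI allI impI; (elim conjE)?)
  show "finite A" "A \<subseteq> univ (S_reduct M)" using A by (auto simp: hstrong_def)
  fix D assume D: "finite D" "A \<subseteq> D" "D \<subseteq> univ (S_reduct M)"
  then have DV: "D \<subseteq> runiv M" by simp
  obtain H where H: "D \<subseteq> H" "hstrong (runiv M) (r_triples M) H"
    using hstrong_closure[OF nonneg D(1) DV] by blast
  have "finite H" "H \<subseteq> runiv M" using H(2) by (auto simp: hstrong_def)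
  then have Q: "finite (pairs H)" "pairs H \<subseteq> pairs (runiv M)" using finite_pairs by (auto simp: pairs_def)
  have N: "s_structure (S_reduct M)" by (rule s_structure_S_reduct[OF M nonneg])
  have P: "presents (pairs (runiv M)) (line (r_triples M)) (S_reduct M)"
    by (rule presents_S_reduct[OF M nonneg])
  have "A \<subseteq> H" using D(2) H(1) by blast
  then show "d0s (s_induced (S_reduct M) A) \<le> d0s (s_induced (S_reduct M) D)"
    using d0s_S_reduct[OF N P H(2,1)] d0s_S_reduct[OF N P H(2), of A]
      hstrong_line_sum[OF triples_on_r_triples A D(1,2) DV Q]
    by linarith
qed

section \<open>Free amalgamation of an R-structure with an S-structure\<close>

lemma not_subset_singleton: "card P = 2 \<Longrightarrow> \<not> P \<subseteq> {c}"
  using card_mono[of "{c}" P] by auto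

text \<open>
  The set \<open>H\<close> carries the triples \<open>E0\<close>, the set \<open>B\<close> carries the family \<open>K\<close> of cliques, and \<open>p j\<close> is
  the pair that is to have \<open>K j\<close> as its line on \<open>B\<close>.  For \<open>j \<in> J\<close> the pair is already present in \<open>H\<close>,
  with the right trace on the common part \<open>H \<inter> B\<close>, and these are all the pairs of \<open>H\<close> with a trace
  of size at least three; the other pairs consist of new points.  The last
  assumption says that \<open>H \<inter> B\<close> is strong in the S-structure \<open>B\<close>.
\<close>

locale clique_amalgam =
  fixes H B :: "'a set" and E0 :: "'a set set" and I J :: "'j set"
    and K p :: "'j \<Rightarrow> 'a set"
  assumes finH: "finite H" and finB: "finite B" and finI: "finite I" and JI: "J \<subseteq> I"
    and E0: "triples_on H E0"
    and K_sub: "j \<in> I \<Longrightarrow> K j \<subseteq> B"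
    and card_p: "j \<in> I \<Longrightarrow> card (p j) = 2"
    and old_in: "j \<in> J \<Longrightarrow> p j \<subseteq> H"
    and old_line: "j \<in> J \<Longrightarrow> line E0 (p j) \<inter> B = K j \<inter> H"
    and old_big: "j \<in> J \<Longrightarrow> 3 \<le> card (K j \<inter> H)"
    and old_all: "P \<in> pairs H \<Longrightarrow> 3 \<le> card (line E0 P \<inter> B) \<Longrightarrow> P \<in> p ` J"
    and inj_old: "inj_on p J"
    and new_fresh: "j \<in> I - J \<Longrightarrow> p j \<inter> (H \<union> B) = {}"
    and new_disj: "i \<in> I - J \<Longrightarrow> j \<in> I - J \<Longrightarrow> i \<noteq> j \<Longrightarrow> p i \<inter> p j = {}"
    and new_small: "j \<in> I - J \<Longrightarrow> card (K j \<inter> H) \<le> 2"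
    and strong: "H \<inter> B \<subseteq> D \<Longrightarrow> D \<subseteq> B \<Longrightarrow>
      card (H \<inter> B) + (\<Sum>j\<in>I. card (K j \<inter> D) - 2) \<le> card D + (\<Sum>j\<in>I. card (K j \<inter> H) - 2)"
begin

definition E :: "'a set set" where
  "E = E0 \<union> {insert c (p j) | j c. j \<in> I \<and> c \<in> K j}"

definition Z :: "'a set" where
  "Z = H \<union> B \<union> (\<Union>j\<in>I - J. p j)"

lemma finite_p: "j \<in> I \<Longrightarrow> finite (p j)"
  using card_p[of j] by (intro card_ge_0_finite) simp

lemma p_nonempty: "j \<in> I \<Longrightarrow> p j \<noteq> {}"
  using card_p[of j] by auto

lemma p_sub_Z: "j \<in> I \<Longrightarrow> p j \<subseteq> Z"
  using old_in[of j] by (auto simp: Z_def)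

lemma finite_Z: "finite Z"
  using finH finB finI finite_p by (simp add: Z_def)

lemma finite_K: "j \<in> I \<Longrightarrow> finite (K j)"
  using K_sub finB finite_subset by blast

lemma K_notin_p:
  assumes j: "j \<in> I" and c: "c \<in> K j"
  shows "c \<notin> p j"
proof (cases "j \<in> J")
  case True
  show ?thesis
  proof (cases "c \<in> H")
    case True
    then have "c \<in> line E0 (p j)" using old_line[OF \<open>j \<in> J\<close>] c by blast
    then show ?thesis by (simp add: line_def)
  qed (use old_in[OF True] in blast)
next
  case False
  then show ?thesis using new_fresh[of j] j c K_sub[OF j] by blast
qed

lemma E0_sub: "T \<in> E0 \<Longrightarrow> T \<subseteq> H"
  using E0 by (simp add: triples_on_def)

lemma new_outside: "j \<in> I - J \<Longrightarrow> p j \<inter> H = {}"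
  using new_fresh[of j] by blast

text \<open>
  A point of \<open>K j\<close> in \<open>H\<close> with \<open>j \<in> J\<close> yields a triple that is already in \<open>E0\<close>, so the three kinds
  of triples can be told apart by their points outside \<open>H\<close>.
\<close>

lemma E_cases:
  assumes "T \<in> E"
  obtains (base) "T \<in> E0"
  | (old) j c where "j \<in> J" "c \<in> K j" "c \<notin> H" "T = insert c (p j)"
  | (new) j c where "j \<in> I - J" "c \<in> K j" "T = insert c (p j)"
proof (cases "T \<in> E0")
  case False
  then obtain j c where T: "j \<in> I" "c \<in> K j" "T = insert c (p j)"
    using assms by (auto simp: E_def)
  have "c \<notin> H" if "j \<in> J"
  proof
    assume "c \<in> H"
    then have "c \<in> line E0 (p j)" using old_line[OF that] T(2) by blast
    then show False using False T(3) by (simp add: line_def)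
  qed
  then show thesis using T old new by blast
qed (rule base)

lemma E_intro: "j \<in> I \<Longrightarrow> c \<in> K j \<Longrightarrow> insert c (p j) \<in> E"
  by (auto simp: E_def)

lemma triples_on_E: "triples_on Z E"
  unfolding triples_on_def
proof (intro ballI conjI)
  fix T assume T: "T \<in> E"
  from T show "T \<subseteq> Z"
  proof (cases rule: E_cases)
    case base
    then show ?thesis using E0_sub by (auto simp: Z_def)
  next
    case (old j c)
    then show ?thesis using old_in[of j] K_sub[of j] JI by (auto simp: Z_def)
  next
    case (new j c)
    then show ?thesis using K_sub[of j] by (auto simp: Z_def)
  qed
  have "card (insert c (p j)) = 3" if "j \<in> I" "c \<in> K j" for j c
    using K_notin_p[OF that] card_p[OF that(1)] finite_p[OF that(1)] by simp
  then show "card T = 3" using T E0 by (auto simp: E_def triples_on_def)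
qed

lemma E_within_H: "{T \<in> E. T \<subseteq> H} = E0"
proof
  show "{T \<in> E. T \<subseteq> H} \<subseteq> E0"
  proof clarify
    fix T assume T: "T \<in> E" "T \<subseteq> H"
    from T(1) show "T \<in> E0"
    proof (cases rule: E_cases)
      case (old j c)
      then show ?thesis using T(2) by blast
    next
      case (new j c)
      then show ?thesis using T(2) new_outside[of j] p_nonempty[of j] by blast
    qed
  qed
qed (use E0_sub in \<open>auto simp: E_def\<close>)

text \<open>
  Adding to \<open>H \<inter> B\<close> a point that lies in two old cliques would lower the predimension: one point is
  gained, and each of the two cliques grows by one.
\<close>

lemma old_clique_unique:
  assumes j: "i \<in> J" "j \<in> J" and c: "c \<in> K i" "c \<in> K j" "c \<notin> H"
  shows "i = j"
proof (rule ccontr)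
  assume ne: "i \<noteq> j"
  let ?D = "insert c (H \<inter> B)"
  have cB: "c \<in> B" using c(1) j(1) JI K_sub by blast
  have le: "(card (K k \<inter> H) - 2) + (if k \<in> {i, j} then 1 else 0) \<le> card (K k \<inter> ?D) - 2"
    if k: "k \<in> I" for k
  proof -
    have sub: "K k \<inter> H \<subseteq> K k \<inter> ?D" using K_sub[OF k] by blast
    have fin: "finite (K k \<inter> ?D)" using finite_K[OF k] by simp
    show ?thesis
    proof (cases "k \<in> {i, j}")
      case True
      then have "insert c (K k \<inter> H) \<subseteq> K k \<inter> ?D" using sub c by blast
      then have "card (insert c (K k \<inter> H)) \<le> card (K k \<inter> ?D)" by (rule card_mono[OF fin])
      moreover have "card (insert c (K k \<inter> H)) = Suc (card (K k \<inter> H))"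
        using c(3) finite_K[OF k] by simp
      moreover have "3 \<le> card (K k \<inter> H)" using True j old_big by blast
      ultimately show ?thesis using True by simp
    next
      case False
      then show ?thesis using card_mono[OF fin sub] by simp
    qed
  qed
  have "(\<Sum>k\<in>I. if k \<in> {i, j} then 1 else 0 :: nat) = card {i, j}"
    using j JI finI sum.inter_restrict[OF finI, of "\<lambda>_. 1::nat" "{i, j}"]
    by (simp add: Int_absorb1 subset_iff)
  then have "(\<Sum>k\<in>I. (card (K k \<inter> H) - 2) + (if k \<in> {i, j} then 1 else 0))
      = (\<Sum>k\<in>I. card (K k \<inter> H) - 2) + 2"
    using ne by (simp only: sum.distrib) simp
  moreover have "(\<Sum>k\<in>I. (card (K k \<inter> H) - 2) + (if k \<in> {i, j} then 1 else 0))
      \<le> (\<Sum>k\<in>I. card (K k \<inter> ?D) - 2)"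
    by (rule sum_mono[OF le])
  ultimately have "(\<Sum>k\<in>I. card (K k \<inter> H) - 2) + 2 \<le> (\<Sum>k\<in>I. card (K k \<inter> ?D) - 2)"
    by linarith
  moreover have "card ?D = Suc (card (H \<inter> B))" using c(3) finH by simp
  ultimately show False using strong[of ?D] cB by auto
qed

lemma insert_cancel: "insert c P = insert c' P \<Longrightarrow> c \<notin> P \<Longrightarrow> c' \<notin> P \<Longrightarrow> c = c'"
  by (metis insert_iff)

lemma line_E_old:
  assumes j: "j \<in> J"
  shows "line E (p j) = line E0 (p j) \<union> (K j - H)"
proof
  have jI: "j \<in> I" using j JI by blast
  show "line E0 (p j) \<union> (K j - H) \<subseteq> line E (p j)"
    using K_notin_p[OF jI] E_intro[OF jI] by (auto simp: line_def E_def)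
  show "line E (p j) \<subseteq> line E0 (p j) \<union> (K j - H)"
  proof
    fix c assume "c \<in> line E (p j)"
    then have c: "c \<notin> p j" "insert c (p j) \<in> E" by (auto simp: line_def)
    from c(2) show "c \<in> line E0 (p j) \<union> (K j - H)"
    proof (cases rule: E_cases)
      case base
      then show ?thesis using c(1) by (simp add: line_def)
    next
      case (old i d)
      have iI: "i \<in> I" using old(1) JI by blast
      have d: "d \<notin> p j" "d \<notin> p i" using old(3) old_in[OF j] old_in[OF old(1)] by blast+
      then have "d = c" using old(4) by blast
      then have "p j = p i" using d old(4) by (simp add: insert_ident)
      then have "j = i" using inj_onD[OF inj_old] j old(1) by blast
      then show ?thesis using old \<open>d = c\<close> by blast
    next
      case (new i d)
      have "p i \<subseteq> {c}" using new(3) new_outside[OF new(1)] old_in[OF j] by blast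
      then show ?thesis using not_subset_singleton[OF card_p[of i]] new(1) by blast
    qed
  qed
qed

lemma line_E_new:
  assumes j: "j \<in> I - J"
  shows "line E (p j) = K j"
proof
  have jI: "j \<in> I" using j by blast
  show "K j \<subseteq> line E (p j)"
    using K_notin_p[OF jI] E_intro[OF jI] by (auto simp: line_def)
  show "line E (p j) \<subseteq> K j"
  proof
    fix c assume "c \<in> line E (p j)"
    then have c: "c \<notin> p j" "insert c (p j) \<in> E" by (auto simp: line_def)
    from c(2) show "c \<in> K j"
    proof (cases rule: E_cases)
      case base
      then show ?thesis using E0_sub new_outside[OF j] p_nonempty[OF jI] by blast
    next
      case (old i d)
      have "p j \<subseteq> {d}" using old(4) old_in[OF old(1)] new_outside[OF j] by blast
      then show ?thesis using not_subset_singleton[OF card_p[OF jI]] by blast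
    next
      case (new i d)
      have "i = j"
      proof (rule ccontr)
        assume "i \<noteq> j"
        then have "p j \<subseteq> {d}" using new_disj[OF new(1) j] new(3) by blast
        then show False using not_subset_singleton[OF card_p[OF jI]] by blast
      qed
      then have "insert c (p j) = insert d (p j)" "d \<notin> p j" using new K_notin_p[OF jI] by auto
      then have "c = d" using c(1) insert_cancel by blast
      then show ?thesis using new(2) \<open>i = j\<close> by simp
    qed
  qed
qed

lemma line_E_base:
  assumes P: "P \<in> pairs H" "P \<notin> p ` J"
  shows "line E P = line E0 P"
proof
  show "line E0 P \<subseteq> line E P" by (auto simp: line_def E_def)
  have PH: "P \<subseteq> H" using P(1) by (simp add: pairs_def)
  show "line E P \<subseteq> line E0 P"
  proof
    fix c assume "c \<in> line E P"
    then have c: "c \<notin> P" "insert c P \<in> E" by (auto simp: line_def)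
    from c(2) show "c \<in> line E0 P"
    proof (cases rule: E_cases)
      case base
      then show ?thesis using c(1) by (simp add: line_def)
    next
      case (old i d)
      have d: "d \<notin> P" "d \<notin> p i" using old(3) old_in[OF old(1)] PH by blast+
      then have "d = c" using old(4) by blast
      then have "P = p i" using d old(4) by (simp add: insert_ident)
      then show ?thesis using P(2) old(1) by blast
    next
      case (new i d)
      have "p i \<subseteq> {c}" using new(3) new_outside[OF new(1)] PH by blast
      then show ?thesis using not_subset_singleton[OF card_p[of i]] new(1) by blast
    qed
  qed
qed

lemma E_outside_cases:
  assumes "T \<in> E" and q: "q \<in> T" "q \<notin> H"
  obtains (old) j where "j \<in> J" "q \<in> K j" "T = insert q (p j)"
  | (new) j d where "j \<in> I - J" "d \<in> K j" "T = insert d (p j)"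
  using assms(1)
proof (cases rule: E_cases)
  case base
  then show thesis using E0_sub q by blast
next
  case (old j c)
  then have "q = c" using q old_in by blast
  then show thesis using old that(1) by blast
next
  case (new j c)
  then show thesis using that(2) by blast
qed

text \<open>
  This rules out unwanted cliques.  If \<open>q\<close> is a point of \<open>P\<close> outside \<open>H\<close>, then all triples through
  \<open>P\<close> come from one and the same clique: for old cliques by uniqueness of the old clique through \<open>q\<close>,
  and for new ones because their pairs are disjoint.
\<close>

lemma line_E_mixed:
  assumes P: "card P = 2" "\<not> P \<subseteq> H" "P \<notin> p ` I"
    and c: "c \<in> line E P" "c' \<in> line E P"
  shows "c = c'"
proof -
  obtain q where q: "q \<in> P" "q \<notin> H" using P(2) by blast
  have finP: "finite P" using P(1) by (intro card_ge_0_finite) simp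
  have T: "c \<notin> P" "insert c P \<in> E" "c' \<notin> P" "insert c' P \<in> E" using c by (auto simp: line_def)
  have qT: "q \<in> insert c P" "q \<in> insert c' P" using q by auto
  have mix: False if "i \<in> J" "q \<in> K i" "P \<subseteq> insert q (p i)" "j \<in> I - J" "P \<subseteq> insert d (p j)" for i j d
  proof -
    have "q \<in> B" using that(1,2) JI K_sub by blast
    then have "q \<notin> p j" using new_fresh[OF that(4)] by blast
    then have "q = d" using that(5) q by blast
    then have "P \<subseteq> {q}" using that(3,5) old_in[OF that(1)] new_outside[OF that(4)] by blast
    then show False using not_subset_singleton[OF P(1)] by blast
  qed
  \<comment> \<open>A pair inside such a triple that is not \<open>p j\<close> itself must use the point \<open>d\<close> of the clique.\<close>
  have apex: "d \<in> P" if "j \<in> I" "P \<subseteq> insert d (p j)" for j d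
  proof (rule ccontr)
    assume "d \<notin> P"
    then have "P \<subseteq> p j" using that(2) by blast
    then have "P = p j" using card_subset_eq[OF finite_p[OF that(1)]] P(1) card_p[OF that(1)] by simp
    then show False using P(3) that(1) by blast
  qed
  have "insert c P = insert c' P"
    using T(2) qT(1) q(2)
  proof (cases rule: E_outside_cases)
    case 1: (old i)
    from T(4) qT(2) q(2) show ?thesis
    proof (cases rule: E_outside_cases)
      case 2: (old j)
      then have "i = j" using old_clique_unique[OF 1(1) 2(1) 1(2) 2(2) q(2)] by simp
      then show ?thesis using 1(3) 2(3) by simp
    next
      case 2: (new j d)
      then show ?thesis using mix[of i j d] 1 by blast
    qed
  next
    case 1: (new i d)
    from T(4) qT(2) q(2) show ?thesis
    proof (cases rule: E_outside_cases)
      case 2: (old j)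
      then show ?thesis using mix[of j i d] 1 by blast
    next
      case 2: (new j d')
      have sub: "P \<subseteq> insert d (p i)" "P \<subseteq> insert d' (p j)" using 1(3) 2(3) by blast+
      have d: "d \<in> P" "d' \<in> P" using apex sub 1(1) 2(1) by blast+
      have fresh: "d \<notin> p i" "d' \<notin> p i" "d \<notin> p j" "d' \<notin> p j"
        using new_fresh[OF 1(1)] new_fresh[OF 2(1)] K_sub[of i] K_sub[of j] 1(1,2) 2(1,2) by blast+
      have dd: "d' = d" using sub d fresh by blast
      obtain a where a: "a \<in> P" "a \<noteq> d" using not_subset_singleton[OF P(1), of d] by blast
      then have "a \<in> p i" "a \<in> p j" using sub dd by blast+
      then have "i = j" using new_disj[OF 1(1) 2(1)] by blast
      then show ?thesis using 1(3) 2(3) dd by simp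
    qed
  qed
  then show ?thesis using insert_cancel T by blast
qed

lemma card_line_E_mixed:
  assumes P: "card P = 2" "\<not> P \<subseteq> H" "P \<notin> p ` I" and D: "finite D"
  shows "card (line E P \<inter> D) - 2 = 0"
proof -
  have "\<forall>c\<in>line E P \<inter> D. \<forall>c'\<in>line E P \<inter> D. c = c'" using line_E_mixed[OF P] by blast
  then have "card (line E P \<inter> D) \<le> Suc 0" using D by (simp add: card_le_Suc0_iff_eq)
  then show ?thesis by simp
qed

lemma line_E_p:
  assumes j: "j \<in> I"
  shows "line E (p j) \<inter> B = K j"
proof (cases "j \<in> J")
  case True
  then show ?thesis using line_E_old[OF True] old_line[OF True] K_sub[OF j] by blast
next
  case False
  then show ?thesis using line_E_new[of j] j K_sub[OF j] by blast
qed

lemma rich_pair: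
  assumes P: "P \<in> pairs Z" "3 \<le> card (line E P \<inter> B)"
  shows "P \<in> p ` I"
proof (rule ccontr)
  assume not: "P \<notin> p ` I"
  have cP: "card P = 2" using P(1) by (simp add: pairs_def)
  show False
  proof (cases "P \<subseteq> H")
    case True
    then have PH: "P \<in> pairs H" using cP by (simp add: pairs_def)
    moreover have nJ: "P \<notin> p ` J" using not JI by blast
    ultimately show False using old_all[OF PH] line_E_base[OF PH nJ] P(2) by simp
  next
    case False
    then show False using card_line_E_mixed[OF cP False not finB] P(2) by linarith
  qed
qed

lemma inj_p: "inj_on p I"
proof (rule inj_onI, rule ccontr)
  fix i j assume ij: "i \<in> I" "j \<in> I" "p i = p j" "i \<noteq> j"
  have ne: "p i \<noteq> {}" by (rule p_nonempty[OF ij(1)])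
  consider "i \<in> J" "j \<in> J" | "i \<in> J" "j \<in> I - J" | "i \<in> I - J" "j \<in> J" | "i \<in> I - J" "j \<in> I - J"
    using ij by blast
  then show False
  proof cases
    case 1
    then show False using inj_onD[OF inj_old ij(3)] ij(4) by blast
  next
    case 2
    then show False using old_in[OF 2(1)] new_outside[OF 2(2)] ij(3) ne by blast
  next
    case 3
    then show False using old_in[OF 3(2)] new_outside[OF 3(1)] ij(3) ne by blast
  next
    case 4
    then show False using new_disj[OF 4 ij(4)] ij(3) ne by blast
  qed
qed

text \<open>
  Let \<open>D = W \<inter> B\<close>.  An old pair contributes one triple per point of \<open>K j \<inter> D - H\<close>.  A new pair
  contributes \<open>|K j \<inter> D|\<close> triples, and only if its two points, which are not in \<open>H \<union> B\<close>, belong to \<open>W\<close>;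
  its balance is therefore at worst \<open>2 - |K j \<inter> D|\<close>.  These are the terms of the predimension of \<open>D\<close>
  over \<open>H \<inter> B\<close> in the S-structure \<open>B\<close>.
\<close>

lemma hdim_E_H_le:
  assumes W: "H \<subseteq> W" "W \<subseteq> Z"
  shows "hdim E H \<le> hdim E W"
proof -
  let ?D = "W \<inter> B"
  let ?F = "{j \<in> I - J. p j \<subseteq> W}"
  let ?g = "\<lambda>j c. insert c (p j)"
  have finW: "finite W" using W(2) finite_Z by (rule finite_subset)
  have finJ: "finite J" using JI finI by (rule finite_subset)
  have finF: "finite ?F" using finI by simp
  have finE0: "finite E0" using E_within_H finite_triples_within[OF finH] by metis
  have "{T \<in> E. T \<subseteq> W} \<subseteq> E0 \<union> ((\<Union>j\<in>J. ?g j ` (K j \<inter> ?D - H)) \<union> (\<Union>j\<in>?F. ?g j ` (K j \<inter> ?D)))"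
    (is "_ \<subseteq> E0 \<union> (?U1 \<union> ?U2)")
  proof
    fix T assume "T \<in> {T \<in> E. T \<subseteq> W}"
    then have T: "T \<in> E" "T \<subseteq> W" by auto
    from T(1) show "T \<in> E0 \<union> (?U1 \<union> ?U2)"
    proof (cases rule: E_cases)
      case base
      then show ?thesis by simp
    next
      case (old j c)
      then have "c \<in> K j \<inter> ?D - H" using T(2) K_sub[of j] JI by blast
      then have "T \<in> ?U1" using old by blast
      then show ?thesis by simp
    next
      case (new j c)
      then have "c \<in> K j \<inter> ?D" "j \<in> ?F" using T(2) K_sub[of j] by blast+
      then have "T \<in> ?U2" using new(3) by blast
      then show ?thesis by simp
    qed
  qed
  moreover have "finite (E0 \<union> (?U1 \<union> ?U2))" using finE0 finJ finF finW by simp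
  ultimately have "card {T \<in> E. T \<subseteq> W} \<le> card (E0 \<union> (?U1 \<union> ?U2))" by (rule card_mono[rotated])
  also have "\<dots> \<le> card E0 + (card ?U1 + card ?U2)"
    by (meson add_left_mono card_Un_le le_trans)
  also have "card ?U1 \<le> (\<Sum>j\<in>J. card (K j \<inter> ?D - H))"
    using finW by (intro order_trans[OF card_UN_le[OF finJ]] sum_mono card_image_le) simp
  also have "card ?U2 \<le> (\<Sum>j\<in>?F. card (K j \<inter> ?D))"
    using finW by (intro order_trans[OF card_UN_le[OF finF]] sum_mono card_image_le) simp
  finally have triples: "card {T \<in> E. T \<subseteq> W}
      \<le> card E0 + ((\<Sum>j\<in>J. card (K j \<inter> ?D - H)) + (\<Sum>j\<in>?F. card (K j \<inter> ?D)))" by simp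
  have points: "card H + card (?D - H) + 2 * card ?F \<le> card W"
  proof -
    let ?P = "\<Union>j\<in>?F. p j"
    have "card ?P = (\<Sum>j\<in>?F. card (p j))"
      using new_disj finite_p by (intro card_UN_disjoint finF) auto
    also have "\<dots> = 2 * card ?F" using card_p by simp
    finally have cP: "card ?P = 2 * card ?F" .
    have finP: "finite ?P" using finF finite_p by auto
    have d1: "?P \<inter> (H \<union> (?D - H)) = {}"
    proof -
      have "p j \<inter> (H \<union> (?D - H)) = {}" if "j \<in> ?F" for j using new_fresh[of j] that by blast
      then show ?thesis by blast
    qed
    have "card H + card (?D - H) = card (H \<union> (?D - H))"
      using finH finW by (intro card_Un_disjoint[symmetric]) auto
    moreover have "card ?P + card (H \<union> (?D - H)) = card (?P \<union> (H \<union> (?D - H)))"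
      using finP finH finW d1 by (intro card_Un_disjoint[symmetric]) auto
    moreover have "card (?P \<union> (H \<union> (?D - H))) \<le> card W" using W by (intro card_mono finW) auto
    ultimately show ?thesis using cP by linarith
  qed
  have sJ: "card (K j \<inter> ?D) - 2 = (card (K j \<inter> H) - 2) + card (K j \<inter> ?D - H)" if j: "j \<in> J" for j
  proof -
    have "K j \<inter> H \<union> (K j \<inter> ?D - H) = K j \<inter> ?D" using W(1) K_sub[of j] j JI by blast
    moreover have "card (K j \<inter> H \<union> (K j \<inter> ?D - H)) = card (K j \<inter> H) + card (K j \<inter> ?D - H)"
      using finH finW by (intro card_Un_disjoint) auto
    ultimately show ?thesis using old_big[OF j] by simp
  qed
  have split: "(\<Sum>j\<in>I. f j) = (\<Sum>j\<in>J. f j) + (\<Sum>j\<in>I - J. f j)" for f :: "'j \<Rightarrow> nat"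
    using sum.subset_diff[OF JI finI, of f] by simp
  have zero: "(\<Sum>j\<in>I - J. card (K j \<inter> H) - 2) = 0" using new_small by simp
  have "(\<Sum>j\<in>?F. card (K j \<inter> ?D)) \<le> (\<Sum>j\<in>?F. (card (K j \<inter> ?D) - 2) + 2)" by (intro sum_mono) simp
  also have "\<dots> = (\<Sum>j\<in>?F. card (K j \<inter> ?D) - 2) + 2 * card ?F" by (simp only: sum.distrib) simp
  also have "(\<Sum>j\<in>?F. card (K j \<inter> ?D) - 2) \<le> (\<Sum>j\<in>I - J. card (K j \<inter> ?D) - 2)"
    using finI by (intro sum_mono2) auto
  finally have sF: "(\<Sum>j\<in>?F. card (K j \<inter> ?D)) \<le> (\<Sum>j\<in>I - J. card (K j \<inter> ?D) - 2) + 2 * card ?F" by simp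
  have "card (H \<inter> B) + (\<Sum>j\<in>I. card (K j \<inter> ?D) - 2) \<le> card ?D + (\<Sum>j\<in>I. card (K j \<inter> H) - 2)"
    using W(1) by (intro strong) auto
  moreover have "card ?D = card (H \<inter> B) + card (?D - H)"
  proof -
    have "H \<inter> B \<union> (?D - H) = ?D" using W(1) by blast
    moreover have "card (H \<inter> B \<union> (?D - H)) = card (H \<inter> B) + card (?D - H)"
      using finH finW by (intro card_Un_disjoint) auto
    ultimately show ?thesis by simp
  qed
  moreover have "(\<Sum>j\<in>J. card (K j \<inter> ?D) - 2)
      = (\<Sum>j\<in>J. card (K j \<inter> H) - 2) + (\<Sum>j\<in>J. card (K j \<inter> ?D - H))"
    using sJ by (simp add: sum.distrib[symmetric])
  ultimately have "(\<Sum>j\<in>J. card (K j \<inter> ?D - H)) + (\<Sum>j\<in>I - J. card (K j \<inter> ?D) - 2) \<le> card (?D - H)"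
    using zero by (simp add: split)
  then show ?thesis using triples points sF unfolding hdim_def E_within_H by linarith
qed

text \<open>
  Passing from \<open>B\<close> to \<open>D\<close>, a pair inside \<open>H\<close> gains the same number of points as in passing from
  \<open>H \<inter> B\<close> to \<open>D \<inter> H\<close>.  New pairs gain nothing, as their lines are contained in \<open>B\<close>, and all remaining
  pairs have at most one point on their line.  Thus strength of \<open>H \<inter> B\<close> in \<open>H\<close> is inherited by \<open>B\<close> in
  the amalgam.
\<close>

lemma line_sum_E:
  assumes strongA: "\<And>F. H \<inter> B \<subseteq> F \<Longrightarrow> F \<subseteq> H \<Longrightarrow>
      card (H \<inter> B) + (\<Sum>P\<in>pairs H. card (line E0 P \<inter> F) - 2)
      \<le> card F + (\<Sum>P\<in>pairs H. card (line E0 P \<inter> (H \<inter> B)) - 2)"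
    and D: "B \<subseteq> D" "D \<subseteq> Z"
  shows "card B + (\<Sum>P\<in>pairs Z. card (line E P \<inter> D) - 2)
    \<le> card D + (\<Sum>P\<in>pairs Z. card (line E P \<inter> B) - 2)"
proof -
  let ?F = "D \<inter> H"
  let ?f = "\<lambda>E D P. card (line E P \<inter> D) - 2"
  have finD: "finite D" using D(2) finite_Z by (rule finite_subset)
  have lineH: "line E0 P \<subseteq> H" for P by (rule line_subset[OF E0])
  have inside: "?f E D P + ?f E0 (H \<inter> B) P = ?f E B P + ?f E0 ?F P" if P: "P \<in> pairs H" for P
  proof (cases "P \<in> p ` J")
    case True
    then obtain j where j: "j \<in> J" "P = p j" by blast
    have KB: "K j \<subseteq> B" using K_sub j(1) JI by blast
    have finK: "finite (K j)" using finite_K j(1) JI by blast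
    have "line E P \<inter> D = line E0 P \<inter> ?F \<union> (K j - H)"
      using line_E_old[OF j(1)] j(2) lineH KB D(1) by blast
    moreover have "line E P \<inter> B = line E0 P \<inter> (H \<inter> B) \<union> (K j - H)"
      using line_E_old[OF j(1)] j(2) lineH KB by blast
    moreover have "card (line E0 P \<inter> ?F \<union> (K j - H)) = card (line E0 P \<inter> ?F) + card (K j - H)"
      using finH finK by (intro card_Un_disjoint) auto
    moreover have "card (line E0 P \<inter> (H \<inter> B) \<union> (K j - H)) = card (line E0 P \<inter> (H \<inter> B)) + card (K j - H)"
      using finH finK by (intro card_Un_disjoint) auto
    moreover have "line E0 P \<inter> (H \<inter> B) = K j \<inter> H" using old_line[OF j(1)] j(2) lineH[of P] by blast
    then have "3 \<le> card (line E0 P \<inter> (H \<inter> B))" using old_big[OF j(1)] by simp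
    moreover have "card (line E0 P \<inter> (H \<inter> B)) \<le> card (line E0 P \<inter> ?F)"
      using D(1) finH by (intro card_mono) auto
    ultimately show ?thesis by simp
  next
    case False
    have "line E0 P \<inter> D = line E0 P \<inter> ?F" "line E0 P \<inter> B = line E0 P \<inter> (H \<inter> B)"
      using lineH by blast+
    then show ?thesis using line_E_base[OF P False] by simp
  qed
  have outside: "?f E D P = ?f E B P" if P: "P \<in> pairs Z - pairs H" for P
  proof -
    have cP: "card P = 2" "\<not> P \<subseteq> H" using P by (auto simp: pairs_def)
    show ?thesis
    proof (cases "P \<in> p ` I")
      case True
      then obtain j where j: "j \<in> I" "P = p j" by blast
      then have jn: "j \<in> I - J" using cP(2) old_in by blast
      then have "line E P \<inter> D = line E P \<inter> B" using line_E_new[OF jn] K_sub[OF j(1)] D(1) j(2) by blast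
      then show ?thesis by simp
    next
      case False
      then show ?thesis
        using card_line_E_mixed[OF cP False finD] card_line_E_mixed[OF cP False finB] by simp
    qed
  qed
  have HZ: "pairs H \<subseteq> pairs Z" by (auto simp: pairs_def Z_def)
  have split: "(\<Sum>P\<in>pairs Z. f P) = (\<Sum>P\<in>pairs H. f P) + (\<Sum>P\<in>pairs Z - pairs H. f P)" for f :: "'a set \<Rightarrow> nat"
    using sum.subset_diff[OF HZ finite_pairs[OF finite_Z], of f] by simp
  have "(\<Sum>P\<in>pairs H. ?f E D P) + (\<Sum>P\<in>pairs H. ?f E0 (H \<inter> B) P)
      = (\<Sum>P\<in>pairs H. ?f E B P) + (\<Sum>P\<in>pairs H. ?f E0 ?F P)"
    using inside by (simp add: sum.distrib[symmetric])
  moreover have "(\<Sum>P\<in>pairs Z - pairs H. ?f E D P) = (\<Sum>P\<in>pairs Z - pairs H. ?f E B P)"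
    using outside by simp
  moreover have "card (H \<inter> B) + (\<Sum>P\<in>pairs H. ?f E0 ?F P) \<le> card ?F + (\<Sum>P\<in>pairs H. ?f E0 (H \<inter> B) P)"
    by (rule strongA) (use D(1) in auto)
  moreover have "card B + card ?F \<le> card D + card (H \<inter> B)"
  proof -
    have "card B + card ?F = card (B \<union> ?F) + card (B \<inter> ?F)" using finB finH by (intro card_Un_Int) auto
    moreover have "card (B \<union> ?F) \<le> card D" using D(1) finD by (intro card_mono) auto
    moreover have "B \<inter> ?F = H \<inter> B" using D(1) by blast
    ultimately show ?thesis by simp
  qed
  ultimately show ?thesis unfolding split by linarith
qed

end

section \<open>The extension property of the reduct\<close>

text \<open>
  The converse of passing from an R-structure to its triples.
\<close>

definition hstruct :: "'a set \<Rightarrow> 'a set set \<Rightarrow> 'a rstruct" where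
  "hstruct V E = \<lparr>runiv = V, rrel = (\<lambda>x y z. {x, y, z} \<in> E \<and> x \<noteq> y \<and> x \<noteq> z \<and> y \<noteq> z)\<rparr>"

lemma runiv_hstruct [simp]: "runiv (hstruct V E) = V"
  by (simp add: hstruct_def)

lemma rrel_hstruct: "rrel (hstruct V E) x y z \<longleftrightarrow> {x, y, z} \<in> E \<and> x \<noteq> y \<and> x \<noteq> z \<and> y \<noteq> z"
  by (simp add: hstruct_def)

lemma r_structure_hstruct:
  assumes E: "triples_on V E"
  shows "r_structure (hstruct V E)"
  unfolding r_structure_def
proof (intro allI impI)
  fix x y z assume "rrel (hstruct V E) x y z"
  then have T: "{x, y, z} \<in> E" "x \<noteq> y" "x \<noteq> z" "y \<noteq> z" by (simp_all add: rrel_hstruct)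
  have "{x, y, z} \<subseteq> V" using E[unfolded triples_on_def, rule_format, OF T(1)] by blast
  moreover have "{y, x, z} = {x, y, z}" "{x, z, y} = {x, y, z}" by auto
  ultimately show "x \<in> runiv (hstruct V E) \<and> y \<in> runiv (hstruct V E) \<and> z \<in> runiv (hstruct V E) \<and>
      x \<noteq> y \<and> x \<noteq> z \<and> y \<noteq> z \<and> rrel (hstruct V E) y x z \<and> rrel (hstruct V E) x z y"
    using T by (simp add: rrel_hstruct)
qed

lemma triple_obtain:
  assumes "triples_on V E" "T \<in> E"
  obtains x y z where "T = {x, y, z}" "x \<noteq> y" "x \<noteq> z" "y \<noteq> z" "x \<in> V" "y \<in> V" "z \<in> V"
proof -
  have "card T = 3" and TV: "T \<subseteq> V" using assms by (auto simp: triples_on_def)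
  then obtain x y z where "T = {x, y, z}" "x \<noteq> y" "x \<noteq> z" "y \<noteq> z" by (auto simp: card_3_iff)
  with TV show thesis by (intro that[of x y z]) simp_all
qed

lemma r_triples_hstruct:
  assumes E: "triples_on V E"
  shows "r_triples (hstruct V E) = E"
proof (intro equalityI subsetI)
  fix T assume "T \<in> r_triples (hstruct V E)"
  then show "T \<in> E" by (auto simp: r_triples_def rrel_hstruct)
next
  fix T assume T: "T \<in> E"
  obtain x y z where xyz: "T = {x, y, z}" "x \<noteq> y" "x \<noteq> z" "y \<noteq> z"
    using triple_obtain[OF E T] by metis
  have "{x, y, z} \<in> r_triples (hstruct V E)"
    using rrel_iff[OF r_structure_hstruct[OF E], of x y z] T xyz by (simp add: rrel_hstruct)
  then show "T \<in> r_triples (hstruct V E)" using xyz by simp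
qed

lemma hdim_cong: "{T \<in> E. T \<subseteq> D} = {T \<in> F. T \<subseteq> D} \<Longrightarrow> hdim E D = hdim F D"
  by (simp add: hdim_def)

lemma r_class_iff:
  "X \<in> r_class \<longleftrightarrow> r_structure X \<and> finite (runiv X) \<and> (\<forall>D. D \<subseteq> runiv X \<longrightarrow> 0 \<le> hdim (r_triples X) D)"
proof -
  have "hstrong (runiv X) (r_triples X) {} \<longleftrightarrow> (\<forall>D. D \<subseteq> runiv X \<longrightarrow> 0 \<le> hdim (r_triples X) D)"
    if "finite (runiv X)"
    using finite_subset[OF _ that] by (auto simp: hstrong_def hdim_empty[OF triples_on_r_triples])
  then show ?thesis unfolding r_class_def r_strong_iff by blast
qed

lemma hrushovski_nonneg:
  assumes hr: "hrushovski_structure M" and D: "finite D" "D \<subseteq> runiv M"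
  shows "0 \<le> hdim (r_triples M) D"
proof -
  have "r_induced M D \<in> r_class" using hr D by (simp add: hrushovski_structure_def)
  moreover have "runiv (r_induced M D) = D" by (simp add: r_induced_def)
  ultimately have "0 \<le> hdim (r_triples (r_induced M D)) D" by (simp add: r_class_iff)
  also have "\<dots> = hdim (r_triples M) D"
    unfolding r_triples_induced[OF D(2)] by (rule hdim_cong) blast
  finally show ?thesis .
qed

lemma hstrong_empty:
  assumes "hrushovski_structure M"
  shows "hstrong (runiv M) (r_triples M) {}"
  using hrushovski_nonneg[OF assms] by (simp add: hstrong_def hdim_empty[OF triples_on_r_triples])

text \<open>
  The points of the amalgam are taken from the type of \<open>M\<close>, which needs enough of them.  A finite set
  of any size without triples belongs to the class and embeds into \<open>M\<close>.
\<close>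

lemma hrushovski_infinite_type:
  fixes M :: "'a rstruct"
  assumes hr: "hrushovski_structure M"
  shows "infinite (UNIV :: 'a set)"
proof
  assume fin: "finite (UNIV :: 'a set)"
  define n where "n = Suc (card (UNIV :: 'a set))"
  have T: "triples_on {..<n} {}" by (simp add: triples_on_def)
  let ?B = "hstruct {..<n} {}"
  have B: "?B \<in> r_class"
    using r_structure_hstruct[OF T] r_triples_hstruct[OF T] by (simp add: r_class_iff hdim_def)
  have strongB: "r_strong {} ?B" using B by (simp add: r_class_def)
  have "r_embedding id (r_induced M {}) ?B" for id :: "'a \<Rightarrow> nat"
    by (simp add: r_embedding_def r_induced_def)
  moreover have "r_strong {} M" using hstrong_empty[OF hr] by (simp add: r_strong_iff)
  ultimately have "\<exists>f. r_embedding f ?B M"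
    using hr B strongB unfolding hrushovski_structure_def by (metis image_empty)
  then obtain f :: "nat \<Rightarrow> 'a" where "inj_on f {..<n}" by (auto simp: r_embedding_def)
  then have "n \<le> card (UNIV :: 'a set)" using card_inj_on_le[of f "{..<n}" UNIV] fin by simp
  then show False by (simp add: n_def)
qed

lemma triples_within_image:
  assumes c: "inj_on c Z" and F: "triples_on Z F" and W: "W \<subseteq> Z"
  shows "{T \<in> (`) c ` F. T \<subseteq> c ` W} = (`) c ` {T \<in> F. T \<subseteq> W}"
proof -
  have "c ` T \<subseteq> c ` W \<longleftrightarrow> T \<subseteq> W" if "T \<in> F" for T
    using image_subset_image_iff[OF c _ W, of T] F that by (simp add: triples_on_def)
  then show ?thesis by auto
qed

lemma hdim_image:
  assumes c: "inj_on c Z" and F: "triples_on Z F" and W: "W \<subseteq> Z"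
  shows "hdim ((`) c ` F) (c ` W) = hdim F W"
proof -
  have "{T \<in> F. T \<subseteq> W} \<subseteq> Pow Z" using W by blast
  then have "inj_on ((`) c) {T \<in> F. T \<subseteq> W}" by (rule inj_on_subset[OF inj_on_image_Pow[OF c]])
  then show ?thesis
    unfolding hdim_def triples_within_image[OF assms]
    by (simp add: card_image inj_on_subset[OF c W])
qed

lemma triples_on_image:
  assumes c: "inj_on c Z" and F: "triples_on Z F"
  shows "triples_on (c ` Z) ((`) c ` F)"
  unfolding triples_on_def
proof
  fix T assume "T \<in> (`) c ` F"
  then obtain S where S: "S \<in> F" "T = c ` S" by blast
  then have "S \<subseteq> Z" "card S = 3" using F by (auto simp: triples_on_def)
  then show "T \<subseteq> c ` Z \<and> card T = 3" using S(2) card_image[OF inj_on_subset[OF c]] by auto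
qed

text \<open>
  The defining extension property, for triple systems that literally extend \<open>H\<close> inside the type of
  \<open>M\<close>; a copy on natural numbers mediates.  Such a system belongs to the class because, by
  submodularity and strength of \<open>H\<close>, the predimension of \<open>W\<close> is at least that of \<open>W \<inter> H\<close>, a finite
  subset of \<open>M\<close>.
\<close>

lemma hrushovski_extension:
  fixes M :: "'a rstruct" and Z :: "'a set"
  assumes hr: "hrushovski_structure M"
    and H: "hstrong (runiv M) (r_triples M) H"
    and Z: "finite Z" "H \<subseteq> Z" and F: "triples_on Z F"
    and FH: "{T \<in> F. T \<subseteq> H} = {T \<in> r_triples M. T \<subseteq> H}"
    and le: "\<And>W. H \<subseteq> W \<Longrightarrow> W \<subseteq> Z \<Longrightarrow> hdim F H \<le> hdim F W"
  shows "\<exists>f. inj_on f Z \<and> f ` Z \<subseteq> runiv M \<and> (\<forall>a\<in>H. f a = a) \<and>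
    (`) f ` F = {T \<in> r_triples M. T \<subseteq> f ` Z} \<and> hstrong (runiv M) (r_triples M) (f ` Z)"
proof -
  let ?V = "runiv M" and ?E = "r_triples M"
  have M: "r_structure M" using hr by (simp add: hrushovski_structure_def)
  have finH: "finite H" and HV: "H \<subseteq> ?V" using H by (auto simp: hstrong_def)
  obtain c :: "'a \<Rightarrow> nat" where c: "inj_on c Z" using finite_imp_inj_to_nat_seg[OF Z(1)] by blast
  let ?F = "(`) c ` F"
  let ?B = "hstruct (c ` Z) ?F"
  have F': "triples_on (c ` Z) ?F" by (rule triples_on_image[OF c F])
  have trB: "r_triples ?B = ?F" by (rule r_triples_hstruct[OF F'])
  have dim: "hdim ?F (c ` W) = hdim F W" if "W \<subseteq> Z" for W by (rule hdim_image[OF c F that])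
  have nonneg: "0 \<le> hdim F W" if W: "W \<subseteq> Z" for W
  proof -
    have finW: "finite W" using W Z(1) by (rule finite_subset)
    have "{T \<in> F. T \<subseteq> W \<inter> H} = {T \<in> ?E. T \<subseteq> W \<inter> H}" using FH by blast
    then have "hdim F (W \<inter> H) = hdim ?E (W \<inter> H)" by (rule hdim_cong)
    also have "\<dots> \<ge> 0" using finW HV by (intro hrushovski_nonneg[OF hr]) auto
    finally have "0 \<le> hdim F (W \<inter> H)" .
    moreover have "hdim F H \<le> hdim F (W \<union> H)" using W Z(2) by (intro le) auto
    ultimately show ?thesis using hdim_submodular[OF finW finH, of F] by linarith
  qed
  have B: "?B \<in> r_class"
    unfolding r_class_iff trB
  proof (intro conjI allI impI)
    show "r_structure ?B" by (rule r_structure_hstruct[OF F'])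
    show "finite (runiv ?B)" using Z(1) by simp
    fix D assume "D \<subseteq> runiv ?B"
    then obtain W where "W \<subseteq> Z" "D = c ` W" by (auto simp: subset_image_iff)
    then show "0 \<le> hdim ?F D" using dim nonneg by simp
  qed
  \<comment> \<open>The copying map \<open>c\<close> preserves and reflects triples.\<close>
  have triple: "{c x, c y, c z} \<in> ?F \<longleftrightarrow> {x, y, z} \<in> F" if "x \<in> Z" "y \<in> Z" "z \<in> Z" for x y z
  proof -
    have "F \<subseteq> Pow Z" using F by (auto simp: triples_on_def)
    have "{x, y, z} \<in> Pow Z" using that by simp
    from inj_on_image_mem_iff[OF inj_on_image_Pow[OF c] this \<open>F \<subseteq> Pow Z\<close>]
    have "c ` {x, y, z} \<in> ?F \<longleftrightarrow> {x, y, z} \<in> F" .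
    then show ?thesis by simp
  qed
  have cdist: "c x = c y \<longleftrightarrow> x = y" if "x \<in> Z" "y \<in> Z" for x y using inj_on_eq_iff[OF c that] .
  have emb: "r_embedding c (r_induced M H) ?B"
    unfolding r_embedding_def
  proof (intro conjI ballI)
    have u: "runiv (r_induced M H) = H" by (simp add: r_induced_def)
    show "inj_on c (runiv (r_induced M H))" using inj_on_subset[OF c Z(2)] u by simp
    show "c ` runiv (r_induced M H) \<subseteq> runiv ?B" using Z(2) u by auto
    fix x y z assume "x \<in> runiv (r_induced M H)" "y \<in> runiv (r_induced M H)" "z \<in> runiv (r_induced M H)"
    then have xyz: "x \<in> H" "y \<in> H" "z \<in> H" by (simp_all add: u)
    then have xyzZ: "x \<in> Z" "y \<in> Z" "z \<in> Z" using Z(2) by blast+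
    have "rrel ?B (c x) (c y) (c z) \<longleftrightarrow> {x, y, z} \<in> F \<and> x \<noteq> y \<and> x \<noteq> z \<and> y \<noteq> z"
      using triple[OF xyzZ] xyzZ by (simp add: rrel_hstruct cdist)
    moreover have "{x, y, z} \<subseteq> H" using xyz by simp
    then have "{x, y, z} \<in> F \<longleftrightarrow> {x, y, z} \<in> ?E" using FH by blast
    moreover have "rrel (r_induced M H) x y z \<longleftrightarrow> {x, y, z} \<in> ?E \<and> x \<noteq> y \<and> x \<noteq> z \<and> y \<noteq> z"
      using xyz by (simp add: rrel_iff[OF M] r_induced_def)
    ultimately show "rrel ?B (c x) (c y) (c z) \<longleftrightarrow> rrel (r_induced M H) x y z" by simp
  qed
  have strongB: "r_strong (c ` H) ?B"
    unfolding r_strong_iff hstrong_def trB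
  proof (intro conjI allI impI; (elim conjE)?)
    show "finite (c ` H)" "c ` H \<subseteq> runiv ?B" using finH Z(2) by auto
    fix D assume D: "finite D" "c ` H \<subseteq> D" "D \<subseteq> runiv ?B"
    then obtain W where W: "W \<subseteq> Z" "D = c ` W" by (auto simp: subset_image_iff)
    then have "H \<subseteq> W" using D(2) image_subset_image_iff[OF c Z(2) W(1)] by simp
    then show "hdim ?F (c ` H) \<le> hdim ?F D" using dim[OF W(1)] dim[OF Z(2)] le W by simp
  qed
  have strongM: "r_strong H M" using H by (simp add: r_strong_iff)
  have ext: "\<And>A (B :: nat rstruct) g. r_strong A M \<and> B \<in> r_class \<and> r_embedding g (r_induced M A) B \<and>
      r_strong (g ` A) B \<Longrightarrow>
      \<exists>f. r_embedding f B M \<and> (\<forall>a\<in>A. f (g a) = a) \<and> r_strong (f ` runiv B) M"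
    using hr unfolding hrushovski_structure_def by blast
  obtain h where h: "r_embedding h ?B M" "\<forall>a\<in>H. h (c a) = a" "r_strong (h ` runiv ?B) M"
    using ext[of H ?B c] strongM B emb strongB by blast
  define f where "f = h \<circ> c"
  have injh: "inj_on h (c ` Z)" using h(1) by (simp add: r_embedding_def)
  have injf: "inj_on f Z" unfolding f_def by (rule comp_inj_on[OF c injh])
  have fZ: "f ` Z = h ` runiv ?B" by (simp add: f_def image_comp)
  have fdist: "f x = f y \<longleftrightarrow> x = y" if "x \<in> Z" "y \<in> Z" for x y using inj_on_eq_iff[OF injf that] .
  have rel: "{f x, f y, f z} \<in> ?E \<longleftrightarrow> {x, y, z} \<in> F"
    if Z3: "x \<in> Z" "y \<in> Z" "z \<in> Z" and d: "x \<noteq> y" "x \<noteq> z" "y \<noteq> z" for x y z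
  proof -
    have "rrel M (f x) (f y) (f z) \<longleftrightarrow> rrel ?B (c x) (c y) (c z)"
      using h(1) Z3 by (simp add: r_embedding_def f_def)
    then show ?thesis
      using Z3 d triple[OF Z3] by (simp add: rrel_iff[OF M] rrel_hstruct fdist cdist)
  qed
  have "(`) f ` F = {T \<in> ?E. T \<subseteq> f ` Z}"
  proof (intro equalityI subsetI)
    fix T assume "T \<in> (`) f ` F"
    then obtain S where S: "S \<in> F" "T = f ` S" by blast
    obtain x y z where xyz: "S = {x, y, z}" "x \<noteq> y" "x \<noteq> z" "y \<noteq> z" "x \<in> Z" "y \<in> Z" "z \<in> Z"
      using triple_obtain[OF F S(1)] by metis
    have "{f x, f y, f z} \<in> ?E" using rel[OF xyz(5-7,2-4)] S(1) xyz(1) by simp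
    moreover have "T = {f x, f y, f z}" using S(2) xyz(1) by simp
    ultimately show "T \<in> {T \<in> ?E. T \<subseteq> f ` Z}" using xyz(5-7) by simp
  next
    fix T assume "T \<in> {T \<in> ?E. T \<subseteq> f ` Z}"
    then have T: "T \<in> ?E" "T \<subseteq> f ` Z" by auto
    obtain u v w where uvw: "T = {u, v, w}" "u \<noteq> v" "u \<noteq> w" "v \<noteq> w"
      using triple_obtain[OF triples_on_r_triples T(1)] by metis
    then obtain x y z where xyz: "u = f x" "v = f y" "w = f z" "x \<in> Z" "y \<in> Z" "z \<in> Z"
      using T(2) by auto
    have "x \<noteq> y" "x \<noteq> z" "y \<noteq> z" using uvw xyz by auto
    then have "{x, y, z} \<in> F" using rel[OF xyz(4-6)] T(1) uvw(1) xyz(1-3) by simp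
    moreover have "T = f ` {x, y, z}" using uvw(1) xyz by simp
    ultimately show "T \<in> (`) f ` F" by blast
  qed
  moreover have "f ` Z \<subseteq> ?V" using h(1) unfolding fZ by (simp add: r_embedding_def)
  moreover have "\<forall>a\<in>H. f a = a" using h(2) by (simp add: f_def)
  moreover have "hstrong ?V ?E (f ` Z)" using h(3) by (simp only: fZ r_strong_iff)
  ultimately show ?thesis using injf by blast
qed

lemma bij_betw_fibres:
  assumes fin: "finite S" "finite T" and card: "\<And>y. card {s \<in> S. u s = y} = card {t \<in> T. v t = y}"
  shows "\<exists>b. bij_betw b S T \<and> (\<forall>s\<in>S. v (b s) = u s)"
proof -
  have "\<exists>b. bij_betw b {s \<in> S. u s = y} {t \<in> T. v t = y}" for y
    using fin card[of y] by (intro finite_same_card_bij) auto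
  then obtain b where b: "\<And>y. bij_betw (b y) {s \<in> S. u s = y} {t \<in> T. v t = y}" by metis
  have img: "b y ` {s \<in> S. u s = y} = {t \<in> T. v t = y}" for y using b[of y] by (simp add: bij_betw_def)
  let ?b = "\<lambda>s. b (u s) s"
  have mem: "?b s \<in> T \<and> v (?b s) = u s" if "s \<in> S" for s
    using img[of "u s"] that by blast
  have "bij_betw ?b S T"
    unfolding bij_betw_def
  proof
    show "inj_on ?b S"
    proof (rule inj_onI)
      fix s s' assume s: "s \<in> S" "s' \<in> S" "?b s = ?b s'"
      then have e: "u s = u s'" using mem by metis
      have "inj_on (b (u s)) {x \<in> S. u x = u s}" using b[of "u s"] by (simp add: bij_betw_def)
      then show "s = s'" using s e by (auto dest: inj_onD)
    qed
    show "?b ` S = T"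
    proof
      show "T \<subseteq> ?b ` S"
      proof
        fix t assume "t \<in> T"
        then have "t \<in> b (v t) ` {s \<in> S. u s = v t}" using img[of "v t"] by blast
        then obtain s where "s \<in> S" "u s = v t" "t = b (v t) s" by blast
        then have "t = ?b s" by simp
        then show "t \<in> ?b ` S" using \<open>s \<in> S\<close> by blast
      qed
    qed (use mem in blast)
  qed
  then show ?thesis using mem by blast
qed

lemma obtain_fresh:
  assumes "finite S" "infinite X"
  obtains \<theta> where "inj_on \<theta> S" "\<theta> ` S \<subseteq> X"
proof -
  obtain Y where Y: "Y \<subseteq> X" "finite Y" "card Y = card S"
    using infinite_arbitrarily_large[OF assms(2), of "card S"] by blast
  then obtain \<theta> where "bij_betw \<theta> S Y" using finite_same_card_bij[OF assms(1), of Y] by metis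
  then show thesis using that Y(1) by (auto simp: bij_betw_def)
qed

lemma line_within:
  assumes "P \<subseteq> H"
  shows "line {T \<in> E. T \<subseteq> H} P = line E P \<inter> H"
  using assms by (auto simp: line_def)

text \<open>
  All triples inside \<open>f ` Z\<close> are images of triples in \<open>F\<close>, so lines computed in the larger system
  agree with the old ones as long as one stays inside the image.
\<close>

lemma line_image:
  assumes f: "inj_on f Z" and F: "triples_on Z F" and img: "(`) f ` F = {T \<in> E. T \<subseteq> f ` Z}"
    and P: "P \<subseteq> Z" and X: "X \<subseteq> Z"
  shows "line E (f ` P) \<inter> f ` X = f ` (line F P \<inter> X)"
proof -
  have FZ: "F \<subseteq> Pow Z" using F by (auto simp: triples_on_def)
  have "f x \<in> line E (f ` P) \<longleftrightarrow> x \<in> line F P" if x: "x \<in> Z" for x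
  proof -
    have xP: "insert x P \<in> Pow Z" using x P by simp
    have "f x \<in> f ` P \<longleftrightarrow> x \<in> P" by (rule inj_on_image_mem_iff[OF f x P])
    moreover have "insert (f x) (f ` P) \<in> E \<longleftrightarrow> f ` (insert x P) \<in> (`) f ` F"
      unfolding img using xP by auto
    moreover have "f ` (insert x P) \<in> (`) f ` F \<longleftrightarrow> insert x P \<in> F"
      by (rule inj_on_image_mem_iff[OF inj_on_image_Pow[OF f] xP FZ])
    ultimately show ?thesis by (simp add: line_def)
  qed
  then show ?thesis using X by blast
qed

lemma d0s_finite_family:
  assumes B: "s_structure B" "finite (univ B)" and D: "D \<subseteq> univ B"
  shows "d0s (s_induced B D)
    = int (card D) - int (\<Sum>j\<in>(SIGMA C:cliques B. {..<mult B C}). card (fst j \<inter> D) - 2)"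
proof (rule d0s_presents[OF B(1) presents_cliques[OF B(1)]])
  have "cliques B \<subseteq> Pow (univ B)" using s_structure_clique(1)[OF B(1)] by blast
  then have "finite (cliques B)" using B(2) by (meson finite_Pow_iff finite_subset)
  then show "finite (SIGMA C:cliques B. {..<mult B C})" by simp
  show "finite D" using D B(2) by (rule finite_subset)
qed (use D in auto)

text \<open>
  The universe of the amalgam is the union of a strong hull \<open>H\<close> of \<open>A\<close>, a copy \<open>Bs\<close> of \<open>B\<close> that meets
  \<open>H\<close> in \<open>A\<close>, and new pairs for those cliques of \<open>B\<close> that have fewer than three points in \<open>A\<close>.
\<close>

theorem S_reduct_extension:
  fixes M :: "'a rstruct" and B :: "'b sstruct"
  assumes hr: "hrushovski_structure M"
    and A: "s_strong A (S_reduct M)"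
    and B: "s_structure B" "finite (univ B)"
    and g: "strong_embedding g (s_induced (S_reduct M) A) B"
  shows "\<exists>h. strong_embedding h B (S_reduct M) \<and> (\<forall>a\<in>A. h (g a) = a)"
proof -
  let ?V = "runiv M" and ?E = "r_triples M" and ?N = "S_reduct M"
  have M: "r_structure M" using hr by (simp add: hrushovski_structure_def)
  note nonneg = hrushovski_nonneg[OF hr]
  have N: "s_structure ?N" by (rule s_structure_S_reduct[OF M nonneg])
  have PN: "presents (pairs ?V) (line ?E) ?N" by (rule presents_S_reduct[OF M nonneg])
  have finA: "finite A" and AV: "A \<subseteq> ?V" using A by (auto simp: s_strong_def)
  obtain H where H: "A \<subseteq> H" "hstrong ?V ?E H" using hstrong_closure[OF nonneg finA AV] by blast
  have finH: "finite H" and HV: "H \<subseteq> ?V" using H(2) by (auto simp: hstrong_def)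

  let ?G = "g ` A"
  have g_iso: "s_iso g (s_induced ?N A) (s_induced B ?G)" and GB: "?G \<subseteq> univ B"
    and G_strong: "s_strong ?G B"
    using g by (auto simp: strong_embedding_def s_embedding_def)
  have inj_g: "inj_on g A" using s_iso_inj[OF g_iso] by simp
  have finG: "finite ?G" using finA by simp

  \<comment> \<open>Cliques of \<open>B\<close> repeated by multiplicity (\<open>I\<close>), those with a large trace on \<open>A\<close> (\<open>J\<close>), and the
    pairs of \<open>M\<close> with a large trace on \<open>A\<close> (\<open>S\<close>).\<close>
  define I where "I = (SIGMA C:cliques B. {..<mult B C})"
  have cl_sub: "C \<subseteq> univ B" if "C \<in> cliques B" for C using s_structure_clique(1)[OF B(1) that] .
  have finI: "finite I"
  proof -
    have "cliques B \<subseteq> Pow (univ B)" using cl_sub by blast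
    then have "finite (cliques B)" using B(2) by (meson finite_Pow_iff finite_subset)
    then show ?thesis by (simp add: I_def)
  qed
  have PB: "presents I fst B" unfolding I_def by (rule presents_cliques[OF B(1)])
  have I_sub: "fst j \<subseteq> univ B" if "j \<in> I" for j
    using that by (intro cl_sub) (auto simp: I_def)
  define J where "J = {j \<in> I. 3 \<le> card (fst j \<inter> ?G)}"
  have JI: "J \<subseteq> I" by (auto simp: J_def)
  define S where "S = {P \<in> pairs ?V. 3 \<le> card (line ?E P \<inter> A)}"
  have finS: "finite S" unfolding S_def by (rule finite_relevant[OF PN finA]) (use AV in simp)
  have S_H: "P \<subseteq> H" if P: "P \<in> S" for P
  proof (rule pair_within_hstrong[OF triples_on_r_triples H(2)])
    show "P \<in> pairs ?V" using P by (simp add: S_def)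
    have "card (line ?E P \<inter> A) \<le> card (line ?E P \<inter> H)" using H(1) finH by (intro card_mono) auto
    then show "3 \<le> card (line ?E P \<inter> H)" using P by (simp add: S_def)
  qed

  \<comment> \<open>For each possible trace the indices and the pairs are equally many, since \<open>g\<close> preserves the
    weights of the induced structures; so \<open>J\<close> and \<open>S\<close> correspond to each other over the traces.\<close>
  have fibres: "card {j \<in> J. fst j \<inter> ?G = Y} = card {P \<in> S. g ` (line ?E P \<inter> A) = Y}" for Y
  proof (cases "Y \<subseteq> ?G \<and> 3 \<le> card Y")
    case True
    then obtain X where X: "X \<subseteq> A" "Y = g ` X" by (auto simp: subset_image_iff)
    have injX: "inj_on g X" by (rule inj_on_subset[OF inj_g X(1)])
    have cX: "card Y = card X" using X(2) card_image[OF injX] by simp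
    have finX: "finite X" using X(1) finA by (rule finite_subset)
    have X3: "at_least3 X" using True cX finX by (simp add: at_least3_finite)
    have Y3: "at_least3 Y" using X3 at_least3_image[OF injX] X(2) by simp
    have "card {j \<in> I. fst j \<inter> ?G = Y} = weight (s_induced B ?G) Y"
      using presents_induced[OF B(1) PB GB] True Y3 by (simp add: presents_def)
    also have "\<dots> = weight (s_induced ?N A) X"
      using s_iso_weight[OF s_structure_induced[OF N] g_iso, of X] AV X by simp
    also have "\<dots> = card {P \<in> pairs ?V. line ?E P \<inter> A = X}"
      using presents_induced[OF N PN, of A] AV X(1) X3 by (simp add: presents_def)
    also have "{P \<in> pairs ?V. line ?E P \<inter> A = X} = {P \<in> S. g ` (line ?E P \<inter> A) = Y}"
    proof -
      have "g ` (line ?E P \<inter> A) = Y \<longleftrightarrow> line ?E P \<inter> A = X" for P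
        using inj_on_image_eq_iff[OF inj_g, of "line ?E P \<inter> A" X] X by simp
      then show ?thesis using True cX by (auto simp: S_def)
    qed
    also have "{j \<in> I. fst j \<inter> ?G = Y} = {j \<in> J. fst j \<inter> ?G = Y}" using True by (auto simp: J_def)
    finally show ?thesis .
  next
    case False
    have 1: "{j \<in> J. fst j \<inter> ?G = Y} = {}" using False by (auto simp: J_def)
    have 2: "card (g ` (line ?E P \<inter> A)) = card (line ?E P \<inter> A)" for P
      by (rule card_image[OF inj_on_subset[OF inj_g]]) simp
    have "{P \<in> S. g ` (line ?E P \<inter> A) = Y} = {}"
    proof (rule equals0I)
      fix P assume "P \<in> {P \<in> S. g ` (line ?E P \<inter> A) = Y}"
      then have "3 \<le> card Y" "Y \<subseteq> ?G" using 2[of P] by (auto simp: S_def)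
      then show False using False by simp
    qed
    then show ?thesis using 1 by (simp only: card.empty)
  qed
  from bij_betw_fibres[OF finite_subset[OF JI finI] finS fibres]
  obtain q where q: "bij_betw q J S" and q_trace: "\<And>j. j \<in> J \<Longrightarrow> g ` (line ?E (q j) \<inter> A) = fst j \<inter> ?G"
    by (elim exE conjE) simp

  \<comment> \<open>New points are needed for \<open>B\<close> outside the image of \<open>A\<close>, and two for each index outside \<open>J\<close>.\<close>
  define FR where "FR = Inl ` (univ B - ?G) \<union> Inr ` ((I - J) \<times> (UNIV :: bool set))"
  have "finite FR" using B(2) finI by (simp add: FR_def)
  moreover have "infinite (- H)"
    using hrushovski_infinite_type[OF hr] finH by (simp add: finite_compl)
  ultimately obtain \<theta> where inj_\<theta>: "inj_on \<theta> FR" and \<theta>_H: "\<theta> ` FR \<subseteq> - H"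
    using obtain_fresh by metis
  have Inl_FR: "Inl b \<in> FR" if "b \<in> univ B" "b \<notin> ?G" for b using that by (simp add: FR_def)
  have Inr_FR: "Inr (j, t) \<in> FR" if "j \<in> I - J" for j t using that by (simp add: FR_def)
  have \<theta>_eq: "\<theta> x = \<theta> y \<longleftrightarrow> x = y" if "x \<in> FR" "y \<in> FR" for x y using inj_on_eq_iff[OF inj_\<theta> that] .
  have \<theta>_notH: "\<theta> x \<notin> H" if "x \<in> FR" for x using \<theta>_H that by blast

  define \<iota> where "\<iota> b = (if b \<in> ?G then inv_into A g b else \<theta> (Inl b))" for b
  define p where "p j = (if j \<in> J then q j else {\<theta> (Inr (j, False)), \<theta> (Inr (j, True))})" for j
  have \<iota>_g: "\<iota> (g a) = a" if "a \<in> A" for a using that inj_g by (simp add: \<iota>_def)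
  have \<iota>_H: "\<iota> b \<in> H \<longleftrightarrow> b \<in> ?G" if "b \<in> univ B" for b
  proof (cases "b \<in> ?G")
    case True
    then show ?thesis using \<iota>_g H(1) by auto
  next
    case False
    then show ?thesis using \<theta>_notH[OF Inl_FR[OF that False]] by (simp add: \<iota>_def)
  qed
  have inj_\<iota>: "inj_on \<iota> (univ B)"
  proof (rule inj_onI)
    fix b b' assume b: "b \<in> univ B" "b' \<in> univ B" "\<iota> b = \<iota> b'"
    show "b = b'"
    proof (cases "b \<in> ?G")
      case True
      then have "b' \<in> ?G" using \<iota>_H[OF b(1)] \<iota>_H[OF b(2)] b(3) by simp
      then show ?thesis using True b(3) \<iota>_g by auto
    next
      case False
      then have F': "b' \<notin> ?G" using \<iota>_H[OF b(1)] \<iota>_H[OF b(2)] b(3) by simp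
      have "\<theta> (Inl b) = \<theta> (Inl b')" using b(3) False F' by (simp add: \<iota>_def)
      then show ?thesis using \<theta>_eq[OF Inl_FR[OF b(1) False] Inl_FR[OF b(2) F']] by simp
    qed
  qed
  have \<iota>_G: "\<iota> ` ?G = A" using \<iota>_g by (force simp: image_iff)
  have \<iota>_Int_H: "\<iota> ` X \<inter> H = \<iota> ` (X \<inter> ?G)" if "X \<subseteq> univ B" for X
    using \<iota>_H that by blast
  have card_\<iota>: "card (\<iota> ` X) = card X" if "X \<subseteq> univ B" for X
    by (rule card_image[OF inj_on_subset[OF inj_\<iota> that]])
  have \<iota>_Int: "\<iota> ` X \<inter> \<iota> ` Y = \<iota> ` (X \<inter> Y)" if "X \<subseteq> univ B" "Y \<subseteq> univ B" for X Y
    using inj_on_image_Int[OF inj_\<iota> that] by simp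

  define Bs where "Bs = \<iota> ` univ B"
  define K where "K j = \<iota> ` fst j" for j :: "'b set \<times> nat"
  define E0 where "E0 = {T \<in> ?E. T \<subseteq> H}"
  have HBs: "H \<inter> Bs = A"
    using \<iota>_Int_H[of "univ B"] GB \<iota>_G unfolding Bs_def by (simp add: Int_absorb1 Int_commute)
  have line_E0: "line E0 P = line ?E P \<inter> H" if "P \<subseteq> H" for P
    unfolding E0_def by (rule line_within[OF that])
  have line_E0_A: "line E0 P \<inter> Bs = line ?E P \<inter> A" if "P \<subseteq> H" for P
    using line_E0[OF that] HBs by blast
  have K_H: "K j \<inter> H = \<iota> ` (fst j \<inter> ?G)" if "j \<in> I" for j
    unfolding K_def by (rule \<iota>_Int_H[OF I_sub[OF that]])
  have card_K_H: "card (K j \<inter> H) = card (fst j \<inter> ?G)" if "j \<in> I" for j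
    unfolding K_H[OF that] using I_sub[OF that] by (intro card_\<iota>) blast
  have qS: "q j \<in> S" if "j \<in> J" for j using q that by (auto simp: bij_betw_def)
  have trace: "line ?E (q j) \<inter> A = K j \<inter> H" if j: "j \<in> J" for j
  proof -
    have "j \<in> I" using j JI by blast
    then have "K j \<inter> H = \<iota> ` g ` (line ?E (q j) \<inter> A)" by (simp only: K_H q_trace[OF j])
    also have "\<dots> = line ?E (q j) \<inter> A" using \<iota>_g by (force simp: image_iff)
    finally show ?thesis by simp
  qed
  have d0s_B: "d0s (s_induced B X) = int (card X) - int (\<Sum>j\<in>I. card (fst j \<inter> X) - 2)"
    if "X \<subseteq> univ B" for X
    unfolding I_def by (rule d0s_finite_family[OF B that])

  interpret am: clique_amalgam H Bs E0 I J K p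
  proof
    show "finite H" by (rule finH)
    show "finite Bs" using B(2) by (simp add: Bs_def)
    show "finite I" by (rule finI)
    show "J \<subseteq> I" by (rule JI)
    show "triples_on H E0" using triples_on_r_triples[of M] by (auto simp: triples_on_def E0_def)
    fix j
    show "K j \<subseteq> Bs" if "j \<in> I" using I_sub[OF that] by (auto simp: K_def Bs_def)
    show "card (p j) = 2" if "j \<in> I"
    proof (cases "j \<in> J")
      case True
      then show ?thesis using qS[OF True] by (simp add: p_def S_def pairs_def)
    next
      case False
      then show ?thesis using \<theta>_eq[OF Inr_FR Inr_FR, of j j False True] that by (simp add: p_def)
    qed
    show "p j \<subseteq> H" if "j \<in> J" using S_H[OF qS[OF that]] that by (simp add: p_def)
    show "line E0 (p j) \<inter> Bs = K j \<inter> H" if "j \<in> J"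
      using line_E0_A[OF S_H[OF qS[OF that]]] trace[OF that] that by (simp add: p_def)
    show "3 \<le> card (K j \<inter> H)" if "j \<in> J" using that card_K_H[of j] by (simp add: J_def)
    show "card (K j \<inter> H) \<le> 2" if "j \<in> I - J" using that card_K_H[of j] by (auto simp: J_def)
    show "p j \<inter> (H \<union> Bs) = {}" if j: "j \<in> I - J"
    proof -
      have "\<theta> (Inr (j, t)) \<notin> Bs" for t
      proof
        assume "\<theta> (Inr (j, t)) \<in> Bs"
        then obtain b where b: "b \<in> univ B" "\<theta> (Inr (j, t)) = \<iota> b" by (auto simp: Bs_def)
        have "b \<notin> ?G" using \<iota>_H[OF b(1)] b(2) \<theta>_notH[OF Inr_FR[OF j]] by metis
        then show False using b(2) \<theta>_eq[OF Inr_FR[OF j] Inl_FR[OF b(1)]] by (simp add: \<iota>_def)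
      qed
      then show ?thesis using \<theta>_notH[OF Inr_FR[OF j]] j by (simp add: p_def)
    qed
    show "p i \<inter> p j = {}" if "i \<in> I - J" "j \<in> I - J" "i \<noteq> j" for i
      using \<theta>_eq[OF Inr_FR[OF that(1)] Inr_FR[OF that(2)]] that by (simp add: p_def)
  next
    fix P assume P: "P \<in> pairs H" "3 \<le> card (line E0 P \<inter> Bs)"
    then have PH: "P \<subseteq> H" by (simp add: pairs_def)
    have "P \<in> S" using P line_E0_A[OF PH] HV by (auto simp: S_def pairs_def)
    then have "P \<in> q ` J" using q by (simp add: bij_betw_def)
    moreover have "p ` J = q ` J" by (rule image_cong[OF refl]) (simp add: p_def)
    ultimately show "P \<in> p ` J" by simp
  next
    have "inj_on q J" using q by (simp add: bij_betw_def)
    moreover have "inj_on p J = inj_on q J" by (rule inj_on_cong) (simp add: p_def)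
    ultimately show "inj_on p J" by simp
  next
    fix D assume D: "H \<inter> Bs \<subseteq> D" "D \<subseteq> Bs"
    then obtain X where X: "X \<subseteq> univ B" "D = \<iota> ` X" by (auto simp: Bs_def subset_image_iff)
    have "\<iota> ` ?G \<subseteq> \<iota> ` X" using D(1) HBs \<iota>_G X(2) by simp
    then have GX: "?G \<subseteq> X" using image_subset_image_iff[OF inj_\<iota> GB X(1)] by simp
    have "finite X" using X(1) B(2) by (rule finite_subset)
    then have "d0s (s_induced B ?G) \<le> d0s (s_induced B X)"
      using G_strong GX X(1) by (simp add: s_strong_def)
    moreover have "(\<Sum>j\<in>I. card (K j \<inter> D) - 2) = (\<Sum>j\<in>I. card (fst j \<inter> X) - 2)"
    proof (rule sum.cong[OF refl])
      fix j assume j: "j \<in> I"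
      have "K j \<inter> D = \<iota> ` (fst j \<inter> X)"
        unfolding K_def X(2) by (rule \<iota>_Int[OF I_sub[OF j] X(1)])
      moreover have "card (\<iota> ` (fst j \<inter> X)) = card (fst j \<inter> X)" using X(1) by (intro card_\<iota>) blast
      ultimately show "card (K j \<inter> D) - 2 = card (fst j \<inter> X) - 2" by simp
    qed
    moreover have "(\<Sum>j\<in>I. card (K j \<inter> H) - 2) = (\<Sum>j\<in>I. card (fst j \<inter> ?G) - 2)"
      using card_K_H by (intro sum.cong) auto
    moreover have "card D = card X" using card_\<iota>[OF X(1)] X(2) by simp
    moreover have "card (H \<inter> Bs) = card ?G" using HBs card_image[OF inj_g] by simp
    ultimately show "card (H \<inter> Bs) + (\<Sum>j\<in>I. card (K j \<inter> D) - 2)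
        \<le> card D + (\<Sum>j\<in>I. card (K j \<inter> H) - 2)"
      using d0s_B[OF GB] d0s_B[OF X(1)] by linarith
  qed

  let ?Z = "am.Z" and ?F = "am.E"
  have HZ: "H \<subseteq> ?Z" and BsZ: "Bs \<subseteq> ?Z" by (auto simp: am.Z_def)
  have FH: "{T \<in> ?F. T \<subseteq> H} = {T \<in> ?E. T \<subseteq> H}" 
    unfolding E0_def[symmetric] by (rule am.E_within_H)
  have "\<exists>f. inj_on f ?Z \<and> f ` ?Z \<subseteq> ?V \<and> (\<forall>a\<in>H. f a = a) \<and>
      (`) f ` ?F = {T \<in> ?E. T \<subseteq> f ` ?Z} \<and> hstrong ?V ?E (f ` ?Z)"
    by (rule hrushovski_extension[OF hr H(2) am.finite_Z HZ am.triples_on_E FH])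
      (rule am.hdim_E_H_le)
  then obtain f where injf: "inj_on f ?Z" and fV: "f ` ?Z \<subseteq> ?V" and f_id: "\<And>a. a \<in> H \<Longrightarrow> f a = a"
    and fE: "(`) f ` ?F = {T \<in> ?E. T \<subseteq> f ` ?Z}" and fZ: "hstrong ?V ?E (f ` ?Z)"
    by (elim exE conjE) simp
  have card_f: "card (f ` X) = card X" if "X \<subseteq> ?Z" for X
    by (rule card_image[OF inj_on_subset[OF injf that]])
  have line_f: "line ?E (f ` P) \<inter> f ` X = f ` (line ?F P \<inter> X)" if "P \<subseteq> ?Z" "X \<subseteq> ?Z" for P X
    by (rule line_image[OF injf am.triples_on_E fE that])
  define h where "h = f \<circ> \<iota>"
  have h_img: "h ` X = f ` \<iota> ` X" for X by (simp add: h_def image_comp)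
  have hB: "h ` univ B = f ` Bs" unfolding h_img Bs_def ..
  have hV: "f ` Bs \<subseteq> ?V" using fV BsZ by blast
  have inj_h: "inj_on h (univ B)"
    unfolding h_def by (rule comp_inj_on[OF inj_\<iota> inj_on_subset[OF injf]]) (use BsZ in \<open>simp add: Bs_def\<close>)

  \<comment> \<open>Pairs of \<open>M\<close> with three points of their line in the copy of \<open>B\<close> lie in the strong set \<open>f ` Z\<close> and
    are therefore images of the pairs \<open>p j\<close>.\<close>
  have "s_iso h B (s_induced ?N (f ` Bs))"
  proof (rule s_isoI[OF B(1) s_structure_induced[OF N]])
    show "f ` Bs \<subseteq> univ ?N" using hV by simp
    show "bij_betw h (univ B) (univ (s_induced ?N (f ` Bs)))"
      using inj_h hB by (simp add: bij_betw_def)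
    fix X assume X: "X \<subseteq> univ B" "at_least3 X"
    have finX: "finite X" using X(1) B(2) by (rule finite_subset)
    have \<iota>XZ: "\<iota> ` X \<subseteq> ?Z" and \<iota>XB: "\<iota> ` X \<subseteq> Bs" using X(1) BsZ by (auto simp: Bs_def)
    have c3: "3 \<le> card (h ` X)"
      using X finX card_image[OF inj_on_subset[OF inj_h X(1)]] by (simp add: at_least3_finite)
    have h3: "at_least3 (h ` X)" using X(2) at_least3_image[OF inj_on_subset[OF inj_h X(1)]] by simp
    have hX: "h ` X \<subseteq> f ` Bs" using X(1) hB by blast
    have lineB: "line ?E (f ` p j) \<inter> f ` Bs = h ` fst j" if j: "j \<in> I" for j
      using line_f[OF am.p_sub_Z[OF j] BsZ] am.line_E_p[OF j] by (simp add: h_img K_def)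
    have "{P \<in> pairs ?V. line ?E P \<inter> f ` Bs = h ` X} = (\<lambda>j. f ` p j) ` {j \<in> I. fst j = X}"
    proof (intro equalityI subsetI)
      fix P assume "P \<in> {P \<in> pairs ?V. line ?E P \<inter> f ` Bs = h ` X}"
      then have P: "P \<in> pairs ?V" "line ?E P \<inter> f ` Bs = h ` X" by auto
      have "card (line ?E P \<inter> f ` Bs) \<le> card (line ?E P \<inter> f ` ?Z)"
        using BsZ am.finite_Z by (intro card_mono) auto
      then have "P \<subseteq> f ` ?Z"
        using pair_within_hstrong[OF triples_on_r_triples fZ P(1)] P(2) c3 by simp
      then obtain Q where Q: "Q \<subseteq> ?Z" "P = f ` Q" by (auto simp: subset_image_iff)
      have "card Q = 2" using P(1) card_f[OF Q(1)] Q(2) by (simp add: pairs_def)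
      then have QZ: "Q \<in> pairs ?Z" using Q(1) by (simp add: pairs_def)
      have "f ` (line ?F Q \<inter> Bs) = f ` \<iota> ` X"
        using line_f[OF Q(1) BsZ] P(2) Q(2) by (simp add: h_img)
      moreover have "line ?F Q \<inter> Bs \<subseteq> ?Z" using BsZ by blast
      ultimately have QX: "line ?F Q \<inter> Bs = \<iota> ` X" using inj_on_image_eq_iff[OF injf _ \<iota>XZ] by blast
      have "3 \<le> card (line ?F Q \<inter> Bs)" unfolding QX using c3 card_f[OF \<iota>XZ] by (simp add: h_img)
      then obtain j where j: "j \<in> I" "Q = p j" using am.rich_pair[OF QZ] by blast
      have "\<iota> ` fst j = \<iota> ` X" using am.line_E_p[OF j(1)] QX j(2) by (simp add: K_def)
      then have "fst j = X" using inj_on_image_eq_iff[OF inj_\<iota> I_sub[OF j(1)] X(1)] by simp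
      then show "P \<in> (\<lambda>j. f ` p j) ` {j \<in> I. fst j = X}" using j Q(2) by blast
    next
      fix P assume "P \<in> (\<lambda>j. f ` p j) ` {j \<in> I. fst j = X}"
      then obtain j where j: "j \<in> I" "fst j = X" "P = f ` p j" by blast
      have "P \<subseteq> ?V" using j(3) am.p_sub_Z[OF j(1)] fV by blast
      moreover have "card P = 2" using j(3) card_f[OF am.p_sub_Z[OF j(1)]] am.card_p[OF j(1)] by simp
      ultimately show "P \<in> {P \<in> pairs ?V. line ?E P \<inter> f ` Bs = h ` X}"
        using lineB[OF j(1)] j by (simp add: pairs_def)
    qed
    moreover have "inj_on (\<lambda>j. f ` p j) {j \<in> I. fst j = X}"
    proof (rule inj_onI)
      fix i j assume ij: "i \<in> {j \<in> I. fst j = X}" "j \<in> {j \<in> I. fst j = X}" "f ` p i = f ` p j"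
      then have "p i = p j" using inj_on_image_eq_iff[OF injf am.p_sub_Z am.p_sub_Z] by blast
      then show "i = j" using inj_onD[OF am.inj_p] ij(1,2) by blast
    qed
    ultimately have "card {P \<in> pairs ?V. line ?E P \<inter> f ` Bs = h ` X} = card {j \<in> I. fst j = X}"
      by (simp add: card_image)
    moreover have "weight (s_induced ?N (f ` Bs)) (h ` X) = card {P \<in> pairs ?V. line ?E P \<inter> f ` Bs = h ` X}"
      using presents_induced[OF N PN, of "f ` Bs"] hV hX h3 by (simp add: presents_def)
    moreover have "weight B X = card {j \<in> I. fst j = X}" using PB X by (simp add: presents_def)
    ultimately show "weight (s_induced ?N (f ` Bs)) (h ` X) = weight B X" by simp
  qed
  then have emb: "s_embedding h B ?N" using hB hV by (simp add: s_embedding_def)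

  have "s_strong (f ` ?Z) ?N" by (rule hstrong_imp_s_strong[OF M nonneg fZ])
  then have "s_strong (f ` Bs) ?N"
  proof (rule s_strong_trans[OF N])
    show "f ` Bs \<subseteq> f ` ?Z" using BsZ by blast
    fix D assume D: "f ` Bs \<subseteq> D" "D \<subseteq> f ` ?Z"
    then obtain X where X: "X \<subseteq> ?Z" "D = f ` X" by (auto simp: subset_image_iff)
    have BsX: "Bs \<subseteq> X" using D(1) image_subset_image_iff[OF injf BsZ X(1)] X(2) by simp
    have pairs_f: "pairs (f ` ?Z) = (`) f ` pairs ?Z"
    proof (intro equalityI subsetI)
      fix P assume "P \<in> pairs (f ` ?Z)"
      then obtain Q where Q: "Q \<subseteq> ?Z" "P = f ` Q" "card P = 2" by (auto simp: pairs_def subset_image_iff)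
      then have "Q \<in> pairs ?Z" using card_f[OF Q(1)] by (simp add: pairs_def)
      then show "P \<in> (`) f ` pairs ?Z" using Q(2) by blast
    next
      fix P assume "P \<in> (`) f ` pairs ?Z"
      then show "P \<in> pairs (f ` ?Z)" using card_f by (auto simp: pairs_def)
    qed
    have "pairs ?Z \<subseteq> Pow ?Z" by (auto simp: pairs_def)
    then have inj_pairs: "inj_on ((`) f) (pairs ?Z)" by (rule inj_on_subset[OF inj_on_image_Pow[OF injf]])
    have dim: "d0s (s_induced ?N (f ` Y))
        = int (card Y) - int (\<Sum>P\<in>pairs ?Z. card (line ?F P \<inter> Y) - 2)" if Y: "Y \<subseteq> ?Z" for Y
    proof -
      have "(\<Sum>P\<in>pairs (f ` ?Z). card (line ?E P \<inter> f ` Y) - 2)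
          = (\<Sum>P\<in>pairs ?Z. card (line ?E (f ` P) \<inter> f ` Y) - 2)"
        unfolding pairs_f by (simp add: sum.reindex[OF inj_pairs])
      also have "\<dots> = (\<Sum>P\<in>pairs ?Z. card (line ?F P \<inter> Y) - 2)"
      proof (rule sum.cong[OF refl])
        fix P assume "P \<in> pairs ?Z"
        then have "P \<subseteq> ?Z" by (simp add: pairs_def)
        then show "card (line ?E (f ` P) \<inter> f ` Y) - 2 = card (line ?F P \<inter> Y) - 2"
          using line_f[OF _ Y] card_f[of "line ?F P \<inter> Y"] Y by (simp add: le_infI2)
      qed
      finally show ?thesis
        using d0s_S_reduct[OF N PN fZ, of "f ` Y"] card_f[OF Y] Y by (simp add: image_mono)
    qed
    have "card Bs + (\<Sum>P\<in>pairs ?Z. card (line ?F P \<inter> X) - 2)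
        \<le> card X + (\<Sum>P\<in>pairs ?Z. card (line ?F P \<inter> Bs) - 2)"
    proof (rule am.line_sum_E[OF _ BsX X(1)])
      fix C assume C: "H \<inter> Bs \<subseteq> C" "C \<subseteq> H"
      have AC: "A \<subseteq> C" using C(1) HBs by simp
      have sum: "(\<Sum>P\<in>pairs H. card (line E0 P \<inter> Y) - 2) = (\<Sum>P\<in>pairs H. card (line ?E P \<inter> Y) - 2)"
        if "Y \<subseteq> H" for Y
      proof (rule sum.cong[OF refl])
        fix P assume "P \<in> pairs H"
        then have "line E0 P = line ?E P \<inter> H" by (intro line_E0) (simp add: pairs_def)
        then have "line E0 P \<inter> Y = line ?E P \<inter> Y" using that by blast
        then show "card (line E0 P \<inter> Y) - 2 = card (line ?E P \<inter> Y) - 2" by simp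
      qed
      have "finite C" "C \<subseteq> ?V" using C(2) finH HV finite_subset by auto
      then have "d0s (s_induced ?N A) \<le> d0s (s_induced ?N C)" using A AC by (simp add: s_strong_def)
      then show "card (H \<inter> Bs) + (\<Sum>P\<in>pairs H. card (line E0 P \<inter> C) - 2)
          \<le> card C + (\<Sum>P\<in>pairs H. card (line E0 P \<inter> (H \<inter> Bs)) - 2)"
        using d0s_S_reduct[OF N PN H(2,1)] d0s_S_reduct[OF N PN H(2) C(2)] sum[OF C(2)] sum[OF H(1)]
        unfolding HBs by linarith
    qed
    then show "d0s (s_induced ?N (f ` Bs)) \<le> d0s (s_induced ?N D)"
      unfolding X(2) using dim[OF BsZ] dim[OF X(1)] by linarith
  qed
  then have "strong_embedding h B ?N" using emb hB by (simp add: strong_embedding_def)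
  moreover have "h (g a) = a" if "a \<in> A" for a using that \<iota>_g f_id H(1) by (auto simp: h_def)
  ultimately show ?thesis by blast
qed

section \<open>Back and forth\<close>

definition d0s_nonneg :: "'a sstruct \<Rightarrow> bool" where
  "d0s_nonneg N \<longleftrightarrow> (\<forall>D. finite D \<and> D \<subseteq> univ N \<longrightarrow> 0 \<le> d0s (s_induced N D))"

text \<open>
  Also known as richness of \<open>N\<close> for \<open>\<K>\<close> and strong embeddings.
\<close>

definition saturated :: "nat sstruct set \<Rightarrow> 'a sstruct \<Rightarrow> bool" where
  "saturated \<K> N \<longleftrightarrow> (\<forall>A B g. s_strong A N \<and> B \<in> \<K> \<and> strong_embedding g (s_induced N A) B \<longrightarrow>
     (\<exists>h. strong_embedding h B N \<and> (\<forall>a\<in>A. h (g a) = a)))"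

definition partial_iso :: "'a sstruct \<Rightarrow> 'b sstruct \<Rightarrow> 'a set \<Rightarrow> ('a \<Rightarrow> 'b) \<Rightarrow> bool" where
  "partial_iso N N' A p \<longleftrightarrow> s_strong A N \<and> s_strong (p ` A) N' \<and>
     s_iso p (s_induced N A) (s_induced N' (p ` A))"

lemma s_strongD: "s_strong A N \<Longrightarrow> finite A" "s_strong A N \<Longrightarrow> A \<subseteq> univ N"
  by (auto simp: s_strong_def)

lemma age_copy:
  assumes N: "s_structure N" and D: "finite D" "D \<subseteq> univ N"
  shows "\<exists>B c. B \<in> age N \<and> s_iso c (s_induced N D) B"
proof -
  note ND = s_structure_induced[OF N D(2)]
  obtain c :: "'a \<Rightarrow> nat" where "inj_on c D" using finite_imp_inj_to_nat_seg[OF D(1)] by blast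
  then obtain B where B: "s_iso c (s_induced N D) B" "s_structure B" "univ B = c ` D"
    using s_iso_copy[OF ND, of c] by auto
  have "B \<in> age N"
    unfolding age_def using B D s_iso_inv[OF ND B(1)] by auto
  then show ?thesis using B(1) by blast
qed

lemma age_members: "B \<in> age N \<Longrightarrow> s_structure B" "B \<in> age N \<Longrightarrow> finite (univ B)"
  by (auto simp: age_def)

lemma d0s_induced_empty:
  assumes "s_structure N"
  shows "d0s (s_induced N {}) = 0"
  using d0s_weight[OF s_structure_induced[OF assms], of "{}"] by simp

lemma s_strong_empty: "s_structure N \<Longrightarrow> d0s_nonneg N \<Longrightarrow> s_strong {} N"
  by (simp add: s_strong_def d0s_nonneg_def d0s_induced_empty)

lemma d0s_nonneg_age:
  assumes N: "s_structure N" "d0s_nonneg N" and B: "B \<in> age N"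
  shows "d0s_nonneg B"
  unfolding d0s_nonneg_def
proof (intro allI impI, elim conjE)
  fix E assume E: "finite E" "E \<subseteq> univ B"
  obtain D f where D: "finite D" "D \<subseteq> univ N" and f: "s_iso f B (s_induced N D)"
    using B by (auto simp: age_def)
  have fE: "f ` E \<subseteq> D" using E(2) s_iso_image[OF f] by auto
  have "d0s (s_induced B E) = d0s (s_induced (s_induced N D) (f ` E))"
    using d0s_iso[OF s_structure_induced[OF age_members(1)[OF B] E(2)] _
        s_iso_restrict[OF age_members(1)[OF B] f E(2)]] E(1) by simp
  also have "\<dots> = d0s (s_induced N (f ` E))" by (rule d0s_induced_induced[OF N(1) D fE])
  also have "\<dots> \<ge> 0" using N(2) E(1) fE D(2) by (auto simp: d0s_nonneg_def)
  finally show "0 \<le> d0s (s_induced B E)" .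
qed

text \<open>
  Nonnegativity of the predimension only depends on the age, which determines the finite
  substructures up to isomorphism.
\<close>

lemma d0s_nonneg_transfer:
  assumes N: "s_structure N" and N': "d0s_nonneg N'" and age: "age N \<subseteq> age N'"
  shows "d0s_nonneg N"
  unfolding d0s_nonneg_def
proof (intro allI impI, elim conjE)
  fix D assume D: "finite D" "D \<subseteq> univ N"
  obtain B c where B: "B \<in> age N" "s_iso c (s_induced N D) B" using age_copy[OF N D] by blast
  obtain D' f where D': "finite D'" "D' \<subseteq> univ N'" and f: "s_iso f B (s_induced N' D')"
  proof -
    have "B \<in> age N'" using B(1) age by (rule subsetD[rotated])
    then show thesis using that unfolding age_def by blast
  qed
  have "d0s (s_induced N D) = d0s B"
    using d0s_iso[OF s_structure_induced[OF N D(2)] _ B(2)] D(1) by simp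
  also have "\<dots> = d0s (s_induced N' D')"
    using d0s_iso[OF age_members[OF B(1)] f] by simp
  finally show "0 \<le> d0s (s_induced N D)" using N' D' by (simp add: d0s_nonneg_def)
qed

lemma s_iso_empty:
  assumes "s_structure N" "s_structure N'"
  shows "s_iso p (s_induced N {}) (s_induced N' {})"
proof (rule s_isoI[OF s_structure_induced[OF assms(1)] s_structure_induced[OF assms(2)]])
  fix X assume "X \<subseteq> univ (s_induced N {})" "at_least3 X"
  then show "weight (s_induced N' {}) (p ` X) = weight (s_induced N {}) X"
    by (simp add: at_least3_def)
qed (simp_all add: bij_betw_def)

lemma partial_iso_inverse:
  assumes N: "s_structure N" "s_structure N'" and p: "partial_iso N N' A p"
  shows "partial_iso N' N (p ` A) (inv_into A p)"
proof -
  have AN: "A \<subseteq> univ N" using p by (auto simp: partial_iso_def s_strong_def)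
  have iso: "s_iso p (s_induced N A) (s_induced N' (p ` A))" using p by (simp add: partial_iso_def)
  have inv: "s_iso (inv_into A p) (s_induced N' (p ` A)) (s_induced N A)"
    using s_iso_inv[OF s_structure_induced[OF N(1) AN] iso] by simp
  moreover have "inv_into A p ` p ` A = A" using s_iso_inj[OF iso] by (simp add: inv_into_image_cancel)
  ultimately show ?thesis using p by (simp add: partial_iso_def)
qed

text \<open>
  The structure on \<open>A'\<close> is copied to natural numbers, where it is a member of the age that strongly
  extends a copy of the image of \<open>p\<close>.
\<close>

lemma partial_iso_extend:
  assumes N: "s_structure N" and N': "s_structure N'" and sat: "saturated \<K> N'" and age: "age N \<subseteq> \<K>"
    and p: "partial_iso N N' A p" and A': "A \<subseteq> A'" "s_strong A' N"
  shows "\<exists>q. partial_iso N N' A' q \<and> (\<forall>a\<in>A. q a = p a)"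
proof -
  have fin: "finite A'" and sub: "A' \<subseteq> univ N" using A'(2) by (auto simp: s_strong_def)
  obtain B c where B: "B \<in> age N" and c: "s_iso c (s_induced N A') B" using age_copy[OF N fin sub] by blast
  note NA' = s_structure_induced[OF N sub] and B_s = age_members[OF B]
  have p_strong: "s_strong A N" "s_strong (p ` A) N'" and p_iso: "s_iso p (s_induced N A) (s_induced N' (p ` A))"
    using p by (auto simp: partial_iso_def)
  have AN: "A \<subseteq> univ N" using p_strong(1) by (rule s_strongD)
  have inj_p: "inj_on p A" using s_iso_inj[OF p_iso] by simp
  define g where "g = c \<circ> inv_into A p"
  have g_img: "g ` p ` A = c ` A"
    unfolding g_def image_comp[symmetric] inv_into_image_cancel[OF inj_p order_refl] ..
  have cA: "c ` A \<subseteq> univ B" using s_iso_image[OF c] A'(1) by auto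
  have inv: "s_iso (inv_into A p) (s_induced N' (p ` A)) (s_induced N A)"
    using s_iso_inv[OF s_structure_induced[OF N AN] p_iso] by simp
  have A_univ: "A \<subseteq> univ (s_induced N A')" using A'(1) by simp
  have cA_iso: "s_iso c (s_induced N A) (s_induced B (c ` A))"
    using s_iso_comp[OF s_iso_induced_induced(2)[OF N sub A'(1)] s_iso_restrict[OF NA' c A_univ]] by simp
  have "s_iso g (s_induced N' (p ` A)) (s_induced B (c ` A))"
    unfolding g_def by (rule s_iso_comp[OF inv cA_iso])
  moreover have "s_strong (c ` A) B"
    by (rule s_strong_iso[OF NA' c s_strong_induced[OF N p_strong(1) A'(1) fin sub]])
  ultimately have "strong_embedding g (s_induced N' (p ` A)) B"
    using g_img cA by (simp add: strong_embedding_def s_embedding_def)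
  then obtain h where h: "strong_embedding h B N'" and h_g: "\<forall>b\<in>p ` A. h (g b) = b"
    using sat p_strong(2) B age unfolding saturated_def by blast
  define q where "q = h \<circ> c"
  have h_iso: "s_iso h B (s_induced N' (h ` univ B))" and h_strong: "s_strong (h ` univ B) N'"
    using h by (auto simp: strong_embedding_def s_embedding_def)
  have "c ` A' = univ B" using s_iso_image[OF c] by simp
  then have "q ` A' = h ` univ B" unfolding q_def by (simp only: image_comp[symmetric])
  then have "partial_iso N N' A' q"
    using s_iso_comp[OF c h_iso] h_strong A'(2) by (simp add: partial_iso_def q_def)
  moreover have "q a = p a" if "a \<in> A" for a
    using h_g that inj_p by (simp add: q_def g_def)
  ultimately show ?thesis by blast
qed

text \<open>
  Choose three points of \<open>X\<close>.  Only finitely many cliques contain them, and each of these other than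
  \<open>X\<close> is separated from \<open>X\<close> by a point that the chain reaches.  From then on \<open>X\<close> is the only set
  that can contribute to the weight of its trace.
\<close>

lemma weight_eventually:
  assumes N: "s_structure N" and A: "mono A" "(\<Union>n. A n) = univ N"
    and X: "X \<subseteq> univ N" "at_least3 X"
  shows "eventually (\<lambda>n. weight (s_induced N (A n)) (X \<inter> A n) = weight N X) sequentially"
proof -
  have reach: "eventually (\<lambda>n. x \<in> A n) sequentially" if "x \<in> univ N" for x
  proof -
    obtain m where "x \<in> A m" using A(2) \<open>x \<in> univ N\<close> by blast
    then have "x \<in> A n" if "m \<le> n" for n using monoD[OF A(1) that] by blast
    then show ?thesis by (auto simp: eventually_sequentially)
  qed
  obtain Y where Y: "Y \<subseteq> X" "finite Y" "at_least3 Y" using at_least3_obtain[OF X(2)] by metis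
  have "\<forall>y\<in>Y. eventually (\<lambda>n. y \<in> A n) sequentially" using reach Y(1) X(1) by blast
  then have ev1: "eventually (\<lambda>n. \<forall>y\<in>Y. y \<in> A n) sequentially" by (rule eventually_ball_finite[OF Y(2)])
  have "\<forall>C\<in>{C \<in> cliques N. Y \<subseteq> C}. eventually (\<lambda>n. C \<inter> A n = X \<inter> A n \<longrightarrow> C = X) sequentially"
  proof
    fix C assume C: "C \<in> {C \<in> cliques N. Y \<subseteq> C}"
    show "eventually (\<lambda>n. C \<inter> A n = X \<inter> A n \<longrightarrow> C = X) sequentially"
    proof (cases "C = X")
      case False
      then obtain z where z: "z \<in> C \<longleftrightarrow> z \<notin> X" by blast
      have "C \<subseteq> univ N" using C s_structure_clique(1)[OF N] by blast
      then have "z \<in> univ N" using z X(1) by blast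
      then show ?thesis
      proof (rule eventually_mono[OF reach])
        fix n assume "z \<in> A n"
        then show "C \<inter> A n = X \<inter> A n \<longrightarrow> C = X" using z by blast
      qed
    qed simp
  qed
  then have ev2: "eventually (\<lambda>n. \<forall>C\<in>{C \<in> cliques N. Y \<subseteq> C}. C \<inter> A n = X \<inter> A n \<longrightarrow> C = X) sequentially"
    by (rule eventually_ball_finite[OF finite_cliques_above[OF N Y(3)]])
  show ?thesis
  proof (rule eventually_mono[OF eventually_conj[OF ev1 ev2]], elim conjE)
    fix n assume n: "\<forall>y\<in>Y. y \<in> A n" "\<forall>C\<in>{C \<in> cliques N. Y \<subseteq> C}. C \<inter> A n = X \<inter> A n \<longrightarrow> C = X"
    have YX: "Y \<subseteq> X \<inter> A n" using n(1) Y(1) by blast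
    have "at_least3 (X \<inter> A n)" by (rule at_least3_mono[OF Y(3) YX])
    then have w: "weight (s_induced N (A n)) (X \<inter> A n) = (\<Sum>C | C \<in> cliques N \<and> C \<inter> A n = X \<inter> A n. mult N C)"
      by (simp add: weight_induced[OF N])
    have "{C. C \<in> cliques N \<and> C \<inter> A n = X \<inter> A n} = (if X \<in> cliques N then {X} else {})"
    proof -
      have "C = X" if "C \<in> cliques N" "C \<inter> A n = X \<inter> A n" for C
      proof -
        have "Y \<subseteq> C" using YX that(2) by blast
        then show ?thesis using n(2) that by blast
      qed
      then show ?thesis by auto
    qed
    then show "weight (s_induced N (A n)) (X \<inter> A n) = weight N X"
      unfolding w by (simp add: weight_def)
  qed
qed

text \<open>
  Cliques may be infinite, so they are not visible in any member of the chain; their weights are,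
  in the limit.
\<close>

lemma s_iso_chain:
  fixes A :: "nat \<Rightarrow> 'a set"
  assumes N: "s_structure N" and N': "s_structure N'"
    and A: "mono A" "(\<Union>n. A n) = univ N" and h: "bij_betw h (univ N) (univ N')"
    and iso: "\<And>n. s_iso h (s_induced N (A n)) (s_induced N' (h ` A n))"
  shows "s_iso h N N'"
proof (rule s_isoI[OF N N' h])
  fix X assume X: "X \<subseteq> univ N" "at_least3 X"
  have inj: "inj_on h (univ N)" and img: "h ` univ N = univ N'" using h by (auto simp: bij_betw_def)
  have AN: "A n \<subseteq> univ N" for n using A(2) by blast
  have mono': "mono (\<lambda>n. h ` A n)" using A(1) by (simp add: mono_def image_mono)
  have union': "(\<Union>n. h ` A n) = univ N'" using A(2) img by (simp add: image_UN[symmetric])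
  have hX: "h ` X \<subseteq> univ N'" using X(1) img by blast
  have hX3: "at_least3 (h ` X)" using X(2) at_least3_image[OF inj_on_subset[OF inj X(1)]] by simp
  have "eventually (\<lambda>n. weight N' (h ` X) = weight N X) sequentially"
  proof (rule eventually_mono[OF eventually_conj[OF weight_eventually[OF N A X]
          weight_eventually[OF N' mono' union' hX hX3]]], elim conjE)
    fix n assume e: "weight (s_induced N (A n)) (X \<inter> A n) = weight N X"
      "weight (s_induced N' (h ` A n)) (h ` X \<inter> h ` A n) = weight N' (h ` X)"
    have "h ` X \<inter> h ` A n = h ` (X \<inter> A n)" using inj_on_image_Int[OF inj X(1) AN] by simp
    moreover have "weight (s_induced N' (h ` A n)) (h ` (X \<inter> A n)) = weight (s_induced N (A n)) (X \<inter> A n)"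
      by (rule s_iso_weight[OF s_structure_induced[OF N AN] iso]) simp
    ultimately show "weight N' (h ` X) = weight N X" using e by simp
  qed
  then show "weight N' (h ` X) = weight N X" by simp
qed

text \<open>
  Forth over a strong hull of \<open>A \<union> X\<close>, then back over a strong hull of the image together with \<open>X'\<close>.
\<close>

lemma partial_iso_step:
  assumes N: "s_structure N" "d0s_nonneg N" and N': "s_structure N'" "d0s_nonneg N'"
    and sat: "saturated \<K> N" "saturated \<K> N'" and age: "age N \<subseteq> \<K>" "age N' \<subseteq> \<K>"
    and p: "partial_iso N N' A p"
    and X: "finite X" "X \<subseteq> univ N" and X': "finite X'" "X' \<subseteq> univ N'"
  shows "\<exists>B q. partial_iso N N' B q \<and> A \<subseteq> B \<and> X \<subseteq> B \<and> X' \<subseteq> q ` B \<and> (\<forall>a\<in>A. q a = p a)"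
proof -
  have A: "finite A" "A \<subseteq> univ N" using p by (auto simp: partial_iso_def s_strong_def)
  have "finite (A \<union> X)" "A \<union> X \<subseteq> univ N" using A X by auto
  then obtain A1 where A1: "A \<union> X \<subseteq> A1" "s_strong A1 N"
    using s_strong_closure[of N "A \<union> X"] N(2) by (auto simp: d0s_nonneg_def)
  then obtain q1 where q1: "partial_iso N N' A1 q1" "\<forall>a\<in>A. q1 a = p a"
    using partial_iso_extend[OF N(1) N'(1) sat(2) age(1) p, of A1] by blast
  define r where "r = inv_into A1 q1"
  have r: "partial_iso N' N (q1 ` A1) r"
    unfolding r_def by (rule partial_iso_inverse[OF N(1) N'(1) q1(1)])
  have inj_q1: "inj_on q1 A1" using q1(1) s_iso_inj by (fastforce simp: partial_iso_def)
  have r_q1: "r (q1 a) = a" if "a \<in> A1" for a using inj_q1 that by (simp add: r_def)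
  have "finite (q1 ` A1 \<union> X')" "q1 ` A1 \<union> X' \<subseteq> univ N'"
    using r X' by (auto simp: partial_iso_def s_strong_def)
  then obtain B where B: "q1 ` A1 \<union> X' \<subseteq> B" "s_strong B N'"
    using s_strong_closure[of N' "q1 ` A1 \<union> X'"] N'(2) by (auto simp: d0s_nonneg_def)
  then obtain r' where r': "partial_iso N' N B r'" "\<forall>b\<in>q1 ` A1. r' b = r b"
    using partial_iso_extend[OF N'(1) N(1) sat(1) age(2) r, of B] by blast
  have inj_r': "inj_on r' B" using r'(1) s_iso_inj by (fastforce simp: partial_iso_def)
  define q where "q = inv_into B r'"
  have q: "partial_iso N N' (r' ` B) q"
    unfolding q_def by (rule partial_iso_inverse[OF N'(1) N(1) r'(1)])
  have r'_q1: "r' (q1 a) = a" if "a \<in> A1" for a using r'(2) r_q1 that by simp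
  have "q a = q1 a" if "a \<in> A1" for a
  proof -
    have "q1 a \<in> B" using B(1) that by blast
    then have "q (r' (q1 a)) = q1 a" using inj_r' by (simp add: q_def)
    then show ?thesis using r'_q1[OF that] by simp
  qed
  then have "\<forall>a\<in>A. q a = p a" using q1(2) A1(1) by auto
  moreover have sub: "A1 \<subseteq> r' ` B"
  proof
    fix a assume "a \<in> A1"
    then have "r' (q1 a) = a" "q1 a \<in> B" using r'_q1 B(1) by blast+
    then show "a \<in> r' ` B" by force
  qed
  moreover have "q ` r' ` B = B" using inv_into_image_cancel[OF inj_r' order_refl] by (simp add: q_def)
  then have "X' \<subseteq> q ` r' ` B" using B(1) by simp
  ultimately show ?thesis using q A1(1) by blast
qed

theorem back_and_forth:
  assumes N: "s_structure N" "d0s_nonneg N" "countable (univ N)"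
    and N': "s_structure N'" "d0s_nonneg N'" "countable (univ N')"
    and sat: "saturated \<K> N" "saturated \<K> N'" and age: "age N \<subseteq> \<K>" "age N' \<subseteq> \<K>"
    and p: "partial_iso N N' A p"
  shows "\<exists>\<sigma>. s_iso \<sigma> N N' \<and> (\<forall>a\<in>A. \<sigma> a = p a)"
proof -
  let ?X = "\<lambda>n. {x \<in> univ N. to_nat_on (univ N) x = n}"
  let ?X' = "\<lambda>n. {x \<in> univ N'. to_nat_on (univ N') x = n}"
  have finX: "finite (?X n)" for n
    by (rule inj_on_finite[of _ _ "{n}"]) (use inj_on_to_nat_on[OF N(3)] in \<open>auto intro: inj_on_subset\<close>)
  have finX': "finite (?X' n)" for n
    by (rule inj_on_finite[of _ _ "{n}"]) (use inj_on_to_nat_on[OF N'(3)] in \<open>auto intro: inj_on_subset\<close>)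
  define P where "P n s \<longleftrightarrow> partial_iso N N' (fst s) (snd s) \<and> (n = 0 \<longrightarrow> s = (A, p))" for n :: nat and s
  \<comment> \<open>Stage \<open>n\<close> takes care of the points numbered \<open>n\<close> in either structure; there is at most one each,
    and treating them as finite sets covers empty and finite universes as well.\<close>
  define Q where "Q n s t \<longleftrightarrow> fst s \<subseteq> fst t \<and> ?X n \<subseteq> fst t \<and> ?X' n \<subseteq> snd t ` fst t \<and>
    (\<forall>a\<in>fst s. snd t a = snd s a)" for n s t
  have "\<exists>S. \<forall>n. P n (S n) \<and> Q n (S n) (S (Suc n))"
  proof (rule dependent_nat_choice)
    show "\<exists>s. P 0 s" using p by (auto simp: P_def)
    fix s n assume "P n s"
    then have s: "partial_iso N N' (fst s) (snd s)" by (simp add: P_def)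
    have "?X n \<subseteq> univ N" "?X' n \<subseteq> univ N'" by auto
    from partial_iso_step[OF N(1,2) N'(1,2) sat age s finX this(1) finX' this(2)]
    obtain B q where "partial_iso N N' B q" "fst s \<subseteq> B" "?X n \<subseteq> B" "?X' n \<subseteq> q ` B" "\<forall>a\<in>fst s. q a = snd s a"
      by (elim exE conjE)
    then show "\<exists>t. P (Suc n) t \<and> Q n s t"
      unfolding P_def Q_def by (intro exI[of _ "(B, q)"]) simp
  qed
  then obtain S where S: "\<And>n. P n (S n)" "\<And>n. Q n (S n) (S (Suc n))" by metis
  define D where "D n = fst (S n)" for n
  define f where "f n = snd (S n)" for n
  have part: "partial_iso N N' (D n) (f n)" for n using S(1)[of n] by (simp add: P_def D_def f_def)
  have D_sub: "D n \<subseteq> univ N" for n using part[of n] by (auto simp: partial_iso_def s_strong_def)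
  have fD_sub: "f n ` D n \<subseteq> univ N'" for n using part[of n] by (auto simp: partial_iso_def s_strong_def)
  have inj_f: "inj_on (f n) (D n)" for n
  proof -
    have "s_iso (f n) (s_induced N (D n)) (s_induced N' (f n ` D n))"
      using part[of n] by (simp add: partial_iso_def)
    from s_iso_inj[OF this] show ?thesis by simp
  qed
  have D0: "D 0 = A" "f 0 = p" using S(1)[of 0] by (simp_all add: P_def D_def f_def)
  have step: "D n \<subseteq> D (Suc n)" "?X n \<subseteq> D (Suc n)" "?X' n \<subseteq> f (Suc n) ` D (Suc n)"
    "\<And>a. a \<in> D n \<Longrightarrow> f (Suc n) a = f n a" for n
    using S(2)[of n] by (auto simp: Q_def D_def f_def)
  have mono_D: "mono D" using step(1) by (rule incseq_SucI)
  have D_le: "D n \<subseteq> D m" if "n \<le> m" for n m by (rule monoD[OF mono_D that])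
  note f_Suc = step(4)
  have agree: "f m a = f n a" if "n \<le> m" "a \<in> D n" for n m a
    using that(1)
  proof (induction m rule: dec_induct)
    case (step m)
    have "a \<in> D m" using D_le[OF step(1)] that(2) by blast
    then show ?case using step(3) f_Suc by simp
  qed simp
  define h where "h x = f (LEAST n. x \<in> D n) x" for x
  have h: "h x = f n x" if "x \<in> D n" for n x
    unfolding h_def
    by (rule agree[symmetric, OF Least_le[of "\<lambda>n. x \<in> D n"] LeastI[of "\<lambda>n. x \<in> D n"], OF that that])
  have h_img: "h ` D n = f n ` D n" for n by (rule image_cong[OF refl h])
  have union: "(\<Union>n. D n) = univ N"
  proof
    show "univ N \<subseteq> (\<Union>n. D n)"
    proof
      fix x assume "x \<in> univ N"
      then have "x \<in> D (Suc (to_nat_on (univ N) x))" using step(2) by blast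
      then show "x \<in> (\<Union>n. D n)" by blast
    qed
  qed (use D_sub in blast)
  have bij: "bij_betw h (univ N) (univ N')"
    unfolding bij_betw_def
  proof
    show "inj_on h (univ N)"
    proof (rule inj_onI)
      fix x y assume xy: "x \<in> univ N" "y \<in> univ N" "h x = h y"
      obtain m n where "x \<in> D m" "y \<in> D n" using xy(1,2) union by blast
      then have "x \<in> D (max m n)" "y \<in> D (max m n)"
        using D_le[of m "max m n"] D_le[of n "max m n"] by auto
      then show "x = y" using xy(3) h inj_onD[OF inj_f] by metis
    qed
    have "h ` univ N = (\<Union>n. f n ` D n)"
      unfolding union[symmetric] image_UN by (simp only: h_img)
    also have "\<dots> = univ N'"
    proof
      show "univ N' \<subseteq> (\<Union>n. f n ` D n)"
      proof
        fix y assume "y \<in> univ N'"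
        then have "y \<in> f (Suc (to_nat_on (univ N') y)) ` D (Suc (to_nat_on (univ N') y))"
          using step(3)[of "to_nat_on (univ N') y"] by blast
        then show "y \<in> (\<Union>n. f n ` D n)" by blast
      qed
    qed (use fD_sub in blast)
    finally show "h ` univ N = univ N'" .
  qed
  have "s_iso h N N'"
  proof (rule s_iso_chain[OF N(1) N'(1) mono_D union bij])
    fix n
    have "s_iso (f n) (s_induced N (D n)) (s_induced N' (f n ` D n))" using part[of n] by (simp add: partial_iso_def)
    then show "s_iso h (s_induced N (D n)) (s_induced N' (h ` D n))"
      unfolding h_img by (rule s_iso_induced_cong[OF N(1) D_sub N'(1) fD_sub _ h])
  qed
  moreover have "\<forall>a\<in>A. h a = p a" using h[of _ 0] D0 by simp
  ultimately show ?thesis by blast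
qed

text \<open>
  \<open>B\<close> embeds strongly somewhere, by \<open>e\<close>.  Homogeneity moves the copy of \<open>A\<close> inside \<open>e(B)\<close> back to \<open>A\<close>,
  and the rest of \<open>e(B)\<close> with it.
\<close>

lemma fraisse_limit_saturated:
  assumes lim: "fraisse_limit \<K> N"
  shows "saturated \<K> N"
  unfolding saturated_def
proof (intro allI impI, elim conjE)
  fix A B and g :: "'a \<Rightarrow> nat"
  assume A: "s_strong A N" and B: "B \<in> \<K>" and g: "strong_embedding g (s_induced N A) B"
  have N: "s_structure N" and ageN: "age N = \<K>" using lim by (auto simp: fraisse_limit_def)
  have hom: "\<exists>\<sigma>. s_iso \<sigma> N N \<and> (\<forall>a\<in>A. \<sigma> a = f a)"
    if "s_strong A N" "s_strong B N" "s_iso f (s_induced N A) (s_induced N B)" for A B f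
    using lim that unfolding fraisse_limit_def by blast
  have Bs: "s_structure B" using B ageN age_members by blast
  obtain e where e: "strong_embedding e B N" using lim B unfolding fraisse_limit_def by blast
  have e_iso: "s_iso e B (s_induced N (e ` univ B))" and e_strong: "s_strong (e ` univ B) N"
    and e_sub: "e ` univ B \<subseteq> univ N"
    using e by (auto simp: strong_embedding_def s_embedding_def)
  have g_iso: "s_iso g (s_induced N A) (s_induced B (g ` A))" and gB: "g ` A \<subseteq> univ B"
    and g_strong: "s_strong (g ` A) B"
    using g by (auto simp: strong_embedding_def s_embedding_def)
  have A_sub: "A \<subseteq> univ N" using A by (rule s_strongD)
  let ?A1 = "e ` g ` A"
  have sub: "?A1 \<subseteq> e ` univ B" using gB by blast
  have A1: "s_strong ?A1 N"
    by (rule s_strong_induced_trans[OF N e_strong s_strong_iso[OF Bs e_iso g_strong]])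
  have A1_sub: "?A1 \<subseteq> univ N" using sub e_sub by blast
  have "s_iso e (s_induced B (g ` A)) (s_induced N ?A1)"
    using s_iso_comp[OF s_iso_restrict[OF Bs e_iso gB] s_iso_induced_induced(1)[OF N e_sub sub]] by simp
  from s_iso_comp[OF g_iso this] have eg: "s_iso (e \<circ> g) (s_induced N A) (s_induced N ?A1)" .
  have inj_eg: "inj_on (e \<circ> g) A" using s_iso_inj[OF eg] by simp
  have inv: "s_iso (inv_into A (e \<circ> g)) (s_induced N ?A1) (s_induced N A)"
    using s_iso_inv[OF s_structure_induced[OF N A_sub] eg] by simp
  obtain \<sigma> where \<sigma>: "s_iso \<sigma> N N" "\<forall>a\<in>?A1. \<sigma> a = inv_into A (e \<circ> g) a"
    using hom[OF A1 A inv] by blast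
  define h where "h = \<sigma> \<circ> e"
  have h_img: "h ` univ B = \<sigma> ` e ` univ B" by (simp add: h_def image_comp)
  have "h ` univ B \<subseteq> univ N" using h_img e_sub s_iso_image[OF \<sigma>(1)] by blast
  moreover have "s_iso h B (s_induced N (h ` univ B))"
    using s_iso_comp[OF e_iso s_iso_restrict[OF N \<sigma>(1) e_sub]] unfolding h_img h_def[symmetric] .
  moreover have "s_strong (h ` univ B) N"
    unfolding h_img by (rule s_strong_iso[OF N \<sigma>(1) e_strong])
  ultimately have "strong_embedding h B N" by (simp add: strong_embedding_def s_embedding_def)
  moreover have "h (g a) = a" if "a \<in> A" for a
  proof -
    have "h (g a) = inv_into A (e \<circ> g) ((e \<circ> g) a)" using \<sigma>(2) that by (simp add: h_def)
    then show ?thesis using inv_into_f_f[OF inj_eg that] by simp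
  qed
  ultimately show "\<exists>h. strong_embedding h B N \<and> (\<forall>a\<in>A. h (g a) = a)" by blast
qed

lemma saturated_fraisse_limit:
  assumes N: "s_structure N" "d0s_nonneg N" "countable (univ N)" and sat: "saturated (age N) N"
  shows "fraisse_limit (age N) N"
  unfolding fraisse_limit_def
proof (intro conjI ballI allI impI; (elim conjE)?)
  fix B assume B: "B \<in> age N"
  note Bs = age_members(1)[OF B]
  have "s_strong {} B" by (rule s_strong_empty[OF Bs d0s_nonneg_age[OF N(1,2) B]])
  then have "strong_embedding g (s_induced N {}) B" for g :: "'a \<Rightarrow> nat"
    using s_iso_empty[OF N(1) Bs] by (simp add: strong_embedding_def s_embedding_def)
  then show "\<exists>f. strong_embedding f B N"
    using sat B s_strong_empty[OF N(1,2)] unfolding saturated_def by blast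
next
  fix A B f assume AB: "s_strong A N" "s_strong B N" and f: "s_iso f (s_induced N A) (s_induced N B)"
  have "f ` A = B" using s_iso_image[OF f] by simp
  then have "partial_iso N N A f" using AB f by (simp add: partial_iso_def)
  then show "\<exists>\<sigma>. s_iso \<sigma> N N \<and> (\<forall>a\<in>A. \<sigma> a = f a)"
    by (rule back_and_forth[OF N N sat sat order_refl order_refl])
qed (rule N(1) N(3) refl)+

lemma fraisse_limit_unique:
  assumes M: "s_structure M" "d0s_nonneg M" and lim: "fraisse_limit (age M) M" "fraisse_limit (age M) N"
  shows "\<exists>f. s_iso f N M"
proof -
  have N: "s_structure N" "countable (univ N)" "age N = age M" and cM: "countable (univ M)"
    using lim by (auto simp: fraisse_limit_def)
  have nonneg: "d0s_nonneg N" by (rule d0s_nonneg_transfer[OF N(1) M(2)]) (simp add: N(3))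
  have "partial_iso N M {} p" for p
    using s_strong_empty[OF N(1) nonneg] s_strong_empty[OF M] s_iso_empty[OF N(1) M(1)]
    by (simp add: partial_iso_def)
  then show ?thesis
    using back_and_forth[OF N(1) nonneg N(2) M cM lim(2,1)[THEN fraisse_limit_saturated]] N(3) by blast
qed

section \<open>The reduct is the limit\<close>

lemma S_reduct_props:
  assumes hr: "hrushovski_structure M"
  shows "s_structure (S_reduct M)" "d0s_nonneg (S_reduct M)" "countable (univ (S_reduct M))"
    "saturated (age (S_reduct M)) (S_reduct M)"
proof -
  have M: "r_structure M" "countable (runiv M)" using hr by (auto simp: hrushovski_structure_def)
  note nonneg = hrushovski_nonneg[OF hr]
  show N: "s_structure (S_reduct M)" by (rule s_structure_S_reduct[OF M(1) nonneg])
  have "s_strong {} (S_reduct M)" by (rule hstrong_imp_s_strong[OF M(1) nonneg hstrong_empty[OF hr]])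
  then show "d0s_nonneg (S_reduct M)" by (simp add: s_strong_def d0s_nonneg_def d0s_induced_empty[OF N])
  show "countable (univ (S_reduct M))" using M(2) by simp
  show "saturated (age (S_reduct M)) (S_reduct M)"
    unfolding saturated_def using S_reduct_extension[OF hr] age_members by blast
qed

theorem theorem5p9:
  fixes M :: "'a rstruct"
  assumes "hrushovski_structure M"
  shows "fraisse_limit (age (S_reduct M)) (S_reduct M) \<and>
    (\<forall>N :: 'b sstruct. fraisse_limit (age (S_reduct M)) N \<longrightarrow> (\<exists>f. s_iso f N (S_reduct M)))"
proof -
  note N = S_reduct_props[OF assms]
  have lim: "fraisse_limit (age (S_reduct M)) (S_reduct M)" by (rule saturated_fraisse_limit[OF N])
  then show ?thesis using fraisse_limit_unique[OF N(1,2) lim] by blast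
qed

end
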